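(* The finite satisfiability problem for $\mathrm{GF}^2_{pres}$ (given a sentence, decide whether it has a finite model) is decidable.
   Context: Structures are over relational signatures with unary and binary relation symbols and equality. The guarded fragment $\mathrm{GF}$ is the smallest set of first-order formulas containing all relational atoms and equalities between variables, closed under Boolean connectives, and such that if $\psi(\bar x,\bar y)\in\mathrm{GF}$ and $\gamma(\bar x,\bar y)$ is a relational atom containing all free variables of $\psi$, then $\forall\bar y\,(\gamma\to\psi)$ and $\exists\bar y\,(\gamma\wedge\psi)$ are in $\mathrm{GF}$. A local Presburger quantifier is an expression $\sum_{i=1}^n\lambda_i\cdot\#^{r_i}_y[\varphi_i(x,y)]\circledast\delta$ with integers $\lambda_i,\delta$, each $r_i$ equal to $R$ or $R^-$ for a binary symbol $R$, and $\circledast\in\{=,\neq,\le,\ge,<,>,\equiv_d,\not\equiv_d\}$ ($d\ge1$, $\equiv_d$ congruence mod $d$); it has free variable $x$, and $\mathcal{M},x/a$ satisfies it iff $\sum_i\lambda_i\cdot|\{b\in M:\mathcal{M}\models r_i(a,b)\wedge\varphi_i(a,b)\}|\circledast\delta$, where $R^-(a,b)$ means $R(b,a)$. $\mathrm{GF}_{pres}$ extends the definition of $\mathrm{GF}$ by closing under local Presburger quantifiers whose subformulas $\varphi_i(x,y)$ are themselves formulas of the logic with free variables among $x,y$. $\mathrm{GF}^2_{pres}$ is its fragment using only the variables $x,y$. *)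

theory Defs
  imports Main "HOL-Library.Nat_Bijection"
begin

datatype var = VX | VY

fun other :: "var \<Rightarrow> var" where
  "other VX = VY" | "other VY = VX"

datatype atom = UA nat var | BA nat var var

fun avars :: "atom \<Rightarrow> var set" where
  "avars (UA p v) = {v}"
| "avars (BA r v w) = {v, w}"

datatype cmp = CEq | CNe | CLe | CGe | CLt | CGt | CCong nat | CNCong nat

text \<open>Formulas.  ExG Q g phi is the guarded quantification  exists Q (g and phi),
  AllG Q g phi is  forall Q (g --> phi).  Pres v ts op delta is the local Presburger
  quantifier  sum_i lambda_i * #^{r_i}_{w}[phi_i] op delta  with free variable v and counted
  variable w = other v; each entry of ts is (lambda_i, R_i, inverted_i, phi_i) where
  inverted_i = True means r_i = R_i^-.\<close>
datatype fm =
    Atom atom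
  | Eq var var
  | Neg fm
  | Conj fm fm
  | Disj fm fm
  | ExG "var set" atom fm
  | AllG "var set" atom fm
  | Pres var "(int \<times> nat \<times> bool \<times> fm) list" cmp int

fun fv :: "fm \<Rightarrow> var set" where
  "fv (Atom a) = avars a"
| "fv (Eq v w) = {v, w}"
| "fv (Neg \<phi>) = fv \<phi>"
| "fv (Conj \<phi> \<psi>) = fv \<phi> \<union> fv \<psi>"
| "fv (Disj \<phi> \<psi>) = fv \<phi> \<union> fv \<psi>"
| "fv (ExG Q g \<phi>) = (avars g \<union> fv \<phi>) - Q"
| "fv (AllG Q g \<phi>) = (avars g \<union> fv \<phi>) - Q"
| "fv (Pres v ts c d) = {v}"

fun cmp_ok :: "cmp \<Rightarrow> bool" where
  "cmp_ok (CCong d) = (d \<ge> 1)"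
| "cmp_ok (CNCong d) = (d \<ge> 1)"
| "cmp_ok _ = True"

fun wf :: "fm \<Rightarrow> bool" where
  "wf (Atom a) = True"
| "wf (Eq v w) = True"
| "wf (Neg \<phi>) = wf \<phi>"
| "wf (Conj \<phi> \<psi>) = (wf \<phi> \<and> wf \<psi>)"
| "wf (Disj \<phi> \<psi>) = (wf \<phi> \<and> wf \<psi>)"
| "wf (ExG Q g \<phi>) = (Q \<subseteq> avars g \<and> fv \<phi> \<subseteq> avars g \<and> wf \<phi>)"
| "wf (AllG Q g \<phi>) = (Q \<subseteq> avars g \<and> fv \<phi> \<subseteq> avars g \<and> wf \<phi>)"
| "wf (Pres v ts c d) = (ts \<noteq> [] \<and> cmp_ok c \<and> (\<forall>t \<in> set ts. wf (snd (snd (snd t)))))"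

definition sentence :: "fm \<Rightarrow> bool" where
  "sentence \<phi> \<longleftrightarrow> wf \<phi> \<and> fv \<phi> = {}"

text \<open>A structure: a domain (a set of naturals; every finite structure is isomorphic to
  one of this form), interpretations of unary and binary symbols.\<close>
record struct =
  dom :: "nat set"
  urel :: "nat \<Rightarrow> nat \<Rightarrow> bool"
  brel :: "nat \<Rightarrow> nat \<Rightarrow> nat \<Rightarrow> bool"

fun asat :: "struct \<Rightarrow> atom \<Rightarrow> (var \<Rightarrow> nat) \<Rightarrow> bool" where
  "asat M (UA p v) \<sigma> = urel M p (\<sigma> v)"
| "asat M (BA r v w) \<sigma> = brel M r (\<sigma> v) (\<sigma> w)"

fun cmp_holds :: "cmp \<Rightarrow> int \<Rightarrow> int \<Rightarrow> bool" where
  "cmp_holds CEq s d = (s = d)"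
| "cmp_holds CNe s d = (s \<noteq> d)"
| "cmp_holds CLe s d = (s \<le> d)"
| "cmp_holds CGe s d = (s \<ge> d)"
| "cmp_holds CLt s d = (s < d)"
| "cmp_holds CGt s d = (s > d)"
| "cmp_holds (CCong m) s d = (s mod int m = d mod int m)"
| "cmp_holds (CNCong m) s d = (s mod int m \<noteq> d mod int m)"

definition rholds :: "struct \<Rightarrow> nat \<Rightarrow> bool \<Rightarrow> nat \<Rightarrow> nat \<Rightarrow> bool" where
  "rholds M R isinv a b = (if isinv then brel M R b a else brel M R a b)"

fun sat :: "struct \<Rightarrow> fm \<Rightarrow> (var \<Rightarrow> nat) \<Rightarrow> bool" where
  "sat M (Atom a) \<sigma> = asat M a \<sigma>"
| "sat M (Eq v w) \<sigma> = (\<sigma> v = \<sigma> w)"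
| "sat M (Neg \<phi>) \<sigma> = (\<not> sat M \<phi> \<sigma>)"
| "sat M (Conj \<phi> \<psi>) \<sigma> = (sat M \<phi> \<sigma> \<and> sat M \<psi> \<sigma>)"
| "sat M (Disj \<phi> \<psi>) \<sigma> = (sat M \<phi> \<sigma> \<or> sat M \<psi> \<sigma>)"
| "sat M (ExG Q g \<phi>) \<sigma> =
     (\<exists>\<sigma>'. (\<forall>v. v \<notin> Q \<longrightarrow> \<sigma>' v = \<sigma> v) \<and> (\<forall>v\<in>Q. \<sigma>' v \<in> dom M)
           \<and> asat M g \<sigma>' \<and> sat M \<phi> \<sigma>')"
| "sat M (AllG Q g \<phi>) \<sigma> =
     (\<forall>\<sigma>'. (\<forall>v. v \<notin> Q \<longrightarrow> \<sigma>' v = \<sigma> v) \<and> (\<forall>v\<in>Q. \<sigma>' v \<in> dom M)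
           \<longrightarrow> asat M g \<sigma>' \<longrightarrow> sat M \<phi> \<sigma>')"
| "sat M (Pres v ts c d) \<sigma> =
     cmp_holds c
       (sum_list (map (\<lambda>(l, R, isinv, \<phi>).
          l * int (card {b \<in> dom M. rholds M R isinv (\<sigma> v) b \<and> sat M \<phi> (\<sigma>(other v := b))})) ts))
       d"

definition fin_sat :: "fm \<Rightarrow> bool" where
  "fin_sat \<phi> \<longleftrightarrow> (\<exists>M \<sigma>. finite (dom M) \<and> dom M \<noteq> {} \<and> (\<forall>v. \<sigma> v \<in> dom M) \<and> sat M \<phi> \<sigma>)"

fun enc_var :: "var \<Rightarrow> nat" where
  "enc_var VX = 0" | "enc_var VY = 1"

fun enc_atom :: "atom \<Rightarrow> nat" where
  "enc_atom (UA p v) = prod_encode (0, prod_encode (p, enc_var v))"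
| "enc_atom (BA r v w) = prod_encode (1, prod_encode (r, prod_encode (enc_var v, enc_var w)))"

definition enc_vset :: "var set \<Rightarrow> nat" where
  "enc_vset Q = prod_encode (of_bool (VX \<in> Q), of_bool (VY \<in> Q))"

fun enc_cmp :: "cmp \<Rightarrow> nat" where
  "enc_cmp CEq = prod_encode (0, 0)"
| "enc_cmp CNe = prod_encode (1, 0)"
| "enc_cmp CLe = prod_encode (2, 0)"
| "enc_cmp CGe = prod_encode (3, 0)"
| "enc_cmp CLt = prod_encode (4, 0)"
| "enc_cmp CGt = prod_encode (5, 0)"
| "enc_cmp (CCong m) = prod_encode (6, m)"
| "enc_cmp (CNCong m) = prod_encode (7, m)"

fun enc :: "fm \<Rightarrow> nat" where
  "enc (Atom a) = prod_encode (0, enc_atom a)"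
| "enc (Eq v w) = prod_encode (1, prod_encode (enc_var v, enc_var w))"
| "enc (Neg \<phi>) = prod_encode (2, enc \<phi>)"
| "enc (Conj \<phi> \<psi>) = prod_encode (3, prod_encode (enc \<phi>, enc \<psi>))"
| "enc (Disj \<phi> \<psi>) = prod_encode (4, prod_encode (enc \<phi>, enc \<psi>))"
| "enc (ExG Q g \<phi>) = prod_encode (5, prod_encode (enc_vset Q, prod_encode (enc_atom g, enc \<phi>)))"
| "enc (AllG Q g \<phi>) = prod_encode (6, prod_encode (enc_vset Q, prod_encode (enc_atom g, enc \<phi>)))"
| "enc (Pres v ts c d) = prod_encode (7, prod_encode (enc_var v, prod_encode
     (list_encode (map (\<lambda>(l, R, isinv, \<phi>).
        prod_encode (int_encode l, prod_encode (R, prod_encode (of_bool isinv, enc \<phi>)))) ts),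
      prod_encode (enc_cmp c, int_encode d))))"

datatype recf = Zf | Sf | Idf nat nat | Cnf recf "recf list" | Prf recf recf | Mnf recf

inductive rf_eval :: "recf \<Rightarrow> nat list \<Rightarrow> nat \<Rightarrow> bool" where
  zero: "rf_eval Zf xs 0"
| succ: "rf_eval Sf [x] (Suc x)"
| proj: "i < n \<Longrightarrow> length xs = n \<Longrightarrow> rf_eval (Idf n i) xs (xs ! i)"
| comp: "list_all2 (\<lambda>g y. rf_eval g xs y) gs ys \<Longrightarrow> rf_eval f ys z \<Longrightarrow> rf_eval (Cnf f gs) xs z"
| pr0: "rf_eval f xs y \<Longrightarrow> rf_eval (Prf f g) (0 # xs) y"
| prS: "rf_eval (Prf f g) (k # xs) y \<Longrightarrow> rf_eval g (k # y # xs) z \<Longrightarrow> rf_eval (Prf f g) (Suc k # xs) z"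
| mn: "rf_eval f (y # xs) 0 \<Longrightarrow> (\<forall>i<y. \<exists>z. 0 < z \<and> rf_eval f (i # xs) z) \<Longrightarrow> rf_eval (Mnf f) xs y"

definition decidable_set :: "nat set \<Rightarrow> bool" where
  "decidable_set S \<longleftrightarrow> (\<exists>f. \<forall>n. rf_eval f [n] (if n \<in> S then 1 else 0))"

end

theory Submission
  imports Defs "HOL-Library.Multiset" "HOL-Library.FuncSet"
begin

text \<open>A sentence with code \<open>N\<close> that has a finite model has one of size at most a recursive function
  of \<open>N\<close>, so finite satisfiability is decided by a bounded search over coded structures.

  For the bound, label every pair of distinct related elements of a finite model by its kind (the truth
  values of all formulas with small codes at that pair). Every truth value of a local Presburger formula
  at an element is a condition on the sign and on a residue of a weighted sum of kinds over its
  neighbours. By a prefix-sum argument, a multiset of bounded integer vectors with sum zero splits into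
  zero-sum pieces of bounded size. Applied to the neighbourhood of each element, this yields one base
  piece and several neutral pieces; applied again to all pieces together, with the requirement that
  each kind be balanced against the reversed kind, it yields a bounded balanced multiset of pieces with
  the same support. Attaching the neutral pieces to base pieces and gluing half-edges in
  sufficiently many copies gives a small structure that satisfies the same sentence. Guardedness ensures
  that unrelated pairs never matter.\<close>

section \<open>Zero-sum partitions\<close>

text \<open>Degrees in finite models are unbounded, so there are infinitely many possible
  neighbourhoods and no bound can come from counting them. Pieces of bounded size come in boundedly
  many types, which makes the second splitting possible: the imbalance of a piece between a kind and
  its reverse is at most its size. A neutral piece may be moved to another element only if it cannot
  push a sum across its threshold. Hence every sum is replaced by a representative near the
  threshold, the remaining distance is recorded by units worth one modulus, and pieces are exchanged
  only between elements with the same colour and the same representatives. The set of recorded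
  formulas is cut off by code rather than generated from subformulas: it is finite with a computable
  bound, which also bounds coefficients and moduli, and it contains the counting formulas that
  express guarded quantification of one variable. What remains non-local is the existence of an
  element with a given property, which only needs that both structures show the same
  colours.\<close>

lemma sum_mset_int_nonneg: "\<forall>x\<in>#X. 0 \<le> f x \<Longrightarrow> (0::int) \<le> (\<Sum>x\<in>#X. f x)"
  by (induction X) auto

lemma sum_mset_int_nonpos: "\<forall>x\<in>#X. f x \<le> 0 \<Longrightarrow> (\<Sum>x\<in>#X. f x) \<le> (0::int)"
  by (induction X) auto

text \<open>Greedy ordering: after a positive partial sum take a negative element, otherwise a
  nonnegative one; it exists because the rest must bring the total back to zero. No step then leaves
  the interval from \<open>- C\<close> to \<open>C\<close>. The offset \<open>p\<close> is the sum
  of what has already been placed.\<close>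

lemma bounded_prefix_sums:
  fixes w :: "'a \<Rightarrow> int"
  assumes "\<forall>x\<in>#X. \<bar>w x\<bar> \<le> C" "(\<Sum>x\<in>#X. w x) = - p" "\<bar>p\<bar> \<le> C"
  shows "\<exists>xs. mset xs = X \<and> (\<forall>i. \<bar>p + sum_list (map w (take i xs))\<bar> \<le> C)"
  using assms
proof (induction "size X" arbitrary: X p)
  case 0
  then show ?case by simp
next
  case (Suc n)
  obtain x where x: "x \<in># X" "\<bar>p + w x\<bar> \<le> C"
  proof (cases "p > 0")
    case True
    have "\<exists>x\<in>#X. w x < 0"
    proof (rule ccontr)
      assume "\<not> ?thesis"
      then have "0 \<le> (\<Sum>x\<in>#X. w x)" by (intro sum_mset_int_nonneg) (auto simp: not_less)
      with Suc.prems True show False by simp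
    qed
    then obtain x where "x \<in># X" "w x < 0" by blast
    with Suc.prems True that[of x] show ?thesis by fastforce
  next
    case False
    have "\<exists>x\<in>#X. w x \<ge> 0"
    proof (rule ccontr)
      assume neg: "\<not> ?thesis"
      from Suc.hyps obtain y Z where X: "X = add_mset y Z"
        by (metis size_eq_Suc_imp_eq_union)
      have "(\<Sum>x\<in>#Z. w x) \<le> 0" using neg X by (intro sum_mset_int_nonpos) auto
      moreover have "w y < 0" using neg X by auto
      ultimately show False using Suc.prems X False by simp
    qed
    then obtain x where "x \<in># X" "w x \<ge> 0" by blast
    with Suc.prems False that[of x] show ?thesis by fastforce
  qed
  define Z where "Z = X - {#x#}"
  have X: "X = add_mset x Z" using x by (simp add: Z_def)
  have "\<exists>xs. mset xs = Z \<and> (\<forall>i. \<bar>(p + w x) + sum_list (map w (take i xs))\<bar> \<le> C)"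
    using Suc.prems Suc.hyps(2) x by (intro Suc.hyps(1)) (auto simp: X)
  then obtain xs where xs: "mset xs = Z" "\<And>i. \<bar>(p + w x) + sum_list (map w (take i xs))\<bar> \<le> C" by blast
  have "\<bar>p + sum_list (map w (take i (x # xs)))\<bar> \<le> C" for i
    using xs(2) Suc.prems(3) by (cases i) (simp_all add: add.assoc)
  with xs X show ?case by (intro exI[of _ "x # xs"]) simp
qed

text \<open>Pigeonhole: more than \<open>2 * C + 1\<close> prefix sums of a bounded ordering take at
  most \<open>2 * C + 1\<close> values, so two coincide and the segment between them sums to zero.
  Only prefixes shorter than the whole list are compared, which keeps the segment a proper
  part.\<close>

lemma zero_sum_split:
  fixes w :: "'a \<Rightarrow> int" and C :: nat
  assumes "\<forall>x\<in>#X. \<bar>w x\<bar> \<le> int C" "(\<Sum>x\<in>#X. w x) = 0" "size X > 2 * C + 1"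
  shows "\<exists>Y. Y \<noteq> {#} \<and> Y \<subset># X \<and> (\<Sum>x\<in>#Y. w x) = 0"
proof -
  obtain xs where xs: "mset xs = X" "\<And>i. \<bar>sum_list (map w (take i xs))\<bar> \<le> int C"
    using bounded_prefix_sums[of X w "int C" 0] assms by auto
  define s where "s i = sum_list (map w (take i xs))" for i
  have "s ` {..<length xs} \<subseteq> {- int C..int C}"
  proof (intro image_subsetI)
    show "s i \<in> {- int C..int C}" for i using xs(2)[of i] by (auto simp: s_def abs_le_iff)
  qed
  then have "card (s ` {..<length xs}) \<le> 2 * C + 1"
    using card_mono[of "{- int C..int C}" "s ` {..<length xs}"] by simp
  moreover have "length xs > 2 * C + 1" using xs assms(3) by auto
  ultimately have "\<not> inj_on s {..<length xs}"
    by (metis card_image card_lessThan not_le)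
  then obtain i j where ij: "i < j" "j < length xs" "s i = s j"
    unfolding inj_on_def by (metis lessThan_iff linorder_neqE_nat)
  define ys where "ys = drop i (take j xs)"
  have split: "take j xs = take i xs @ ys"
    using ij unfolding ys_def by (metis append_take_drop_id min.absorb1 less_imp_le take_take)
  have "xs = take i xs @ ys @ drop j xs"
    by (metis append.assoc append_take_drop_id split)
  then have eq: "X = mset ys + mset (take i xs @ drop j xs)"
    using xs(1) by (metis mset_append union_ac(1) union_commute)
  have "(\<Sum>x\<in>#mset ys. w x) = 0"
    using ij(3) split by (simp add: s_def sum_mset_sum_list flip: mset_map)
  moreover have "mset ys \<noteq> {#}" using ij by (simp add: ys_def)
  moreover have "mset ys \<subset># X" unfolding eq using ij by (simp add: subset_mset_def)
  ultimately show ?thesis by blast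
qed

lemma zero_sum_partition_single:
  fixes w :: "'a \<Rightarrow> int" and C :: nat
  assumes "\<forall>x\<in>#X. \<bar>w x\<bar> \<le> int C" "(\<Sum>x\<in>#X. w x) = 0"
  shows "\<exists>P. \<Sum>\<^sub># P = X \<and> (\<forall>Y\<in>#P. size Y \<le> 2 * C + 1 \<and> (\<Sum>x\<in>#Y. w x) = 0)"
  using assms
proof (induction "size X" arbitrary: X rule: less_induct)
  case less
  show ?case
  proof (cases "size X > 2 * C + 1")
    case False
    then show ?thesis using less.prems by (intro exI[of _ "{#X#}"]) simp
  next
    case True
    then obtain Y where Y: "Y \<noteq> {#}" "Y \<subset># X" "(\<Sum>x\<in>#Y. w x) = 0"
      using zero_sum_split less.prems by blast
    define Z where "Z = X - Y"
    have X: "X = Y + Z" using Y by (simp add: Z_def subset_mset.less_imp_le)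
    have Z: "Z \<noteq> {#}" using Y X by auto
    obtain P where "\<Sum>\<^sub># P = Y" "\<forall>Y\<in>#P. size Y \<le> 2 * C + 1 \<and> (\<Sum>x\<in>#Y. w x) = 0"
      using less.hyps[of Y] less.prems Y X Z by (auto simp: nonempty_has_size)
    moreover obtain Q where "\<Sum>\<^sub># Q = Z" "\<forall>Y\<in>#Q. size Y \<le> 2 * C + 1 \<and> (\<Sum>x\<in>#Y. w x) = 0"
      using less.hyps[of Z] less.prems Y X Z by (auto simp: nonempty_has_size)
    ultimately show ?thesis by (intro exI[of _ "P + Q"]) (auto simp: X)
  qed
qed

text \<open>Size bound for zero-sum pieces in \<open>m\<close> coordinates bounded by
  \<open>C\<close>. Pieces of size at most \<open>b\<close> for the earlier coordinates have weight
  at most \<open>C * b\<close> in the new one, so at most \<open>2 * (C * b) + 1\<close> of them are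
  merged.\<close>

fun zsb :: "nat \<Rightarrow> nat \<Rightarrow> nat" where
  "zsb 0 C = 1"
| "zsb (Suc m) C = zsb m C * (2 * (C * zsb m C) + 1)"

lemma zsb_mono: "m \<le> m' \<Longrightarrow> C \<le> C' \<Longrightarrow> zsb m C \<le> zsb m' C'"
proof (induction m' arbitrary: m)
  case (Suc m')
  show ?case
  proof (cases m)
    case 0
    have "1 \<le> zsb m' C'" using Suc.IH[of 0] Suc.prems by simp
    then show ?thesis using 0 by simp
  next
    case (Suc k)
    then show ?thesis using Suc.IH[of k] Suc.prems by (auto intro!: mult_le_mono add_mono)
  qed
qed simp

lemma sum_mset_sum_mset: "(\<Sum>x\<in>#\<Sum>\<^sub># P. f x) = (\<Sum>Y\<in>#P. \<Sum>x\<in>#Y. f x)"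
  by (induction P) auto

lemma size_sum_mset_le:
  fixes P :: "'a multiset multiset"
  shows "\<forall>Y\<in>#P. size Y \<le> b \<Longrightarrow> size (\<Sum>\<^sub># P) \<le> size P * b"
  by (induction P) auto

lemma abs_sum_mset_le:
  fixes w :: "'a \<Rightarrow> int" and C :: nat
  shows "\<forall>x\<in>#X. \<bar>w x\<bar> \<le> int C \<Longrightarrow> \<bar>\<Sum>x\<in>#X. w x\<bar> \<le> int (C * size X)"
  by (induction X) (auto simp: algebra_simps)

text \<open>Induction on the coordinates: the pieces found so far become the elements to be
  partitioned for the new coordinate, and merging them preserves the zero sums already achieved. The
  start is the partition into singletons.\<close>

lemma zero_sum_partition:
  fixes w :: "'j \<Rightarrow> 'a \<Rightarrow> int" and C :: nat
  assumes "finite J" "\<forall>j\<in>J. \<forall>x\<in>#X. \<bar>w j x\<bar> \<le> int C" "\<forall>j\<in>J. (\<Sum>x\<in>#X. w j x) = 0"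
  shows "\<exists>P. \<Sum>\<^sub># P = X \<and> (\<forall>Y\<in>#P. size Y \<le> zsb (card J) C \<and> (\<forall>j\<in>J. (\<Sum>x\<in>#Y. w j x) = 0))"
  using assms
proof (induction J rule: finite_induct)
  case empty
  show ?case by (intro exI[of _ "image_mset (\<lambda>x. {#x#}) X"]) auto
next
  case (insert j J)
  then obtain P where P: "\<Sum>\<^sub># P = X" "\<forall>Y\<in>#P. size Y \<le> zsb (card J) C"
    "\<forall>Y\<in>#P. \<forall>j\<in>J. (\<Sum>x\<in>#Y. w j x) = 0" by (metis insertCI)
  define b where "b = zsb (card J) C"
  have mem: "x \<in># X" if "Y \<in># P" "x \<in># Y" for x Y using that P(1) by auto
  have "\<bar>\<Sum>x\<in>#Y. w j x\<bar> \<le> int (C * b)" if "Y \<in># P" for Y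
  proof -
    have "\<bar>\<Sum>x\<in>#Y. w j x\<bar> \<le> int (C * size Y)"
      using insert.prems mem[OF that] by (intro abs_sum_mset_le) auto
    also have "\<dots> \<le> int (C * b)" using P(2) that by (simp add: b_def mult_left_mono)
    finally show ?thesis .
  qed
  moreover have "(\<Sum>Y\<in>#P. \<Sum>x\<in>#Y. w j x) = 0"
    using insert.prems P(1) by (simp flip: sum_mset_sum_mset)
  ultimately obtain Q where Q: "\<Sum>\<^sub># Q = P"
    "\<forall>R\<in>#Q. size R \<le> 2 * (C * b) + 1 \<and> (\<Sum>Y\<in>#R. \<Sum>x\<in>#Y. w j x) = 0"
    using zero_sum_partition_single[of P "\<lambda>Y. \<Sum>x\<in>#Y. w j x" "C * b"] by blast
  have memQ: "Y \<in># P" if "R \<in># Q" "Y \<in># R" for R Y using that Q(1) by auto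
  show ?case
  proof (intro exI[of _ "image_mset sum_mset Q"] conjI ballI)
    show "\<Sum>\<^sub># (image_mset sum_mset Q) = X"
      using P(1) Q(1) sum_mset_sum_mset[of "\<lambda>x. x" Q] by simp
  next
    fix Y assume "Y \<in># image_mset sum_mset Q"
    then obtain R where R: "R \<in># Q" "Y = \<Sum>\<^sub># R" by auto
    have "size Y \<le> size R * b" unfolding R(2) using P(2) memQ[OF R(1)]
      by (intro size_sum_mset_le) (auto simp: b_def)
    also have "\<dots> \<le> (2 * (C * b) + 1) * b" using Q(2) R(1) by (intro mult_right_mono) auto
    finally show "size Y \<le> zsb (card (insert j J)) C"
      using insert.hyps by (simp add: b_def mult.commute)
  next
    fix Y i assume "Y \<in># image_mset sum_mset Q" and i: "i \<in> insert j J"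
    then obtain R where R: "R \<in># Q" "Y = \<Sum>\<^sub># R" by auto
    show "(\<Sum>x\<in>#Y. w i x) = 0"
    proof (cases "i = j")
      case True
      then show ?thesis using Q(2) R by (simp add: sum_mset_sum_mset)
    next
      case False
      then have "\<forall>Y\<in>#R. (\<Sum>x\<in>#Y. w i x) = 0" using i P(3) memQ[OF R(1)] by auto
      then show ?thesis unfolding R(2) sum_mset_sum_mset by (simp add: sum_mset.neutral)
    qed
  qed
qed

section \<open>Graphs with prescribed degrees\<close>

text \<open>Inverse of a cyclic shift in the natural numbers, where subtracting \<open>x\<close>
  becomes adding \<open>K - x\<close>.\<close>

lemma shift_mod_iff:
  fixes i j x K :: nat
  assumes "i < K" "j < K" "x < K"
  shows "(i + x) mod K = j \<longleftrightarrow> i = (j + (K - x)) mod K"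
proof -
  have "(i + x) mod K = (if i + x < K then i + x else i + x - K)"
    using assms by (simp add: le_mod_geq)
  moreover have "(j + (K - x)) mod K = (if x \<le> j then j - x else j + (K - x))"
  proof (cases "x \<le> j")
    case True
    then have "j + (K - x) = (j - x) + K" using assms by simp
    then have "(j + (K - x)) mod K = (j - x) mod K" by (metis mod_add_self2)
    then show ?thesis using True assms by simp
  qed (use assms in simp)
  ultimately show ?thesis using assms by auto
qed

lemma finite_bij_lessThan: "finite A \<Longrightarrow> \<exists>h. bij_betw h {..<card A} A"
  by (metis bij_betw_inv ex_bij_betw_finite_nat lessThan_atLeast0)

text \<open>Two copies (sides) of every vertex are blown up cyclically. The half-edge \<open>s\<close> leaving side
  \<open>False\<close> in copy \<open>i\<close> is glued to its partner on side \<open>True\<close> in copy \<open>i + idx s\<close>; since the shifts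
  \<open>idx s\<close> are pairwise distinct modulo the number of copies, no double edges and no loops arise.\<close>

lemma realize_half_edges:
  fixes S :: "'s set" and own :: "'s \<Rightarrow> 'e" and kd :: "'s \<Rightarrow> 'k" and rev :: "'k \<Rightarrow> 'k"
  assumes finS: "finite S" and own: "\<And>s. s \<in> S \<Longrightarrow> own s \<in> E" and rev: "\<And>\<kappa>. rev (rev \<kappa>) = \<kappa>"
    and bal: "\<And>\<kappa>. card {s \<in> S. kd s = rev \<kappa>} = card {s \<in> S. kd s = \<kappa>}"
  defines "V \<equiv> E \<times> (UNIV :: bool set) \<times> {..<Suc (card S)}"
  shows "\<exists>G. (\<forall>u v \<kappa> \<kappa>'. G u \<kappa> v \<longrightarrow> G u \<kappa>' v \<longrightarrow> \<kappa> = \<kappa>')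
    \<and> (\<forall>u v \<kappa>. G u \<kappa> v \<longrightarrow> u \<in> V \<and> v \<in> V \<and> u \<noteq> v \<and> G v (rev \<kappa>) u)
    \<and> (\<forall>u\<in>V. \<forall>\<kappa>. card {v. G u \<kappa> v} = card {s \<in> S. own s = fst u \<and> kd s = \<kappa>})"
proof -
  define K where "K = Suc (card S)"
  have V: "V = E \<times> UNIV \<times> {..<K}" by (simp add: V_def K_def)
  have ex_f: "\<exists>f. bij_betw f {s \<in> S. kd s = \<kappa>} {s \<in> S. kd s = rev \<kappa>}" for \<kappa>
    by (rule finite_same_card_bij) (simp_all add: finS bal)
  define f where "f \<kappa> = (SOME f. bij_betw f {s \<in> S. kd s = \<kappa>} {s \<in> S. kd s = rev \<kappa>})" for \<kappa>
  have f: "bij_betw (f \<kappa>) {s \<in> S. kd s = \<kappa>} {s \<in> S. kd s = rev \<kappa>}" for \<kappa>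
    unfolding f_def by (rule someI_ex[OF ex_f])
  \<comment> \<open>The partner map need not be an involution, because the partner lives on the
    other side. This is why two sides are used: a kind that equals its own reverse may occur an odd
    number of times.\<close>
  define \<beta> where "\<beta> s = f (kd s) s" for s
  have \<beta>: "\<beta> s \<in> S" "kd (\<beta> s) = rev (kd s)" if "s \<in> S" for s
  proof -
    have "s \<in> {t \<in> S. kd t = kd s}" using that by simp
    from bij_betw_apply[OF f this] show "\<beta> s \<in> S" "kd (\<beta> s) = rev (kd s)"
      unfolding \<beta>_def by simp_all
  qed
  have inj\<beta>: "inj_on \<beta> S"
  proof (rule inj_onI)
    fix s t assume st: "s \<in> S" "t \<in> S" "\<beta> s = \<beta> t"
    have "rev (kd s) = rev (kd t)"
      unfolding \<beta>(2)[OF st(1), symmetric] \<beta>(2)[OF st(2), symmetric] st(3) ..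
    then have eq: "kd s = kd t" by (metis rev)
    have "inj_on (f (kd s)) {s' \<in> S. kd s' = kd s}" using f by (simp add: bij_betw_def)
    then show "s = t" using st eq by (simp add: \<beta>_def inj_on_def)
  qed
  then have surj\<beta>: "\<beta> ` S = S" using finS \<beta> by (intro endo_inj_surj) auto
  obtain idx where idx: "bij_betw idx S {0..<card S}" using ex_bij_betw_finite_nat[OF finS] by blast
  have idxK: "idx s < K" if "s \<in> S" for s using bij_betwE[OF idx] that by (fastforce simp: K_def)
  have idx_inj: "s = t" if "s \<in> S" "t \<in> S" "idx s = idx t" for s t
    using idx that by (auto simp: bij_betw_def inj_on_def)
  define R where "R u s v \<longleftrightarrow> s \<in> S \<and> (\<exists>i<K. u = (own s, False, i) \<and> v = (own (\<beta> s), True, (i + idx s) mod K))" for u s v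
  \<comment> \<open>The two ends determine both copy numbers, hence the shift modulo
    \<open>K\<close>, hence the half-edge.\<close>
  have R_uniq: "s = t" if st: "R u s v" "R u t v" for u v s t
  proof -
    obtain i where i: "i < K" "(i + idx s) mod K = (i + idx t) mod K" "s \<in> S" "t \<in> S"
      using st by (auto simp: R_def)
    define j where "j = (i + idx s) mod K"
    have "(idx s + i) mod K = j" "(idx t + i) mod K = j" using i by (simp_all add: j_def add.commute)
    moreover have "j < K" using i by (simp add: j_def)
    ultimately have "idx s = idx t" using i idxK by (metis shift_mod_iff)
    then show ?thesis using idx_inj i by blast
  qed
  define G where "G u \<kappa> v \<longleftrightarrow> (\<exists>s. R u s v \<and> \<kappa> = kd s) \<or> (\<exists>s. R v s u \<and> \<kappa> = rev (kd s))" for u \<kappa> v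
  have R_sides: "\<not> fst (snd u) \<and> fst (snd v)" if "R u s v" for u s v using that by (auto simp: R_def)
  have G_sym: "G v (rev \<kappa>) u" if "G u \<kappa> v" for u \<kappa> v using that rev by (auto simp: G_def)
  have cnt: "card {v. G u \<kappa> v} = card {s \<in> S. own s = fst u \<and> kd s = \<kappa>}" if u: "u \<in> V" for u \<kappa>
  proof -
    obtain e b i where ui: "u = (e, b, i)" "e \<in> E" "i < K" using u V by auto
    show ?thesis
    proof (cases b)
      case False
      have "R u s v \<longleftrightarrow> s \<in> S \<and> own s = e \<and> v = (own (\<beta> s), True, (i + idx s) mod K)" for s v
        using ui False by (auto simp: R_def)
      moreover have "\<not> R v s u" for s v using ui False by (simp add: R_def)
      ultimately have "{v. G u \<kappa> v} = (\<lambda>s. (own (\<beta> s), True, (i + idx s) mod K)) ` {s \<in> S. own s = e \<and> kd s = \<kappa>}"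
        by (auto simp: G_def)
      moreover have "inj_on (\<lambda>s. (own (\<beta> s), True, (i + idx s) mod K)) {s \<in> S. own s = e \<and> kd s = \<kappa>}"
      proof (rule inj_onI)
        fix s t assume "s \<in> {s \<in> S. own s = e \<and> kd s = \<kappa>}" "t \<in> {s \<in> S. own s = e \<and> kd s = \<kappa>}"
          "(own (\<beta> s), True, (i + idx s) mod K) = (own (\<beta> t), True, (i + idx t) mod K)"
        then have "R u s (own (\<beta> s), True, (i + idx s) mod K)" "R u t (own (\<beta> s), True, (i + idx s) mod K)"
          using ui False by (auto simp: R_def)
        then show "s = t" by (rule R_uniq)
      qed
      ultimately show ?thesis using ui by (simp add: card_image)
    next
      case True
      \<comment> \<open>Seen from side \<open>True\<close>, an edge of kind \<open>\<kappa>\<close>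
        comes from a half-edge whose partner is owned by \<open>e\<close>. Since
        \<open>\<beta>\<close> permutes the half-edges and reverses kinds, there are as many of them
        as half-edges of kind \<open>\<kappa>\<close> owned by \<open>e\<close>.\<close>
      define B where "B = {s \<in> S. own (\<beta> s) = e \<and> rev (kd s) = \<kappa>}"
      define g where "g s = (own s, False, (i + (K - idx s)) mod K)" for s
      have R_g: "R v s u \<longleftrightarrow> s \<in> S \<and> own (\<beta> s) = e \<and> v = g s" for v s
      proof
        assume "R v s u"
        then show "s \<in> S \<and> own (\<beta> s) = e \<and> v = g s"
          using ui shift_mod_iff[OF _ ui(3) idxK] by (auto simp: R_def g_def)
      next
        assume *: "s \<in> S \<and> own (\<beta> s) = e \<and> v = g s"
        have "(i + (K - idx s)) mod K < K" using ui by simp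
        then have "((i + (K - idx s)) mod K + idx s) mod K = i"
          using shift_mod_iff[of "(i + (K - idx s)) mod K" K i "idx s"] ui idxK * by blast
        then show "R v s u" using * ui True by (auto simp: R_def g_def)
      qed
      have "\<not> R u s v" for s v using ui True by (simp add: R_def)
      then have "{v. G u \<kappa> v} = g ` B" by (auto simp: G_def B_def R_g)
      moreover have "inj_on g B"
        using R_g R_uniq unfolding B_def inj_on_def by blast
      moreover have "\<beta> ` B = {t \<in> S. own t = e \<and> kd t = \<kappa>}"
      proof
        show "\<beta> ` B \<subseteq> {t \<in> S. own t = e \<and> kd t = \<kappa>}" using \<beta> rev by (auto simp: B_def)
        show "{t \<in> S. own t = e \<and> kd t = \<kappa>} \<subseteq> \<beta> ` B"
        proof
          fix t assume t: "t \<in> {t \<in> S. own t = e \<and> kd t = \<kappa>}"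
          then obtain s where "s \<in> S" "t = \<beta> s" using surj\<beta> by blast
          then show "t \<in> \<beta> ` B" using t \<beta> by (auto simp: B_def)
        qed
      qed
      moreover have "inj_on \<beta> B" using inj\<beta> by (auto simp: B_def inj_on_def)
      ultimately have "card {v. G u \<kappa> v} = card B" "card B = card {t \<in> S. own t = e \<and> kd t = \<kappa>}"
        by (metis card_image)+
      then show ?thesis using ui by simp
    qed
  qed
  show ?thesis
  proof (intro exI[of _ G] conjI allI impI ballI)
    fix u v \<kappa> \<kappa>' assume "G u \<kappa> v" "G u \<kappa>' v"
    then show "\<kappa> = \<kappa>'" using R_uniq R_sides unfolding G_def by metis
  next
    fix u v \<kappa> assume G: "G u \<kappa> v"
    show "u \<in> V" "v \<in> V" using G own \<beta> by (auto simp: G_def R_def V)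
    show "u \<noteq> v" using G R_sides unfolding G_def by blast
    show "G v (rev \<kappa>) u" using G_sym[OF G] .
  qed (rule cnt)
qed

text \<open>The multisets are unfolded into half-edges: a triple records the owner, the kind, and a
  running number among equal kinds of the same owner.\<close>

lemma realize_degrees_sides:
  fixes T :: "'e \<Rightarrow> 'k multiset" and rev :: "'k \<Rightarrow> 'k"
  assumes fin: "finite E" and rev: "\<And>\<kappa>. rev (rev \<kappa>) = \<kappa>"
    and bal: "\<And>\<kappa>. (\<Sum>e\<in>E. count (T e) (rev \<kappa>)) = (\<Sum>e\<in>E. count (T e) \<kappa>)"
  defines "V \<equiv> E \<times> (UNIV :: bool set) \<times> {..<Suc (\<Sum>e\<in>E. size (T e))}"
  shows "\<exists>G. (\<forall>u v \<kappa> \<kappa>'. G u \<kappa> v \<longrightarrow> G u \<kappa>' v \<longrightarrow> \<kappa> = \<kappa>')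
    \<and> (\<forall>u v \<kappa>. G u \<kappa> v \<longrightarrow> u \<in> V \<and> v \<in> V \<and> u \<noteq> v \<and> G v (rev \<kappa>) u)
    \<and> (\<forall>u\<in>V. \<forall>\<kappa>. card {v. G u \<kappa> v} = count (T (fst u)) \<kappa>)"
proof -
  define S where "S = (SIGMA e:E. SIGMA \<kappa>:set_mset (T e). {..<count (T e) \<kappa>})"
  define own :: "'e \<times> 'k \<times> nat \<Rightarrow> 'e" where "own = fst"
  define kd :: "'e \<times> 'k \<times> nat \<Rightarrow> 'k" where "kd = fst \<circ> snd"
  have finS: "finite S" using fin by (auto simp: S_def)
  have cardS: "card S = (\<Sum>e\<in>E. size (T e))"
    using fin by (simp add: S_def card_SigmaI size_multiset_overloaded_eq)
  have own: "own s \<in> E" if "s \<in> S" for s using that by (auto simp: S_def own_def)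
  have mem: "x \<in># M" if "i < count M x" for i and x :: 'k and M
    using that by (metis count_eq_zero_iff not_less_zero)
  have fib_eq: "{s \<in> S. own s = e \<and> kd s = \<kappa>} = (\<lambda>i. (e, \<kappa>, i)) ` {..<count (T e) \<kappa>}" if "e \<in> E" for e \<kappa>
    using that by (auto simp: S_def own_def kd_def image_iff dest: mem)
  have fib_card: "card {s \<in> S. own s = e \<and> kd s = \<kappa>} = count (T e) \<kappa>" if "e \<in> E" for e \<kappa>
    unfolding fib_eq[OF that] by (subst card_image) (auto simp: inj_on_def)
  have kfib_card: "card {s \<in> S. kd s = \<kappa>} = (\<Sum>e\<in>E. count (T e) \<kappa>)" for \<kappa>
  proof -
    have "{s \<in> S. kd s = \<kappa>} = (\<Union>e\<in>E. {s \<in> S. own s = e \<and> kd s = \<kappa>})" using own by auto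
    also have "card \<dots> = (\<Sum>e\<in>E. card {s \<in> S. own s = e \<and> kd s = \<kappa>})"
      using fin finS by (intro card_UN_disjoint) auto
    finally show ?thesis using fib_card by simp
  qed
  have bal': "card {s \<in> S. kd s = rev \<kappa>} = card {s \<in> S. kd s = \<kappa>}" for \<kappa>
    by (simp only: kfib_card bal)
  obtain G where "(\<forall>u v \<kappa> \<kappa>'. G u \<kappa> v \<longrightarrow> G u \<kappa>' v \<longrightarrow> \<kappa> = \<kappa>')
    \<and> (\<forall>u v \<kappa>. G u \<kappa> v \<longrightarrow> u \<in> V \<and> v \<in> V \<and> u \<noteq> v \<and> G v (rev \<kappa>) u)
    \<and> (\<forall>u\<in>V. \<forall>\<kappa>. card {v. G u \<kappa> v} = card {s \<in> S. own s = fst u \<and> kd s = \<kappa>})"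
    using realize_half_edges[of S own E rev kd, OF finS own rev bal']
    unfolding V_def cardS by blast
  then show ?thesis using fib_card by (intro exI[of _ G]) (auto simp: V_def)
qed

text \<open>Renumbers the vertices as an initial segment of the naturals, the form of the domain of
  a coded structure; \<open>\<pi>\<close> remembers which member of \<open>E\<close> a vertex
  copies.\<close>

lemma realize_degrees:
  fixes T :: "'e \<Rightarrow> 'k multiset" and rev :: "'k \<Rightarrow> 'k"
  assumes fin: "finite E" and rev: "\<And>\<kappa>. rev (rev \<kappa>) = \<kappa>"
    and bal: "\<And>\<kappa>. (\<Sum>e\<in>E. count (T e) (rev \<kappa>)) = (\<Sum>e\<in>E. count (T e) \<kappa>)"
  shows "\<exists>n \<pi> G. n = card E * (2 * Suc (\<Sum>e\<in>E. size (T e))) \<and> \<pi> ` {..<n::nat} = E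
    \<and> (\<forall>u v \<kappa> \<kappa>'. G u \<kappa> v \<longrightarrow> G u \<kappa>' v \<longrightarrow> \<kappa> = \<kappa>')
    \<and> (\<forall>u v \<kappa>. G u \<kappa> v \<longrightarrow> u < n \<and> v < n \<and> u \<noteq> v \<and> G v (rev \<kappa>) u)
    \<and> (\<forall>u<n. \<forall>\<kappa>. card {v. G u \<kappa> v} = count (T (\<pi> u)) \<kappa>)"
proof -
  define V where "V = E \<times> (UNIV :: bool set) \<times> {..<Suc (\<Sum>e\<in>E. size (T e))}"
  obtain G where G: "(\<forall>u v \<kappa> \<kappa>'. G u \<kappa> v \<longrightarrow> G u \<kappa>' v \<longrightarrow> \<kappa> = \<kappa>')
    \<and> (\<forall>u v \<kappa>. G u \<kappa> v \<longrightarrow> u \<in> V \<and> v \<in> V \<and> u \<noteq> v \<and> G v (rev \<kappa>) u)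
    \<and> (\<forall>u\<in>V. \<forall>\<kappa>. card {v. G u \<kappa> v} = count (T (fst u)) \<kappa>)"
    using realize_degrees_sides[OF fin rev bal] unfolding V_def by blast
  have G1: "G u \<kappa> v \<Longrightarrow> G u \<kappa>' v \<Longrightarrow> \<kappa> = \<kappa>'"
    and G2: "G u \<kappa> v \<Longrightarrow> u \<in> V \<and> v \<in> V \<and> u \<noteq> v \<and> G v (rev \<kappa>) u"
    and G3: "u \<in> V \<Longrightarrow> card {v. G u \<kappa> v} = count (T (fst u)) \<kappa>" for u v \<kappa> \<kappa>'
    using G by blast+
  have finV: "finite V" using fin by (simp add: V_def)
  have cardV: "card V = card E * (2 * Suc (\<Sum>e\<in>E. size (T e)))"
    by (simp add: V_def card_cartesian_product)
  obtain h where h: "bij_betw h {..<card V} V" using finite_bij_lessThan[OF finV] by blast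
  have hV: "h u \<in> V" if "u < card V" for u using h that by (auto simp: bij_betw_def)
  have h_inj: "u = v" if "u < card V" "v < card V" "h u = h v" for u v
    using h that by (auto simp: bij_betw_def inj_on_def)
  define G' where "G' u \<kappa> v \<longleftrightarrow> u < card V \<and> v < card V \<and> G (h u) \<kappa> (h v)" for u \<kappa> v
  show ?thesis
  proof (intro exI[of _ "card V"] exI[of _ "fst \<circ> h"] exI[of _ G'] conjI allI impI)
    show "(fst \<circ> h) ` {..<card V} = E"
    proof -
      have "(fst \<circ> h) ` {..<card V} = fst ` V" 
        by (simp only: image_comp[symmetric] bij_betw_imp_surj_on[OF h])
      also have "\<dots> = E" by (force simp: V_def)
      finally show ?thesis .
    qed
  next
    fix u \<kappa> assume u: "u < card V"
    have "bij_betw h {v. G' u \<kappa> v} {w. G (h u) \<kappa> w}"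
      unfolding bij_betw_def
    proof
      show "inj_on h {v. G' u \<kappa> v}" using h_inj by (auto simp: inj_on_def G'_def)
      have "w \<in> h ` {..<card V}" if "G (h u) \<kappa> w" for w using G2[OF that] h by (auto simp: bij_betw_def)
      then show "h ` {v. G' u \<kappa> v} = {w. G (h u) \<kappa> w}"
        using u unfolding G'_def lessThan_def by blast
    qed
    then show "card {v. G' u \<kappa> v} = count (T ((fst \<circ> h) u)) \<kappa>"
      using G3[OF hV[OF u]] bij_betw_same_card by fastforce
  next
    fix u v \<kappa> assume "G' u \<kappa> v"
    then show "u < card V" "v < card V" "u \<noteq> v" "G' v (rev \<kappa>) u"
      using G2[of "h u" \<kappa> "h v"] by (auto simp: G'_def)
  next
    fix u v \<kappa> \<kappa>' assume "G' u \<kappa> v" "G' u \<kappa>' v"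
    then show "\<kappa> = \<kappa>'" using G1 unfolding G'_def by blast
  qed (rule cardV)
qed

section \<open>Small graphs with the same local counting constraints\<close>

text \<open>Choose for each element of the support one zero-sum piece containing it and add these
  pieces up. Multiplicities change, but the support survives, and the number of pieces is governed
  by the support instead of the size of \<open>X\<close>.\<close>

lemma zero_sum_same_support:
  fixes w :: "'j \<Rightarrow> 'a \<Rightarrow> int" and C :: nat
  assumes "finite J" "\<forall>j\<in>J. \<forall>x\<in>#X. \<bar>w j x\<bar> \<le> int C" "\<forall>j\<in>J. (\<Sum>x\<in>#X. w j x) = 0"
  shows "\<exists>Y. set_mset Y = set_mset X \<and> size Y \<le> card (set_mset X) * zsb (card J) C
    \<and> (\<forall>j\<in>J. (\<Sum>x\<in>#Y. w j x) = 0)"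
proof -
  obtain P where P: "\<Sum>\<^sub># P = X" "\<And>Y. Y \<in># P \<Longrightarrow> size Y \<le> zsb (card J) C"
    "\<And>Y j. Y \<in># P \<Longrightarrow> j \<in> J \<Longrightarrow> (\<Sum>x\<in>#Y. w j x) = 0"
    using zero_sum_partition[OF assms] by blast
  have "\<exists>Y. Y \<in># P \<and> x \<in># Y" if "x \<in># X" for x using that P(1) by auto
  then obtain S where S: "\<And>x. x \<in># X \<Longrightarrow> S x \<in># P \<and> x \<in># S x" by metis
  define Q where "Q = image_mset S (mset_set (set_mset X))"
  have Q: "Y \<in># P" if "Y \<in># Q" for Y using that S by (auto simp: Q_def)
  show ?thesis
  proof (intro exI[of _ "\<Sum>\<^sub># Q"] conjI ballI)
    show "set_mset (\<Sum>\<^sub># Q) = set_mset X"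
      using S P(1) by (fastforce simp: Q_def)
    have "size (\<Sum>\<^sub># Q) \<le> size Q * zsb (card J) C" using Q P(2) by (intro size_sum_mset_le) auto
    then show "size (\<Sum>\<^sub># Q) \<le> card (set_mset X) * zsb (card J) C" by (simp add: Q_def)
    fix j assume "j \<in> J"
    then show "(\<Sum>x\<in>#\<Sum>\<^sub># Q. w j x) = 0"
      using Q P(3) by (auto simp: sum_mset_sum_mset intro!: sum_mset.neutral)
  qed
qed

lemma in_sum_multisets: "finite I \<Longrightarrow> x \<in># (\<Sum>i\<in>I. M i) \<longleftrightarrow> (\<exists>i\<in>I. x \<in># M i)"
  by (induction I rule: finite_induct) auto

lemma sum_mset_sum_multisets:
  "finite I \<Longrightarrow> (\<Sum>x\<in>#(\<Sum>i\<in>I. M i). f x) = (\<Sum>i\<in>I. \<Sum>x\<in>#M i. f x)"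
  by (induction I rule: finite_induct) auto

lemma sum_multisets_eq_list: "(\<Sum>i<length ys. f (ys ! i)) = (\<Sum>y\<in>#mset ys. f y)"
  by (simp add: sum_mset_sum_list sum_list_sum_nth lessThan_atLeast0 flip: mset_map)

section \<open>Sign and residue of a sum relative to a threshold\<close>

definition same_order_mod :: "int \<Rightarrow> nat \<Rightarrow> int \<Rightarrow> int \<Rightarrow> bool" where
  "same_order_mod \<delta> D s' s \<longleftrightarrow> sgn (s' - \<delta>) = sgn (s - \<delta>) \<and> int D dvd s' - s"

text \<open>The representative \<open>\<rho>\<close> arises by moving \<open>s\<close> towards
  \<open>\<delta>\<close> in steps of \<open>D\<close> without reaching it, and it equals
  \<open>\<delta>\<close> only when \<open>s\<close> does. The step counts \<open>p\<close> and
  \<open>q\<close> are positive only on the side where further steps lead away from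
  \<open>\<delta>\<close>.\<close>

lemma residual_exists:
  fixes s \<delta> :: int and D :: nat
  assumes "D \<ge> 1"
  shows "\<exists>\<rho> p q. s = \<rho> + int D * int p - int D * int q \<and> \<bar>\<rho>\<bar> \<le> \<bar>\<delta>\<bar> + int D
    \<and> (p > 0 \<longrightarrow> \<rho> > \<delta>) \<and> (q > 0 \<longrightarrow> \<rho> < \<delta>)"
proof -
  consider "s = \<delta>" | "s > \<delta>" | "s < \<delta>" by linarith
  then show ?thesis
  proof cases
    case 1
    then show ?thesis by (intro exI[of _ \<delta>] exI[of _ 0]) simp
  next
    case 2
    define r where "r = (s - \<delta> - 1) mod int D"
    define t where "t = (s - \<delta> - 1) div int D"
    have "s - \<delta> - 1 = int D * t + r" by (simp add: r_def t_def)
    moreover have "0 \<le> r" "r < int D" "0 \<le> t"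
      using assms 2 by (simp_all add: r_def t_def pos_imp_zdiv_nonneg_iff)
    ultimately show ?thesis
      by (intro exI[of _ "\<delta> + 1 + r"] exI[of _ "nat t"] exI[of _ 0]) simp
  next
    case 3
    define r where "r = (\<delta> - s - 1) mod int D"
    define t where "t = (\<delta> - s - 1) div int D"
    have "\<delta> - s - 1 = int D * t + r" by (simp add: r_def t_def)
    moreover have "0 \<le> r" "r < int D" "0 \<le> t"
      using assms 3 by (simp_all add: r_def t_def pos_imp_zdiv_nonneg_iff)
    ultimately show ?thesis
      by (intro exI[of _ "\<delta> - 1 - r"] exI[of _ 0] exI[of _ "nat t"]) simp
  qed
qed

text \<open>Only the direction of the slack matters, not its amount: \<open>p\<close> and
  \<open>q\<close> cannot both be positive, and each moves the sum away from
  \<open>\<delta>\<close>. So slack may be redistributed freely as long as \<open>\<rho>\<close>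
  stays the same.\<close>

lemma residual_same:
  fixes s \<delta> \<rho> :: int and D p q :: nat
  assumes "s = \<rho> + int D * int p - int D * int q" "p > 0 \<longrightarrow> \<rho> > \<delta>" "q > 0 \<longrightarrow> \<rho> < \<delta>"
  shows "same_order_mod \<delta> D s \<rho>"
proof -
  define a b where ab: "a = int D * int p" "b = int D * int q"
  have "0 \<le> a" "0 \<le> b" by (simp_all add: ab)
  moreover have "a > 0 \<longrightarrow> \<rho> > \<delta>" "b > 0 \<longrightarrow> \<rho> < \<delta>"
    using assms(2,3) by (auto simp: ab zero_less_mult_iff)
  moreover have "s = \<rho> + a - b" using assms(1) by (simp add: ab)
  ultimately have "sgn (s - \<delta>) = sgn (\<rho> - \<delta>)"
    by (auto simp: sgn_if)
  moreover have "s - \<rho> = int D * (int p - int q)" using assms(1) by (simp add: algebra_simps)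
  ultimately show ?thesis by (simp add: same_order_mod_def)
qed

lemma same_order_mod_trans:
  "same_order_mod \<delta> D s \<rho> \<Longrightarrow> same_order_mod \<delta> D t \<rho> \<Longrightarrow> same_order_mod \<delta> D s t"
  unfolding same_order_mod_def by (metis diff_diff_eq2 diff_add_cancel dvd_diff add_diff_cancel_right' diff_add_eq)

text \<open>The neighbourhood of a vertex is represented by a multiset of units: one \<open>Base\<close>, one \<open>Nb \<kappa>\<close>
  for every neighbour via kind \<open>\<kappa>\<close>, and slack units \<open>Up j\<close>, \<open>Dn j\<close>, each worth the modulus of the
  \<open>j\<close>-th constraint, that account for the distance of the \<open>j\<close>-th weighted sum to its residual.\<close>

datatype ('j, 'k) unt = Base | Nb (un_Nb: 'k) | Up 'j | Dn 'j

definition nbs :: "('j, 'k) unt multiset \<Rightarrow> 'k multiset" where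
  "nbs T = image_mset un_Nb (filter_mset is_Nb T)"

lemma nbs_simps [simp]:
  "nbs {#} = {#}" "nbs (M + N) = nbs M + nbs N" "nbs (add_mset Base M) = nbs M"
  "nbs (add_mset (Nb \<kappa>) M) = add_mset \<kappa> (nbs M)" "nbs (add_mset (Up j) M) = nbs M"
  "nbs (add_mset (Dn j) M) = nbs M"
  by (simp_all add: nbs_def)

lemma in_nbs: "\<kappa> \<in># nbs T \<longleftrightarrow> Nb \<kappa> \<in># T"
  by (force simp: nbs_def image_iff)

lemma size_nbs: "size (nbs T) \<le> size T"
  by (simp add: nbs_def size_filter_mset_lesseq)

lemma nbs_sum: "nbs (\<Sum>i\<in>I. M i) = (\<Sum>i\<in>I. nbs (M i))"
  by (induction I rule: infinite_finite_induct) auto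

lemma nbs_sum_mset: "nbs (\<Sum>\<^sub># P) = (\<Sum>Y\<in>#P. nbs Y)"
  by (induction P) auto

text \<open>The signs are chosen so that a collection with exactly one \<open>Base\<close> has total
  zero precisely when its weighted sum equals the residual plus the \<open>Up\<close> slack minus
  the \<open>Dn\<close> slack. In the class \<open>x\<close>, the first component is the colour and
  the second gives the residuals.\<close>

fun uw :: "('j \<Rightarrow> 'k \<Rightarrow> int) \<Rightarrow> ('j \<Rightarrow> 'c \<Rightarrow> int) \<Rightarrow> ('j \<Rightarrow> nat) \<Rightarrow> 'c \<times> ('j \<Rightarrow> int) \<Rightarrow> 'j \<Rightarrow> ('j, 'k) unt \<Rightarrow> int" where
  "uw w w0 D x j Base = w0 j (fst x) - snd x j"
| "uw w w0 D x j (Nb \<kappa>) = w j \<kappa>"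
| "uw w w0 D x j (Up i) = (if i = j then - int (D j) else 0)"
| "uw w w0 D x j (Dn i) = (if i = j then int (D j) else 0)"

lemma sum_uw:
  "(\<Sum>u\<in>#T. uw w w0 D x j u) = int (count T Base) * (w0 j (fst x) - snd x j) + (\<Sum>\<kappa>\<in>#nbs T. w j \<kappa>)
     - int (D j) * int (count T (Up j)) + int (D j) * int (count T (Dn j))"
proof (induction T)
  case (add u T)
  then show ?case by (cases u) (auto simp: algebra_simps)
qed simp

text \<open>Bounds the number of pairs of a class and a piece: \<open>c\<close> colours, residuals
  between \<open>- 2 * C\<close> and \<open>2 * C\<close> for each of \<open>m\<close> constraints,
  and multisets over one base unit, \<open>K\<close> neighbour units and \<open>2 * m\<close> slack
  units. The \<open>3 * C\<close> bounds the weight of the base unit, a colour weight up to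
  \<open>C\<close> minus a residual up to \<open>2 * C\<close>.\<close>

definition item_bound :: "nat \<Rightarrow> nat \<Rightarrow> nat \<Rightarrow> nat \<Rightarrow> nat" where
  "item_bound m K c C = c * (4 * C + 1) ^ m * (\<Sum>i<Suc (zsb m (3 * C)). (1 + K + 2 * m) ^ i)"

text \<open>The second splitting has one coordinate per kind, and the imbalance of a piece is at
  most its size; so \<open>zsb K\<close> is applied to the size bound of the first
  splitting.\<close>

definition items_bound :: "nat \<Rightarrow> nat \<Rightarrow> nat \<Rightarrow> nat \<Rightarrow> nat" where
  "items_bound m K c C = item_bound m K c C * zsb K (zsb m (3 * C))"

text \<open>Base pieces times two sides times copies; the number of copies exceeds the number of
  half-edges by one.\<close>

definition graph_bound :: "nat \<Rightarrow> nat \<Rightarrow> nat \<Rightarrow> nat \<Rightarrow> nat" where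
  "graph_bound m K c C = items_bound m K c C * (2 * Suc (items_bound m K c C * zsb m (3 * C)))"

lemma card_bounded_multisets:
  assumes "finite U" "card U \<le> k"
  shows "finite {g. set_mset g \<subseteq> U \<and> size g \<le> b} \<and> card {g. set_mset g \<subseteq> U \<and> size g \<le> b} \<le> (\<Sum>i<Suc b. k ^ i)"
proof -
  have eq: "{g. set_mset g \<subseteq> U \<and> size g \<le> b} = mset ` {xs. set xs \<subseteq> U \<and> length xs \<le> b}"
  proof (intro set_eqI iffI)
    fix g assume "g \<in> {g. set_mset g \<subseteq> U \<and> size g \<le> b}"
    moreover obtain xs where "mset xs = g" using ex_mset by blast
    ultimately show "g \<in> mset ` {xs. set xs \<subseteq> U \<and> length xs \<le> b}" by auto
  qed auto
  have fin: "finite {xs. set xs \<subseteq> U \<and> length xs \<le> b}" using assms(1) by (rule finite_lists_length_le)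
  have "card (mset ` {xs. set xs \<subseteq> U \<and> length xs \<le> b}) \<le> card {xs. set xs \<subseteq> U \<and> length xs \<le> b}"
    using fin by (rule card_image_le)
  also have "\<dots> = (\<Sum>i\<le>b. card U ^ i)" using assms(1) by (rule card_lists_length_le)
  also have "\<dots> \<le> (\<Sum>i\<le>b. k ^ i)" using assms(2) by (intro sum_mono power_mono) auto
  finally show ?thesis using fin by (simp add: eq lessThan_Suc_atMost)
qed

lemma count_sum_mset_image: "count (\<Sum>Y\<in>#P. f Y) x = (\<Sum>Y\<in>#P. count (f Y) x)"
  by (induction P) auto

lemma count_image_mset_set:
  assumes "finite M"
  shows "count (image_mset f (mset_set M)) x = card {b \<in> M. f b = x}"
proof -
  have "count (image_mset f (mset_set M)) x = (\<Sum>y\<in>f -` {x} \<inter> M. count (mset_set M) y)"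
    using assms by (simp add: count_image_mset)
  also have "\<dots> = (\<Sum>y\<in>f -` {x} \<inter> M. 1)" using assms by (intro sum.cong) auto
  also have "\<dots> = card (f -` {x} \<inter> M)" by simp
  also have "f -` {x} \<inter> M = {b \<in> M. f b = x}" by auto
  finally show ?thesis .
qed

lemma sum_mset_image_count:
  fixes f :: "'a \<Rightarrow> int"
  shows "(\<Sum>x\<in>#M. f x) = (\<Sum>x\<in>set_mset M. int (count M x) * f x)"
proof (induction M)
  case (add y M)
  let ?S = "insert y (set_mset M)"
  have "(\<Sum>x\<in>#M. f x) = (\<Sum>x\<in>?S. int (count M x) * f x)"
    unfolding add by (rule sum.mono_neutral_left) (auto simp: count_eq_zero_iff)
  moreover have "f y = (\<Sum>x\<in>?S. if x = y then f x else 0)" by simp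
  ultimately have "(\<Sum>x\<in>#add_mset y M. f x) = (\<Sum>x\<in>?S. (if x = y then f x else 0) + int (count M x) * f x)"
    by (simp add: sum.distrib)
  also have "\<dots> = (\<Sum>x\<in>?S. int (count (add_mset y M) x) * f x)"
    by (intro sum.cong) (auto simp: algebra_simps)
  finally show ?case by simp
qed simp

text \<open>A model in which only colours, kinds and counts are visible. \<open>LK\<close> singles
  out the kinds that count as edges. The map \<open>src\<close> recovers the colour of the first end
  from the kind, so that gluing half-edges keeps kinds and colours consistent.\<close>

locale kind_graph =
  fixes A :: "'a set" and k :: "'a \<Rightarrow> 'a \<Rightarrow> 'k" and col :: "'a \<Rightarrow> 'c" and rev :: "'k \<Rightarrow> 'k" and src :: "'k \<Rightarrow> 'c"
    and LK :: "'k set" and Kd :: "'k set" and Cd :: "'c set" and J :: "'j set"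
    and w :: "'j \<Rightarrow> 'k \<Rightarrow> int" and w0 :: "'j \<Rightarrow> 'c \<Rightarrow> int" and \<delta> :: "'j \<Rightarrow> int" and D :: "'j \<Rightarrow> nat" and C :: nat
  assumes finA: "finite A" and neA: "A \<noteq> {}" and rev: "rev (rev \<kappa>) = \<kappa>"
    and k_rev: "a \<in> A \<Longrightarrow> b \<in> A \<Longrightarrow> k b a = rev (k a b)" and k_src: "a \<in> A \<Longrightarrow> b \<in> A \<Longrightarrow> src (k a b) = col a"
    and LK_rev: "\<kappa> \<in> LK \<Longrightarrow> rev \<kappa> \<in> LK"
    and finK: "finite Kd" and finC: "finite Cd" and finJ: "finite J"
    and k_in: "a \<in> A \<Longrightarrow> b \<in> A \<Longrightarrow> k a b \<in> Kd" and col_in: "a \<in> A \<Longrightarrow> col a \<in> Cd"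
    and w_le: "j \<in> J \<Longrightarrow> \<kappa> \<in> Kd \<Longrightarrow> \<bar>w j \<kappa>\<bar> \<le> int C" and w0_le: "j \<in> J \<Longrightarrow> c \<in> Cd \<Longrightarrow> \<bar>w0 j c\<bar> \<le> int C"
    and \<delta>_le: "j \<in> J \<Longrightarrow> \<bar>\<delta> j\<bar> \<le> int C" and D_ge: "j \<in> J \<Longrightarrow> 1 \<le> D j" and D_le: "j \<in> J \<Longrightarrow> D j \<le> C"
begin

definition N :: "'a \<Rightarrow> 'a set" where
  "N a = {b \<in> A. b \<noteq> a \<and> k a b \<in> LK}"

definition S :: "'j \<Rightarrow> 'a \<Rightarrow> int" where
  "S j a = w0 j (col a) + (\<Sum>b\<in>N a. w j (k a b))"

text \<open>By the choice of residuals and slack, all units of an element together sum to zero in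
  every coordinate, so they split into bounded zero-sum pieces. The last two properties say that the
  pieces of \<open>a\<close> jointly contain each of its edges once and a single base unit, so
  exactly one of them is the base piece.\<close>

lemma decompose:
  obtains cls :: "'a \<Rightarrow> 'c \<times> ('j \<Rightarrow> int)" and P :: "'a \<Rightarrow> ('j, 'k) unt multiset multiset" where
    "\<And>a. fst (cls a) = col a"
    "\<And>a. a \<in> A \<Longrightarrow> cls a \<in> Cd \<times> (J \<rightarrow>\<^sub>E {- (2 * int C)..2 * int C})"
    "\<And>a g. a \<in> A \<Longrightarrow> g \<in># P a \<Longrightarrow> set_mset g \<subseteq> insert Base (Nb ` Kd \<union> Up ` J \<union> Dn ` J)"
    "\<And>a g. a \<in> A \<Longrightarrow> g \<in># P a \<Longrightarrow> size g \<le> zsb (card J) (3 * C)"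
    "\<And>a g j. a \<in> A \<Longrightarrow> g \<in># P a \<Longrightarrow> j \<in> J \<Longrightarrow> (\<Sum>u\<in>#g. uw w w0 D (cls a) j u) = 0"
    "\<And>a g j. a \<in> A \<Longrightarrow> g \<in># P a \<Longrightarrow> Up j \<in># g \<Longrightarrow> snd (cls a) j > \<delta> j"
    "\<And>a g j. a \<in> A \<Longrightarrow> g \<in># P a \<Longrightarrow> Dn j \<in># g \<Longrightarrow> snd (cls a) j < \<delta> j"
    "\<And>a j. a \<in> A \<Longrightarrow> j \<in> J \<Longrightarrow> same_order_mod (\<delta> j) (D j) (S j a) (snd (cls a) j)"
    "\<And>a. a \<in> A \<Longrightarrow> nbs (\<Sum>\<^sub># (P a)) = image_mset (k a) (mset_set (N a))"
    "\<And>a. a \<in> A \<Longrightarrow> count (\<Sum>\<^sub># (P a)) Base = 1"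
proof -
  define Q where "Q a j t \<longleftrightarrow> (case t of (\<rho>, p, q) \<Rightarrow> S j a = \<rho> + int (D j) * int p - int (D j) * int q
    \<and> \<bar>\<rho>\<bar> \<le> \<bar>\<delta> j\<bar> + int (D j) \<and> (p > 0 \<longrightarrow> \<rho> > \<delta> j) \<and> (q > 0 \<longrightarrow> \<rho> < \<delta> j))" for a j t
  have Q_ex: "\<exists>t. Q a j t" if "j \<in> J" for a j
    using residual_exists[OF D_ge[OF that], of "S j a" "\<delta> j"] unfolding Q_def by fast
  define t where "t a j = (SOME t. Q a j t)" for a j
  have t: "Q a j (t a j)" if "j \<in> J" for a j
    unfolding t_def by (rule someI_ex[OF Q_ex[OF that]])
  define \<rho> p q where "\<rho> a j = fst (t a j)" and "p a j = fst (snd (t a j))" and "q a j = snd (snd (t a j))" for a j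
  have r: "S j a = \<rho> a j + int (D j) * int (p a j) - int (D j) * int (q a j)"
    "\<bar>\<rho> a j\<bar> \<le> \<bar>\<delta> j\<bar> + int (D j)"
    "p a j > 0 \<longrightarrow> \<rho> a j > \<delta> j" "q a j > 0 \<longrightarrow> \<rho> a j < \<delta> j" if "j \<in> J" for a j
    using t[OF that, of a] by (simp_all add: Q_def \<rho>_def p_def q_def split_beta)
  \<comment> \<open>Restricting the residuals to \<open>J\<close> makes the classes range over a
    finite function space.\<close>
  define cls where "cls a = (col a, restrict (\<rho> a) J)" for a
  define sl where "sl a = (\<Sum>j\<in>J. replicate_mset (p a j) (Up j) + replicate_mset (q a j) (Dn j) :: ('j, 'k) unt multiset)" for a
  define U where "U a = add_mset Base (image_mset Nb (image_mset (k a) (mset_set (N a))) + sl a)" for a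
  have in_sl: "u \<in># sl a \<longleftrightarrow> (\<exists>j\<in>J. p a j > 0 \<and> u = Up j \<or> q a j > 0 \<and> u = Dn j)" for u a
    by (simp only: sl_def in_sum_multisets[OF finJ] union_iff in_replicate_mset)
  have nbs_Nb: "nbs (image_mset Nb M) = M" for M :: "'k multiset"
    by (induction M) auto
  have "\<kappa> \<notin># nbs (sl a)" for a \<kappa>
    by (simp add: in_nbs in_sl)
  then have "nbs (sl a) = {#}" for a by (meson multiset_nonemptyE)
  then have nbsU: "nbs (U a) = image_mset (k a) (mset_set (N a))" for a
    by (simp add: U_def nbs_Nb)
  have finN: "finite (N a)" for a using finA by (simp add: N_def)
  have cntB: "count (U a) Base = 1" for a
    using in_sl[of Base a] by (auto simp: U_def count_eq_zero_iff[symmetric] count_image_mset)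
  have cnt_sl: "count (sl a) (Up j) = p a j" "count (sl a) (Dn j) = q a j" if "j \<in> J" for a j
    using that finJ by (simp_all add: sl_def count_sum sum.distrib if_distrib sum.delta cong: if_cong)
  have notNb: "count {#Nb (k a b). b \<in># M#} (Up j) = 0" "count {#Nb (k a b). b \<in># M#} (Dn j) = 0"
    for M a and j :: 'j
    by (auto simp: count_eq_zero_iff)
  have cntU: "count (U a) (Up j) = p a j" "count (U a) (Dn j) = q a j" if "j \<in> J" for a j
    using that by (simp_all add: U_def cnt_sl notNb image_mset.compositionality comp_def)
  have zero: "(\<Sum>u\<in>#U a. uw w w0 D (cls a) j u) = 0" if "a \<in> A" "j \<in> J" for a j
    using r(1)[OF that(2), of a] that
    by (simp add: sum_uw cntB nbsU cntU cls_def S_def sum_unfold_sum_mset image_mset.compositionality comp_def)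
  have U_cases: "u = Base \<or> u \<in> Nb ` Kd \<or> (\<exists>j\<in>J. p a j > 0 \<and> u = Up j \<or> q a j > 0 \<and> u = Dn j)"
    if "a \<in> A" "u \<in># U a" for a u
  proof -
    have "u = Base \<or> u \<in> Nb ` (k a ` N a) \<or> u \<in># sl a"
      using that(2) finN by (auto simp: U_def)
    moreover have "k a ` N a \<subseteq> Kd" using k_in[OF that(1)] by (auto simp: N_def)
    ultimately show ?thesis unfolding in_sl by blast
  qed
  have small: "\<bar>uw w w0 D (cls a) j u\<bar> \<le> int (3 * C)" if "a \<in> A" "j \<in> J" "u \<in># U a" for a j u
  proof (cases u)
    case Base
    have "\<bar>\<rho> a j\<bar> \<le> 2 * int C" using r(2)[OF that(2), of a] \<delta>_le[OF that(2)] D_le[OF that(2)] by simp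
    moreover have "\<bar>w0 j (col a)\<bar> \<le> int C" using w0_le col_in that by blast
    ultimately show ?thesis using that(2) by (simp add: Base cls_def)
  next
    case (Nb \<kappa>)
    then have "\<kappa> \<in> Kd" using U_cases[OF that(1,3)] by auto
    then show ?thesis using w_le[OF that(2), of \<kappa>] by (simp add: Nb)
  qed (use D_le[OF that(2)] in auto)
  define good where "good a P \<longleftrightarrow> \<Sum>\<^sub># P = U a \<and> (\<forall>g\<in>#P. size g \<le> zsb (card J) (3 * C) \<and> (\<forall>j\<in>J. (\<Sum>u\<in>#g. uw w w0 D (cls a) j u) = 0))" for a P
  have good_ex: "\<exists>P. good a P" if "a \<in> A" for a
    using zero_sum_partition[of J "U a" "uw w w0 D (cls a)" "3 * C"] finJ small[OF that] zero[OF that]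
    unfolding good_def by blast
  define P where "P a = (SOME P. good a P)" for a
  have "good a (P a)" if "a \<in> A" for a
    unfolding P_def by (rule someI_ex[OF good_ex[OF that]])
  then have P: "\<And>a. a \<in> A \<Longrightarrow> \<Sum>\<^sub># (P a) = U a"
    "\<And>a g. a \<in> A \<Longrightarrow> g \<in># P a \<Longrightarrow> size g \<le> zsb (card J) (3 * C)"
    "\<And>a g j. a \<in> A \<Longrightarrow> g \<in># P a \<Longrightarrow> j \<in> J \<Longrightarrow> (\<Sum>u\<in>#g. uw w w0 D (cls a) j u) = 0"
    unfolding good_def by blast+
  have gU: "u \<in># U a" if "a \<in> A" "g \<in># P a" "u \<in># g" for a g u
    using P(1)[OF that(1), symmetric] that by auto
  show thesis
  proof (rule that[of cls P])
    fix a assume a: "a \<in> A"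
    have "\<bar>\<rho> a j\<bar> \<le> 2 * int C" if "j \<in> J" for j
      using r(2)[OF that, of a] \<delta>_le[OF that] D_le[OF that] by simp
    then show "cls a \<in> Cd \<times> (J \<rightarrow>\<^sub>E {- (2 * int C)..2 * int C})"
      using col_in[OF a] by (fastforce simp: cls_def abs_le_iff)
    show "nbs (\<Sum>\<^sub># (P a)) = image_mset (k a) (mset_set (N a))" "count (\<Sum>\<^sub># (P a)) Base = 1"
      using P(1)[OF a] nbsU cntB by simp_all
    show "same_order_mod (\<delta> j) (D j) (S j a) (snd (cls a) j)" if "j \<in> J" for j
      using residual_same[OF r(1,3,4)[OF that]] that by (simp add: cls_def)
    fix g assume g: "g \<in># P a"
    show "set_mset g \<subseteq> insert Base (Nb ` Kd \<union> Up ` J \<union> Dn ` J)"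
      using gU[OF a g] U_cases[OF a] by blast
    show "snd (cls a) j > \<delta> j" if "Up j \<in># g" for j
      using U_cases[OF a gU[OF a g that]] r(3)[of j a] by (auto simp: cls_def)
    show "snd (cls a) j < \<delta> j" if "Dn j \<in># g" for j
      using U_cases[OF a gU[OF a g that]] r(4)[of j a] by (auto simp: cls_def)
    show "size g \<le> zsb (card J) (3 * C)" by (rule P(2)[OF a g])
    show "(\<Sum>u\<in>#g. uw w w0 D (cls a) j u) = 0" if "j \<in> J" for j by (rule P(3)[OF a g that])
  qed (simp add: cls_def)
qed

text \<open>Double counting: exchanging the ends of every edge is a bijection between the edges of a
  kind and those of its reverse. It makes the imbalances of all pieces together sum to zero.\<close>

lemma card_Collect_k_rev:
  "(\<Sum>a\<in>A. card {b \<in> N a. k a b = rev \<kappa>}) = (\<Sum>a\<in>A. card {b \<in> N a. k a b = \<kappa>})"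
proof -
  have finN: "finite (N a)" for a using finA by (simp add: N_def)
  have opp: "b \<in> A \<and> a \<in> N b \<and> k b a = rev (k a b)" if "a \<in> A" "b \<in> N a" for a b
    using that k_rev[of a b] LK_rev[of "k a b"] by (auto simp: N_def)
  have key: "a \<in> A \<and> b \<in> N a \<and> k a b = rev \<kappa> \<longleftrightarrow> b \<in> A \<and> a \<in> N b \<and> k b a = \<kappa>" for a b
    using opp[of a b] opp[of b a] rev by metis
  have "(\<Sum>a\<in>A. card {b \<in> N a. k a b = rev \<kappa>}) = card (SIGMA a:A. {b \<in> N a. k a b = rev \<kappa>})"
    using finA finN by (subst card_SigmaI) auto
  also have "(SIGMA a:A. {b \<in> N a. k a b = rev \<kappa>}) = prod.swap ` (SIGMA a:A. {b \<in> N a. k a b = \<kappa>})"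
    (is "?L = ?R")
  proof (rule set_eqI)
    fix z
    have "z \<in> ?L \<longleftrightarrow> prod.swap z \<in> (SIGMA a:A. {b \<in> N a. k a b = \<kappa>})"
      by (cases z) (simp only: mem_Sigma_iff swap_simp mem_Collect_eq key)
    moreover have "prod.swap (prod.swap z) \<in> ?R \<longleftrightarrow> prod.swap z \<in> (SIGMA a:A. {b \<in> N a. k a b = \<kappa>})"
      by (rule inj_image_mem_iff[OF inj_swap])
    ultimately show "z \<in> ?L \<longleftrightarrow> z \<in> ?R" unfolding swap_swap by (simp only:)
  qed
  also have "card \<dots> = card (SIGMA a:A. {b \<in> N a. k a b = \<kappa>})"
    by (intro card_image) (auto simp: inj_on_def)
  also have "\<dots> = (\<Sum>a\<in>A. card {b \<in> N a. k a b = \<kappa>})"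
    using finA finN by (subst card_SigmaI) auto
  finally show ?thesis .
qed

text \<open>The pieces of all elements, tagged with the class of their element, satisfy the balance
  equations. Keeping the support while bounding the size retains a base piece for every class, and
  each neutral piece can be attached to a base piece of its own class. The combined multisets still
  meet the constraints, since they sum to zero and their slack points away from the
  threshold.\<close>

lemma small_graph:
  obtains n :: nat and col' :: "nat \<Rightarrow> 'c" and G :: "nat \<Rightarrow> 'k \<Rightarrow> nat \<Rightarrow> bool" where
    "0 < n" "n \<le> graph_bound (card J) (card Kd) (card Cd) C"
    "\<And>u. u < n \<Longrightarrow> \<exists>a\<in>A. col a = col' u
       \<and> (\<forall>j\<in>J. same_order_mod (\<delta> j) (D j) (w0 j (col' u) + (\<Sum>(v, \<kappa>)\<in>{(v, \<kappa>). G u \<kappa> v}. w j \<kappa>)) (S j a))"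
    "\<And>a. a \<in> A \<Longrightarrow> \<exists>u<n. col' u = col a"
    "\<And>u v \<kappa> \<kappa>'. G u \<kappa> v \<Longrightarrow> G u \<kappa>' v \<Longrightarrow> \<kappa> = \<kappa>'"
    "\<And>u v \<kappa>. G u \<kappa> v \<Longrightarrow> u < n \<and> v < n \<and> u \<noteq> v \<and> G v (rev \<kappa>) u \<and> src \<kappa> = col' u
       \<and> (\<exists>a\<in>A. \<exists>b\<in>N a. \<kappa> = k a b)"
proof -
  obtain cls :: "'a \<Rightarrow> 'c \<times> ('j \<Rightarrow> int)" and P :: "'a \<Rightarrow> ('j, 'k) unt multiset multiset" where
    cls_col: "\<And>a. fst (cls a) = col a"
    and cls_in: "\<And>a. a \<in> A \<Longrightarrow> cls a \<in> Cd \<times> (J \<rightarrow>\<^sub>E {- (2 * int C)..2 * int C})"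
    and P_set: "\<And>a g. a \<in> A \<Longrightarrow> g \<in># P a \<Longrightarrow> set_mset g \<subseteq> insert Base (Nb ` Kd \<union> Up ` J \<union> Dn ` J)"
    and P_size: "\<And>a g. a \<in> A \<Longrightarrow> g \<in># P a \<Longrightarrow> size g \<le> zsb (card J) (3 * C)"
    and P_zero: "\<And>a g j. a \<in> A \<Longrightarrow> g \<in># P a \<Longrightarrow> j \<in> J \<Longrightarrow> (\<Sum>u\<in>#g. uw w w0 D (cls a) j u) = 0"
    and P_Up: "\<And>a g j. a \<in> A \<Longrightarrow> g \<in># P a \<Longrightarrow> Up j \<in># g \<Longrightarrow> snd (cls a) j > \<delta> j"
    and P_Dn: "\<And>a g j. a \<in> A \<Longrightarrow> g \<in># P a \<Longrightarrow> Dn j \<in># g \<Longrightarrow> snd (cls a) j < \<delta> j"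
    and P_same: "\<And>a j. a \<in> A \<Longrightarrow> j \<in> J \<Longrightarrow> same_order_mod (\<delta> j) (D j) (S j a) (snd (cls a) j)"
    and P_nbs: "\<And>a. a \<in> A \<Longrightarrow> nbs (\<Sum>\<^sub># (P a)) = image_mset (k a) (mset_set (N a))"
    and P_Base: "\<And>a. a \<in> A \<Longrightarrow> count (\<Sum>\<^sub># (P a)) Base = 1"
    by (rule decompose, rule that, assumption+)
  define B where "B = zsb (card J) (3 * C)"
  define I where "I = (\<Sum>a\<in>A. image_mset (Pair (cls a)) (P a))"
  have inI: "it \<in># I \<longleftrightarrow> (\<exists>a\<in>A. \<exists>g\<in>#P a. it = (cls a, g))" for it
    by (auto simp: I_def in_sum_multisets finA)
  have finN: "finite (N a)" for a using finA by (simp add: N_def)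
  \<comment> \<open>Half-edges of a kind minus those of the reversed kind; vanishing totals of this
    weight are the balance hypothesis of \<open>realize_degrees\<close>.\<close>
  define bw where "bw \<kappa> it = int (count (nbs (snd it)) \<kappa>) - int (count (nbs (snd it)) (rev \<kappa>))"
    for \<kappa> and it :: "('c \<times> ('j \<Rightarrow> int)) \<times> ('j, 'k) unt multiset"
  have cnt_le: "count (nbs g) \<kappa> \<le> B" if "a \<in> A" "g \<in># P a" for a g \<kappa>
    using P_size[OF that] size_nbs[of g] count_le_size[of "nbs g" \<kappa>] unfolding B_def by linarith
  have bw_le: "\<bar>bw \<kappa> it\<bar> \<le> int B" if it: "it \<in># I" for \<kappa> it
  proof -
    obtain a g where ag: "a \<in> A" "g \<in># P a" "it = (cls a, g)" using it unfolding inI by blast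
    show ?thesis using cnt_le[OF ag(1,2), of \<kappa>] cnt_le[OF ag(1,2), of "rev \<kappa>"] by (simp add: bw_def ag(3))
  qed
  have cnt_I: "(\<Sum>it\<in>#I. count (nbs (snd it)) \<kappa>) = (\<Sum>a\<in>A. card {b \<in> N a. k a b = \<kappa>})" for \<kappa>
  proof -
    have "(\<Sum>g\<in>#P a. count (nbs g) \<kappa>) = card {b \<in> N a. k a b = \<kappa>}" if "a \<in> A" for a
    proof -
      have "(\<Sum>g\<in>#P a. count (nbs g) \<kappa>) = count (nbs (\<Sum>\<^sub># (P a))) \<kappa>"
        by (simp add: nbs_sum_mset count_sum_mset_image)
      also have "\<dots> = card {b \<in> N a. k a b = \<kappa>}"
        unfolding P_nbs[OF that] using finN[of a] by (rule count_image_mset_set)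
      finally show ?thesis .
    qed
    then show ?thesis
      by (simp add: I_def sum_mset_sum_multisets finA image_mset.compositionality comp_def)
  qed
  have bw_zero: "(\<Sum>it\<in>#I. bw \<kappa> it) = 0" for \<kappa>
  proof -
    have "(\<Sum>it\<in>#I. bw \<kappa> it) = int (\<Sum>it\<in>#I. count (nbs (snd it)) \<kappa>) - int (\<Sum>it\<in>#I. count (nbs (snd it)) (rev \<kappa>))"
      by (induction I) (simp_all add: bw_def)
    then show ?thesis unfolding cnt_I card_Collect_k_rev by simp
  qed
  obtain Y where Y: "set_mset Y = set_mset I" "size Y \<le> card (set_mset I) * zsb (card Kd) B"
    "\<And>\<kappa>. \<kappa> \<in> Kd \<Longrightarrow> (\<Sum>it\<in>#Y. bw \<kappa> it) = 0"
    using zero_sum_same_support[of Kd I bw B] finK bw_le bw_zero by blast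
  obtain ys where ys: "mset ys = Y" using ex_mset by blast
  define l where "l = length ys"
  have ysI: "\<exists>a\<in>A. snd (ys ! i) \<in># P a \<and> fst (ys ! i) = cls a" if "i < l" for i
  proof -
    have "ys ! i \<in># I" using that ys Y(1) by (metis l_def nth_mem_mset)
    then show ?thesis unfolding inI by force
  qed
  define cl where "cl i = fst (ys ! i)" for i
  define gr where "gr i = snd (ys ! i)" for i
  have cl: "\<exists>a\<in>A. gr i \<in># P a \<and> cl i = cls a" if "i < l" for i
    using ysI[OF that] by (simp add: cl_def gr_def)
  define E where "E = {i. i < l \<and> Base \<in># gr i}"
  have E_l: "e < l" if "e \<in> E" for e using that by (simp add: E_def)
  have finE: "finite E" and cardE: "card E \<le> l"
    using card_mono[of "{..<l}" E] by (auto simp: E_def)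
  have at_index: "\<exists>i<l. cl i = cls a \<and> gr i = g" if "a \<in> A" "g \<in># P a" for a g
  proof -
    have "(cls a, g) \<in> set ys" using that inI Y(1) ys by (metis set_mset_mset)
    then show ?thesis by (force simp: in_set_conv_nth l_def cl_def gr_def)
  qed
  have base_ex: "\<exists>e\<in>E. cl e = cls a" if "a \<in> A" for a
  proof -
    have "Base \<in># \<Sum>\<^sub># (P a)" using P_Base[OF that] by (metis count_eq_zero_iff zero_neq_one)
    then obtain g where "g \<in># P a" "Base \<in># g" by auto
    then show ?thesis using at_index[OF that, of g] by (auto simp: E_def)
  qed
  \<comment> \<open>A base piece becomes a vertex and owns itself; a neutral piece goes to any base
    piece of its class. Choosing by class matters because slack units are legitimate only for the
    same residuals.\<close>
  define own where "own i = (if i \<in> E then i else SOME e. e \<in> E \<and> cl e = cl i)" for i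
  have own: "own i \<in> E \<and> cl (own i) = cl i" if "i < l" for i
  proof (cases "i \<in> E")
    case False
    have "\<exists>e. e \<in> E \<and> cl e = cl i" using cl[OF that] base_ex by metis
    from someI_ex[OF this] show ?thesis using False by (simp add: own_def)
  qed (simp add: own_def)
  define T where "T e = (\<Sum>i\<in>{i \<in> {..<l}. own i = e}. gr i)" for e
  have inT: "\<exists>i<l. own i = e \<and> u \<in># gr i" if "u \<in># T e" for u e
    using that by (auto simp: T_def in_sum_multisets)
  have T_src: "\<exists>a\<in>A. cls a = cl e \<and> (\<exists>g\<in>#P a. u \<in># g)" if "u \<in># T e" "e \<in> E" for u e
    using inT[OF that(1)] own cl by metis
  have T_zero: "(\<Sum>u\<in>#T e. uw w w0 D (cl e) j u) = 0" if "e \<in> E" "j \<in> J" for e j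
  proof -
    have "(\<Sum>u\<in>#gr i. uw w w0 D (cl e) j u) = 0" if i: "i < l" "own i = e" for i
    proof -
      obtain a where "a \<in> A" "gr i \<in># P a" "cl i = cls a" using cl[OF i(1)] by blast
      moreover have "cl e = cl i" using own[OF i(1)] i(2) by simp
      ultimately show ?thesis using P_zero \<open>j \<in> J\<close> by simp
    qed
    then show ?thesis by (simp add: T_def sum_mset_sum_multisets)
  qed
  have gr_Base: "count (gr i) Base \<le> 1" if il: "i < l" for i
  proof -
    obtain a where a: "a \<in> A" "gr i \<in># P a" using cl[OF il] by blast
    then obtain P' where "P a = add_mset (gr i) P'" by (metis mset_add)
    then show ?thesis using P_Base[OF a(1)] by simp
  qed
  have T_Base: "count (T e) Base = 1" if "e \<in> E" for e
  proof -
    have "count (T e) Base = (\<Sum>i\<in>{i \<in> {..<l}. own i = e}. count (gr i) Base)"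
      by (simp add: T_def count_sum)
    also have "\<dots> = (\<Sum>i\<in>{i \<in> {..<l}. own i = e}. if i = e then 1 else 0)"
    proof (rule sum.cong[OF refl])
      fix i assume i: "i \<in> {i \<in> {..<l}. own i = e}"
      show "count (gr i) Base = (if i = e then 1 else 0)"
      proof (cases "i = e")
        case True
        then have "count (gr i) Base > 0" using \<open>e \<in> E\<close> by (simp add: E_def)
        moreover have "count (gr i) Base \<le> 1" using gr_Base[of i] i by simp
        ultimately have "count (gr i) Base = 1" by linarith
        then show ?thesis using True by simp
      next
        case False
        then have "i \<notin> E" using i by (auto simp: own_def)
        then show ?thesis using False i by (simp add: E_def count_eq_zero_iff)
      qed
    qed
    also have "\<dots> = 1"
    proof -
      have "own e = e" using that by (simp add: own_def)
      then show ?thesis using E_l[OF that] by simp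
    qed
    finally show ?thesis .
  qed
  have fibre: "(\<Sum>e\<in>E. \<Sum>i\<in>{i \<in> {..<l}. own i = e}. f i) = (\<Sum>i<l. f i)" for f :: "nat \<Rightarrow> nat"
    using own finE by (intro sum.group) auto
  have bal: "(\<Sum>e\<in>E. count (nbs (T e)) (rev \<kappa>)) = (\<Sum>e\<in>E. count (nbs (T e)) \<kappa>)" for \<kappa>
  proof -
    have tot: "(\<Sum>e\<in>E. count (nbs (T e)) \<kappa>) = (\<Sum>it\<in>#Y. count (nbs (snd it)) \<kappa>)" for \<kappa>
    proof -
      have "(\<Sum>e\<in>E. count (nbs (T e)) \<kappa>) = (\<Sum>i<l. count (nbs (gr i)) \<kappa>)"
        using fibre[of "\<lambda>i. count (nbs (gr i)) \<kappa>"] by (simp add: T_def nbs_sum count_sum)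
      also have "\<dots> = (\<Sum>it\<in>#Y. count (nbs (snd it)) \<kappa>)"
        unfolding gr_def l_def ys[symmetric] by (rule sum_multisets_eq_list)
      finally show ?thesis .
    qed
    have bwY: "(\<Sum>it\<in>#Y. bw \<kappa> it) = int (\<Sum>it\<in>#Y. count (nbs (snd it)) \<kappa>) - int (\<Sum>it\<in>#Y. count (nbs (snd it)) (rev \<kappa>))" for \<kappa>
      by (induction Y) (simp_all add: bw_def)
    have *: "(\<Sum>it\<in>#Y. count (nbs (snd it)) (rev \<kappa>)) = (\<Sum>it\<in>#Y. count (nbs (snd it)) \<kappa>)" if "\<kappa> \<in> Kd" for \<kappa>
      using bwY[of \<kappa>] Y(3)[OF that] by linarith
    \<comment> \<open>Balance was imposed only for kinds in \<open>Kd\<close>, but other kinds occur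
      in no piece. \<open>Kd\<close> is not assumed to be closed under \<open>rev\<close>, hence the
      case distinction below.\<close>
    have zero: "(\<Sum>it\<in>#Y. count (nbs (snd it)) \<kappa>) = 0" if "\<kappa> \<notin> Kd" for \<kappa>
    proof -
      have "count (nbs (snd it)) \<kappa> = 0" if "it \<in># Y" for it
      proof -
        have "it \<in># I" using that Y(1) by simp
        then obtain a g where ag: "a \<in> A" "g \<in># P a" "it = (cls a, g)" unfolding inI by blast
        have "Nb \<kappa> \<notin># g" using P_set[OF ag(1,2)] \<open>\<kappa> \<notin> Kd\<close> by auto
        then show ?thesis by (simp add: ag(3) count_eq_zero_iff in_nbs)
      qed
      then show ?thesis by (auto intro!: sum_mset.neutral)
    qed
    have "(\<Sum>it\<in>#Y. count (nbs (snd it)) (rev \<kappa>)) = (\<Sum>it\<in>#Y. count (nbs (snd it)) \<kappa>)"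
    proof (cases "\<kappa> \<in> Kd")
      case True
      then show ?thesis by (rule *)
    next
      case False
      show ?thesis
      proof (cases "rev \<kappa> \<in> Kd")
        case True
        from *[OF this] show ?thesis unfolding rev by simp
      next
        case False
        then show ?thesis by (simp only: zero[OF False] zero[OF \<open>\<kappa> \<notin> Kd\<close>])
      qed
    qed
    then show ?thesis unfolding tot .
  qed
  define realized where "realized n \<pi> G \<longleftrightarrow> n = card E * (2 * Suc (\<Sum>e\<in>E. size (nbs (T e)))) \<and> \<pi> ` {..<n::nat} = E
    \<and> (\<forall>u v \<kappa> \<kappa>'. G u \<kappa> v \<longrightarrow> G u \<kappa>' v \<longrightarrow> \<kappa> = \<kappa>')
    \<and> (\<forall>u v \<kappa>. G u \<kappa> v \<longrightarrow> u < n \<and> v < n \<and> u \<noteq> v \<and> G v (rev \<kappa>) u)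
    \<and> (\<forall>u<n. \<forall>\<kappa>. card {v. G u \<kappa> v} = count (nbs (T (\<pi> u))) \<kappa>)" for n \<pi> G
  have "\<exists>n \<pi> G. realized n \<pi> G"
    unfolding realized_def by (rule realize_degrees[OF finE rev bal])
  then obtain n \<pi> G where "realized n \<pi> G" by blast
  note G = this[unfolded realized_def]
  have n_eq: "n = card E * (2 * Suc (\<Sum>e\<in>E. size (nbs (T e))))" and \<pi>: "\<pi> ` {..<n} = E"
    using G by blast+
  have G1: "\<kappa> = \<kappa>'" if "G u \<kappa> v" "G u \<kappa>' v" for u v \<kappa> \<kappa>' using G that by blast
  have G2: "u < n \<and> v < n \<and> u \<noteq> v \<and> G v (rev \<kappa>) u" if "G u \<kappa> v" for u v \<kappa> using G that by blast
  have G3: "card {v. G u \<kappa> v} = count (nbs (T (\<pi> u))) \<kappa>" if "u < n" for u \<kappa> using G that by blast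
  have \<pi>E: "\<pi> u \<in> E" if "u < n" for u using \<pi> that by blast
  have finG: "finite {v. G u \<kappa> v}" for u \<kappa>
    by (rule finite_subset[of _ "{..<n}"]) (use G2 in auto)
  have G_in: "\<kappa> \<in># nbs (T (\<pi> u))" if "G u \<kappa> v" for u v \<kappa>
  proof -
    have "{v. G u \<kappa> v} \<noteq> {}" using that by blast
    then have "card {v. G u \<kappa> v} \<noteq> 0" using finG by simp
    then show ?thesis using G3 G2[OF that] by (metis count_eq_zero_iff)
  qed
  show thesis
  proof (rule that[of n "\<lambda>u. fst (cl (\<pi> u))" G])
    obtain a where "a \<in> A" using neA by blast
    then have "E \<noteq> {}" using base_ex by blast
    then have "card E > 0" using finE by (simp add: card_gt_0_iff)
    then show "0 < n" by (simp add: n_eq)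
    show "n \<le> graph_bound (card J) (card Kd) (card Cd) C"
    proof -
      let ?N = "Nb ` Kd :: ('j, 'k) unt set" and ?U = "Up ` J :: ('j, 'k) unt set" and ?D = "Dn ` J :: ('j, 'k) unt set"
      define Us where "Us = insert Base (?N \<union> ?U \<union> ?D)"
      have finUs: "finite Us" using finK finJ by (simp add: Us_def)
      have "card Us \<le> Suc (card (?N \<union> ?U \<union> ?D))"
        unfolding Us_def using finK finJ by (simp add: card_insert_if)
      also have "card (?N \<union> ?U \<union> ?D) \<le> card ?N + card ?U + card ?D"
        using card_Un_le[of "?N \<union> ?U" ?D] card_Un_le[of ?N ?U] by linarith
      also have "\<dots> \<le> card Kd + card J + card J"
        using finK finJ by (intro add_mono card_image_le)
      finally have cardUs: "card Us \<le> 1 + card Kd + 2 * card J" by simp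
      let ?X = "Cd \<times> (J \<rightarrow>\<^sub>E {- (2 * int C)..2 * int C})" and ?M = "{g. set_mset g \<subseteq> Us \<and> size g \<le> B}"
      have finX: "finite ?X" using finC finJ by (intro finite_cartesian_product finite_PiE) auto
      have "card {- (2 * int C)..2 * int C} = 4 * C + 1" by simp
      then have cardX: "card ?X = card Cd * (4 * C + 1) ^ card J"
        using finJ by (simp add: card_cartesian_product card_PiE)
      have finM: "finite ?M" and cardM: "card ?M \<le> (\<Sum>i<Suc B. (1 + card Kd + 2 * card J) ^ i)"
        using card_bounded_multisets[OF finUs cardUs] by blast+
      have fin: "finite (?X \<times> ?M)" using finX finM by (rule finite_cartesian_product)
      have le: "card (?X \<times> ?M) \<le> item_bound (card J) (card Kd) (card Cd) C"
        unfolding item_bound_def card_cartesian_product[of ?X ?M] cardX B_def[symmetric]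
        by (rule mult_le_mono2[OF cardM])
      have sub: "set_mset I \<subseteq> ?X \<times> ?M"
      proof
        fix it assume "it \<in># I"
        then obtain a g where ag: "a \<in> A" "g \<in># P a" "it = (cls a, g)" unfolding inI by blast
        have "g \<in> ?M" unfolding Us_def B_def
          using P_set[OF ag(1,2)] P_size[OF ag(1,2)] by (intro CollectI conjI)
        with cls_in[OF ag(1)] show "it \<in> ?X \<times> ?M" unfolding ag(3) by (rule SigmaI)
      qed
      have "card (set_mset I) \<le> item_bound (card J) (card Kd) (card Cd) C"
        using card_mono[OF fin sub] le by (rule order_trans)
      then have "card (set_mset I) * zsb (card Kd) B \<le> items_bound (card J) (card Kd) (card Cd) C"
        unfolding items_bound_def B_def by (rule mult_le_mono1)
      with Y(2) have "size Y \<le> items_bound (card J) (card Kd) (card Cd) C" by (rule order_trans)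
      then have l_le: "l \<le> items_bound (card J) (card Kd) (card Cd) C"
        using ys by (auto simp: l_def)
      have "(\<Sum>e\<in>E. size (nbs (T e))) = (\<Sum>i<l. size (nbs (gr i)))"
        using fibre[of "\<lambda>i. size (nbs (gr i))"] by (simp add: T_def nbs_sum size_multiset_sum)
      also have "\<dots> \<le> (\<Sum>i<l. B)"
      proof (rule sum_mono)
        fix i assume "i \<in> {..<l}"
        then obtain a where "a \<in> A" "gr i \<in># P a" using cl by blast
        then have "size (gr i) \<le> B" using P_size by (simp add: B_def)
        then show "size (nbs (gr i)) \<le> B" using size_nbs order_trans by blast
      qed
      finally have "(\<Sum>e\<in>E. size (nbs (T e))) \<le> l * B" by simp
      also have "\<dots> \<le> items_bound (card J) (card Kd) (card Cd) C * B" using l_le by (rule mult_le_mono1)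
      finally show ?thesis
        unfolding n_eq graph_bound_def B_def using cardE l_le by (intro mult_le_mono) auto
    qed
  next
    fix u assume u: "u < n"
    obtain a where a: "a \<in> A" "cl (\<pi> u) = cls a" using cl[OF E_l[OF \<pi>E[OF u]]] by blast
    have same: "same_order_mod (\<delta> j) (D j) (w0 j (fst (cl (\<pi> u))) + (\<Sum>(v, \<kappa>)\<in>{(v, \<kappa>). G u \<kappa> v}. w j \<kappa>)) (S j a)"
      if j: "j \<in> J" for j
    proof -
      let ?T = "T (\<pi> u)"
      have "(\<Sum>\<kappa>\<in>#nbs ?T. w j \<kappa>) = (\<Sum>\<kappa>\<in>set_mset (nbs ?T). int (count (nbs ?T) \<kappa>) * w j \<kappa>)"
        by (rule sum_mset_image_count)
      also have "\<dots> = (\<Sum>\<kappa>\<in>set_mset (nbs ?T). \<Sum>v\<in>{v. G u \<kappa> v}. w j \<kappa>)"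
        using G3[OF u] by simp
      also have "\<dots> = (\<Sum>(\<kappa>, v)\<in>(SIGMA \<kappa>:set_mset (nbs ?T). {v. G u \<kappa> v}). w j \<kappa>)"
        using finG by (intro sum.Sigma) auto
      also have "\<dots> = (\<Sum>(v, \<kappa>)\<in>{(v, \<kappa>). G u \<kappa> v}. w j \<kappa>)"
        by (rule sum.reindex_bij_witness[of _ prod.swap prod.swap]) (use G_in in auto)
      finally have eq: "(\<Sum>\<kappa>\<in>#nbs ?T. w j \<kappa>) = (\<Sum>(v, \<kappa>)\<in>{(v, \<kappa>). G u \<kappa> v}. w j \<kappa>)" .
      \<comment> \<open>The zero-sum equation of the combined pieces, which contain one base unit,
        solved for the weighted sum.\<close>
      have "w0 j (fst (cl (\<pi> u))) + (\<Sum>\<kappa>\<in>#nbs ?T. w j \<kappa>)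
        = snd (cl (\<pi> u)) j + int (D j) * int (count ?T (Up j)) - int (D j) * int (count ?T (Dn j))"
        using T_zero[OF \<pi>E[OF u] j] unfolding sum_uw T_Base[OF \<pi>E[OF u]] by simp
      moreover have "count ?T (Up j) > 0 \<longrightarrow> snd (cl (\<pi> u)) j > \<delta> j"
      proof
        assume "count ?T (Up j) > 0"
        then have "Up j \<in># ?T" by simp
        then obtain a' g where "a' \<in> A" "cls a' = cl (\<pi> u)" "g \<in># P a'" "Up j \<in># g"
          using T_src \<pi>E[OF u] by blast
        then show "snd (cl (\<pi> u)) j > \<delta> j" using P_Up[of a' g j] by simp
      qed
      moreover have "count ?T (Dn j) > 0 \<longrightarrow> snd (cl (\<pi> u)) j < \<delta> j"
      proof
        assume "count ?T (Dn j) > 0"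
        then have "Dn j \<in># ?T" by simp
        then obtain a' g where "a' \<in> A" "cls a' = cl (\<pi> u)" "g \<in># P a'" "Dn j \<in># g"
          using T_src \<pi>E[OF u] by blast
        then show "snd (cl (\<pi> u)) j < \<delta> j" using P_Dn[of a' g j] by simp
      qed
      ultimately have "same_order_mod (\<delta> j) (D j) (w0 j (fst (cl (\<pi> u))) + (\<Sum>\<kappa>\<in>#nbs ?T. w j \<kappa>)) (snd (cl (\<pi> u)) j)"
        by (rule residual_same)
      then show ?thesis unfolding eq using P_same[OF a(1) j] unfolding a(2) by (rule same_order_mod_trans)
    qed
    show "\<exists>a\<in>A. col a = fst (cl (\<pi> u)) \<and> (\<forall>j\<in>J. same_order_mod (\<delta> j) (D j)
        (w0 j (fst (cl (\<pi> u))) + (\<Sum>(v, \<kappa>)\<in>{(v, \<kappa>). G u \<kappa> v}. w j \<kappa>)) (S j a))"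
      using a same cls_col by auto
  next
    fix a assume "a \<in> A"
    then obtain e where "e \<in> E" "cl e = cls a" using base_ex by blast
    then show "\<exists>u<n. fst (cl (\<pi> u)) = col a" using \<pi> cls_col by (metis imageE lessThan_iff)
  next
    fix u v \<kappa> assume g: "G u \<kappa> v"
    have u: "u < n" using G2[OF g] by blast
    have "Nb \<kappa> \<in># T (\<pi> u)" using G_in[OF g] unfolding in_nbs .
    then obtain a g' where a: "a \<in> A" "cls a = cl (\<pi> u)" "g' \<in># P a" "Nb \<kappa> \<in># g'"
      using T_src \<pi>E[OF u] by blast
    have "\<kappa> \<in># nbs (\<Sum>\<^sub># (P a))" unfolding in_nbs using a(3,4) by auto
    then obtain b where b: "b \<in> N a" "\<kappa> = k a b" unfolding P_nbs[OF a(1)] using finN[of a] by auto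
    have "src \<kappa> = fst (cls a)" unfolding b(2) cls_col using k_src[OF a(1)] b(1) by (simp add: N_def)
    then have "src \<kappa> = fst (cl (\<pi> u))" unfolding a(2) .
    moreover have "\<exists>a\<in>A. \<exists>b\<in>N a. \<kappa> = k a b" using a(1) b by (intro bexI)
    ultimately show "u < n \<and> v < n \<and> u \<noteq> v \<and> G v (rev \<kappa>) u \<and> src \<kappa> = fst (cl (\<pi> u))
       \<and> (\<exists>a\<in>A. \<exists>b\<in>N a. \<kappa> = k a b)"
      using G2[OF g] by (intro conjI) blast+
  next
    fix u v \<kappa> \<kappa>' assume "G u \<kappa> v" "G u \<kappa>' v"
    then show "\<kappa> = \<kappa>'" by (rule G1)
  qed
qed

end

section \<open>Formulas and their codes\<close>

text \<open>Formulas recur through tuples inside a list; the recursion of \<open>enc\<close> already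
  unpacks these tuples, and its induction rule yields the hypothesis in that form.\<close>

lemma fm_induct [case_names Atom Eq Neg Conj Disj ExG AllG Pres]:
  assumes "\<And>a. P (Atom a)" "\<And>v w. P (Eq v w)" "\<And>\<phi>. P \<phi> \<Longrightarrow> P (Neg \<phi>)"
    "\<And>\<phi> \<psi>. P \<phi> \<Longrightarrow> P \<psi> \<Longrightarrow> P (Conj \<phi> \<psi>)" "\<And>\<phi> \<psi>. P \<phi> \<Longrightarrow> P \<psi> \<Longrightarrow> P (Disj \<phi> \<psi>)"
    "\<And>Q g \<phi>. P \<phi> \<Longrightarrow> P (ExG Q g \<phi>)" "\<And>Q g \<phi>. P \<phi> \<Longrightarrow> P (AllG Q g \<phi>)"
    "\<And>v ts c d. (\<And>l R i \<phi>. (l, R, i, \<phi>) \<in> set ts \<Longrightarrow> P \<phi>) \<Longrightarrow> P (Pres v ts c d)"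
  shows "P \<phi>"
proof (induction \<phi> rule: enc.induct)
  case (8 v ts c d)
  show ?case by (rule assms(8)) (rule 8[OF _ refl refl refl])
qed (rule assms; assumption)+

lemma le_triangle: "n \<le> triangle n"
  by (induction n) auto

text \<open>The code of a pair bounds even the sum of its components, so a list code bounds the sum
  of the entries and thereby the sum of the absolute coefficients of a counting formula.\<close>

lemma add_le_prod_encode: "x + y \<le> prod_encode (x, y)"
  using le_triangle[of "x + y"] by (simp add: prod_encode_def)

lemma prod_encode_mono:
  assumes "x \<le> x'" "y \<le> y'"
  shows "prod_encode (x, y) \<le> prod_encode (x', y')"
proof -
  have "triangle m \<le> triangle n" if "m \<le> n" for m n
    using that by (induction n) (auto simp: le_Suc_eq)
  then show ?thesis using assms by (simp add: prod_encode_def add_mono)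
qed

lemma sum_list_le_list_encode: "sum_list xs \<le> list_encode xs"
proof (induction xs)
  case (Cons x xs)
  then show ?case using add_le_prod_encode[of x "list_encode xs"] by simp
qed simp

lemma length_le_list_encode: "length xs \<le> list_encode xs"
proof (induction xs)
  case (Cons x xs)
  then show ?case using le_prod_encode_2[of "list_encode xs" x] by simp
qed simp

lemma member_le_list_encode: "x \<in> set xs \<Longrightarrow> x \<le> list_encode xs"
  using member_le_sum_list[of x xs] sum_list_le_list_encode[of xs] by linarith

lemma abs_le_int_encode: "\<bar>i\<bar> \<le> int (int_encode i)"
proof -
  have "\<bar>int_decode z\<bar> \<le> int z" for z
  proof (cases "even z")
    case False
    then have "z div 2 + 1 \<le> z" by presburger
    then show ?thesis using False by (simp add: int_decode_def sum_decode_def)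
  qed (simp add: int_decode_def sum_decode_def)
  from this[of "int_encode i"] show ?thesis unfolding int_encode_inverse .
qed

lemma enc_var_inj: "enc_var v = enc_var w \<longleftrightarrow> v = w"
  by (cases v; cases w) auto

lemma enc_vset_inj: "enc_vset Q = enc_vset Q' \<longleftrightarrow> Q = Q'"
proof
  assume "enc_vset Q = enc_vset Q'"
  then have "v \<in> Q \<longleftrightarrow> v \<in> Q'" for v by (cases v) (auto simp: enc_vset_def of_bool_def split: if_splits)
  then show "Q = Q'" by blast
qed simp

lemma enc_atom_inj: "enc_atom a = enc_atom b \<longleftrightarrow> a = b"
  by (cases a; cases b) (auto simp: enc_var_inj)

lemma enc_cmp_inj: "enc_cmp a = enc_cmp b \<longleftrightarrow> a = b"
  by (cases a; cases b) auto

text \<open>Needed so that only finitely many formulas lie below a code bound, at most as many as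
  there are codes.\<close>

lemma enc_inj: "enc \<phi> = enc \<psi> \<longleftrightarrow> \<phi> = \<psi>"
proof
  show "enc \<phi> = enc \<psi> \<Longrightarrow> \<phi> = \<psi>"
  proof (induction \<phi> arbitrary: \<psi> rule: fm_induct)
    case (Pres v ts c d)
    then obtain v' ts' c' d' where \<psi>: "\<psi> = Pres v' ts' c' d'" by (cases \<psi>) auto
    have "ts = ts'"
    proof (rule list.inj_map_strong)
      show "map (\<lambda>(l, R, isinv, \<phi>). prod_encode (int_encode l, prod_encode (R, prod_encode (of_bool isinv, enc \<phi>)))) ts
          = map (\<lambda>(l, R, isinv, \<phi>). prod_encode (int_encode l, prod_encode (R, prod_encode (of_bool isinv, enc \<phi>)))) ts'"
        using Pres.prems by (simp add: \<psi> list_encode_eq)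
    qed (use Pres.IH in \<open>auto simp: int_encode_eq of_bool_def split: if_splits\<close>)
    then show ?case using Pres.prems by (simp add: \<psi> enc_var_inj enc_cmp_inj int_encode_eq)
  next
    case (Atom a) then show ?case by (cases \<psi>) (auto simp: enc_atom_inj)
  next
    case (Eq v w) then show ?case by (cases \<psi>) (auto simp: enc_var_inj)
  next
    case (Neg \<phi>) then show ?case by (cases \<psi>) auto
  next
    case (Conj \<phi> \<phi>') then show ?case by (cases \<psi>) auto
  next
    case (Disj \<phi> \<phi>') then show ?case by (cases \<psi>) auto
  next
    case (ExG Q g \<phi>) then show ?case by (cases \<psi>) (auto simp: enc_vset_inj enc_atom_inj)
  next
    case (AllG Q g \<phi>) then show ?case by (cases \<psi>) (auto simp: enc_vset_inj enc_atom_inj)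
  qed
qed simp

lemma prod_encode_leD: "prod_encode (x, y) \<le> b \<Longrightarrow> x \<le> b \<and> y \<le> b"
  using le_prod_encode_1[of x y] le_prod_encode_2[of y x] by linarith

lemma snd_less_prod_encode: "1 \<le> k \<Longrightarrow> r < prod_encode (k, r)"
  using add_le_prod_encode[of k r] by linarith

definition enc_term :: "int \<times> nat \<times> bool \<times> fm \<Rightarrow> nat" where
  "enc_term = (\<lambda>(l, R, i, \<phi>). prod_encode (int_encode l, prod_encode (R, prod_encode (of_bool i, enc \<phi>))))"

lemma enc_Pres: "enc (Pres v ts c d) = prod_encode (7, prod_encode (enc_var v, prod_encode (list_encode (map enc_term ts),
    prod_encode (enc_cmp c, int_encode d))))"
  by (simp add: enc_term_def)

lemma enc_Pres_bounds:
  assumes "enc (Pres v ts c d) \<le> b"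
  shows "list_encode (map enc_term ts) \<le> b" "enc_cmp c \<le> b" "int_encode d \<le> b"
proof -
  note 1 = prod_encode_leD[OF conjunct2[OF prod_encode_leD[OF conjunct2[OF prod_encode_leD[OF assms[unfolded enc_Pres]]]]]]
  note 2 = prod_encode_leD[OF conjunct2[OF 1]]
  show "list_encode (map enc_term ts) \<le> b" "enc_cmp c \<le> b" "int_encode d \<le> b"
    by (rule conjunct1[OF 1], rule conjunct1[OF 2], rule conjunct2[OF 2])
qed

lemma enc_Pres_member:
  assumes "enc (Pres v ts c d) \<le> b" "(l, R, i, \<phi>) \<in> set ts"
  shows "R \<le> b" "enc \<phi> \<le> b"
proof -
  have "enc_term (l, R, i, \<phi>) \<in> set (map enc_term ts)" unfolding set_map using assms(2) by (rule imageI)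
  from order_trans[OF member_le_list_encode[OF this] enc_Pres_bounds(1)[OF assms(1)]]
  have "prod_encode (int_encode l, prod_encode (R, prod_encode (of_bool i, enc \<phi>))) \<le> b" by (simp add: enc_term_def)
  note 1 = prod_encode_leD[OF conjunct2[OF prod_encode_leD[OF this]]]
  show "R \<le> b" by (rule conjunct1[OF 1])
  show "enc \<phi> \<le> b" using prod_encode_leD[OF conjunct2[OF 1]] by (rule conjunct2)
qed

text \<open>Bounds what a single element can contribute to the sum of a counting formula, whichever
  of the conditions hold there.\<close>

lemma enc_Pres_coeffs:
  assumes "enc (Pres v ts c d) \<le> b"
  shows "(\<Sum>(l, R, i, \<phi>)\<leftarrow>ts. \<bar>l\<bar>) \<le> int b"
proof -
  have "\<bar>l\<bar> \<le> int (enc_term (l, R, i, \<phi>))" for l R i \<phi>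
    using abs_le_int_encode[of l] prod_encode_leD[OF order_refl, of "int_encode l"]
    unfolding enc_term_def prod.case by (meson of_nat_mono order_trans)
  then have "(\<Sum>(l, R, i, \<phi>)\<leftarrow>ts. \<bar>l\<bar>) \<le> (\<Sum>t\<leftarrow>ts. int (enc_term t))"
    by (intro sum_list_mono) auto
  also have "\<dots> = int (sum_list (map enc_term ts))" by (induction ts) auto
  also have "\<dots> \<le> int b"
    using sum_list_le_list_encode[of "map enc_term ts"] enc_Pres_bounds(1)[OF assms] by linarith
  finally show ?thesis .
qed

text \<open>Lets structural recursion on formulas be simulated by course-of-values recursion on
  codes. Strictness comes from the tags, which are nonzero for compound formulas.\<close>

lemma enc_less:
  "enc \<phi> < enc (Neg \<phi>)" "enc \<phi> < enc (Conj \<phi> \<psi>)" "enc \<psi> < enc (Conj \<phi> \<psi>)"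
  "enc \<phi> < enc (Disj \<phi> \<psi>)" "enc \<psi> < enc (Disj \<phi> \<psi>)" "enc \<phi> < enc (ExG Q g \<phi>)" "enc \<phi> < enc (AllG Q g \<phi>)"
proof -
  note bin = prod_encode_leD[OF order_refl, of "enc \<phi>" "enc \<psi>"]
  note quant = prod_encode_leD[OF conjunct2[OF prod_encode_leD[OF order_refl, of "enc_vset Q" "prod_encode (enc_atom g, enc \<phi>)"]]]
  show "enc \<phi> < enc (Neg \<phi>)" by (simp add: snd_less_prod_encode)
  show "enc \<phi> < enc (Conj \<phi> \<psi>)" "enc \<psi> < enc (Conj \<phi> \<psi>)" "enc \<phi> < enc (Disj \<phi> \<psi>)" "enc \<psi> < enc (Disj \<phi> \<psi>)"
    using bin by (auto intro: le_less_trans[OF _ snd_less_prod_encode])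
  show "enc \<phi> < enc (ExG Q g \<phi>)" "enc \<phi> < enc (AllG Q g \<phi>)"
    using quant by (auto intro: le_less_trans[OF _ snd_less_prod_encode])
qed

lemma enc_less_Pres:
  assumes "(l, R, i, \<phi>) \<in> set ts"
  shows "enc \<phi> < enc (Pres v ts c d)"
proof -
  have "enc_term (l, R, i, \<phi>) \<le> list_encode (map enc_term ts)"
    using assms by (intro member_le_list_encode) simp
  then have "enc \<phi> \<le> list_encode (map enc_term ts)"
    unfolding enc_term_def prod.case by (meson prod_encode_leD)
  also have "\<dots> \<le> prod_encode (enc_var v, prod_encode (list_encode (map enc_term ts), prod_encode (enc_cmp c, int_encode d)))"
    by (meson prod_encode_leD order_refl)
  also have "\<dots> < enc (Pres v ts c d)" unfolding enc_Pres by (rule snd_less_prod_encode) simp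
  finally show ?thesis .
qed

section \<open>Two-variable assignments and local forms of the semantics\<close>

definition as :: "nat \<Rightarrow> nat \<Rightarrow> var \<Rightarrow> nat" where
  "as u v = (\<lambda>w. case w of VX \<Rightarrow> u | VY \<Rightarrow> v)"

lemma as_simps [simp]: "as u v VX = u" "as u v VY = v"
  by (simp_all add: as_def)

lemma as_eta: "as (\<sigma> VX) (\<sigma> VY) = \<sigma>"
  by (rule ext) (simp add: as_def split: var.split)

lemma as_upd [simp]: "(as u v)(VX := w) = as w v" "(as u v)(VY := w) = as u w"
  by (auto simp: as_def fun_eq_iff split: var.split)

lemma all_var: "(\<forall>v. P v) \<longleftrightarrow> P VX \<and> P VY"
proof (intro iffI allI)
  show "P v" if "P VX \<and> P VY" for v using that by (cases v) simp_all
qed simp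

lemma sat_cong: "(\<And>v. v \<in> fv \<phi> \<Longrightarrow> \<sigma> v = \<tau> v) \<Longrightarrow> sat M \<phi> \<sigma> = sat M \<phi> \<tau>"
proof (induction \<phi> arbitrary: \<sigma> \<tau> rule: fm_induct)
  case (Atom a)
  then show ?case by (cases a) auto
next
  case (Neg \<phi>)
  have "sat M \<phi> \<sigma> = sat M \<phi> \<tau>" by (rule Neg.IH) (use Neg.prems in simp)
  then show ?case by simp
next
  case (Conj \<phi> \<psi>)
  then show ?case by (metis UnCI fv.simps(4) sat.simps(4))
next
  case (Disj \<phi> \<psi>)
  then show ?case by (metis UnCI fv.simps(5) sat.simps(5))
next
  case (ExG Q g \<phi>)
  have "sat M (ExG Q g \<phi>) \<tau>" if sat: "sat M (ExG Q g \<phi>) \<sigma>" and fv: "\<And>v. v \<in> fv (ExG Q g \<phi>) \<Longrightarrow> \<sigma> v = \<tau> v" for \<sigma> \<tau>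
  proof -
    obtain \<sigma>' where s: "\<forall>v. v \<notin> Q \<longrightarrow> \<sigma>' v = \<sigma> v" "\<forall>v\<in>Q. \<sigma>' v \<in> dom M" "asat M g \<sigma>'" "sat M \<phi> \<sigma>'"
      using sat by auto
    define \<tau>' where "\<tau>' v = (if v \<in> Q then \<sigma>' v else \<tau> v)" for v
    have eq: "\<tau>' v = \<sigma>' v" if "v \<in> avars g \<union> fv \<phi>" for v
      using that fv[of v] s(1) by (auto simp: \<tau>'_def)
    have "asat M g \<tau>'" using s(3) eq by (cases g) auto
    moreover have "sat M \<phi> \<tau>'" using s(4) eq ExG.IH[of \<tau>' \<sigma>'] by simp
    ultimately show ?thesis using s(2) by (auto simp: \<tau>'_def intro!: exI[of _ \<tau>'])
  qed
  then show ?case using ExG.prems by metis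
next
  case (AllG Q g \<phi>)
  have "sat M (AllG Q g \<phi>) \<sigma>" if sat: "sat M (AllG Q g \<phi>) \<tau>" and fv: "\<And>v. v \<in> fv (AllG Q g \<phi>) \<Longrightarrow> \<sigma> v = \<tau> v" for \<sigma> \<tau>
    unfolding sat.simps
  proof (intro allI impI)
    fix \<sigma>' assume s: "(\<forall>v. v \<notin> Q \<longrightarrow> \<sigma>' v = \<sigma> v) \<and> (\<forall>v\<in>Q. \<sigma>' v \<in> dom M)" "asat M g \<sigma>'"
    define \<tau>' where "\<tau>' v = (if v \<in> Q then \<sigma>' v else \<tau> v)" for v
    have eq: "\<tau>' v = \<sigma>' v" if "v \<in> avars g \<union> fv \<phi>" for v
      using that fv[of v] s(1) by (auto simp: \<tau>'_def)
    have "asat M g \<tau>'" using s(2) eq by (cases g) auto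
    then have "sat M \<phi> \<tau>'" using sat s(1) by (auto simp: \<tau>'_def)
    then show "sat M \<phi> \<sigma>'" using eq AllG.IH[of \<tau>' \<sigma>'] by simp
  qed
  then show ?case using AllG.prems by metis
next
  case (Pres v ts c d)
  then have "\<sigma>(other v := b) = \<tau>(other v := b)" for b
    by (cases v) (auto simp: fun_eq_iff all_var)
  then show ?case using Pres.prems by simp
qed simp_all

text \<open>Comparisons with \<open>d\<close> depend on the sign of the difference, congruences on
  the residue. For modulus 0 the operation \<open>mod\<close> is the identity and the congruence is
  equality, so the sign decides it; \<open>max 1 m\<close> covers this case.\<close>

lemma cmp_holds_same_order:
  assumes "same_order_mod d D s' s" "\<And>m. c = CCong m \<or> c = CNCong m \<Longrightarrow> D = max 1 m"
  shows "cmp_holds c s' d = cmp_holds c s d"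
proof -
  have order: "s' = d \<longleftrightarrow> s = d" "s' < d \<longleftrightarrow> s < d" "s' > d \<longleftrightarrow> s > d" "s' \<le> d \<longleftrightarrow> s \<le> d" "s' \<ge> d \<longleftrightarrow> s \<ge> d"
    using assms(1) by (auto simp: same_order_mod_def sgn_if split: if_splits)
  have "s' mod int m = d mod int m \<longleftrightarrow> s mod int m = d mod int m" if "D = max 1 m" for m
  proof (cases "m = 0")
    case False
    then have "int m dvd s' - s" using assms(1) that by (simp add: same_order_mod_def max_def split: if_splits)
    then have "s' mod int m = s mod int m" by (simp add: mod_eq_dvd_iff)
    then show ?thesis by simp
  qed (simp add: order)
  then show ?thesis using assms(2) order by (cases c) auto
qed

definition as2 :: "var \<Rightarrow> nat \<Rightarrow> nat \<Rightarrow> var \<Rightarrow> nat" where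
  "as2 v a b = (if v = VX then as a b else as b a)"

definition atm :: "var \<Rightarrow> nat \<Rightarrow> bool \<Rightarrow> fm" where
  "atm v R i = Atom (if i then BA R (other v) v else BA R v (other v))"

text \<open>The contribution of a single \<open>b\<close>. Rewriting counts as sums over
  \<open>b\<close> turns a counting formula into a weight on pairs.\<close>

definition term_at :: "struct \<Rightarrow> var \<Rightarrow> (int \<times> nat \<times> bool \<times> fm) list \<Rightarrow> nat \<Rightarrow> nat \<Rightarrow> int" where
  "term_at M v ts a b = (\<Sum>(l, R, i, \<phi>)\<leftarrow>ts. l * of_bool (sat M (atm v R i) (as2 v a b) \<and> sat M \<phi> (as2 v a b)))"

lemma sum_list_card_swap:
  assumes "finite A"
  shows "(\<Sum>(l, R, i, \<phi>)\<leftarrow>ts. l * int (card {b \<in> A. P R i \<phi> b}))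
    = (\<Sum>b\<in>A. \<Sum>(l, R, i, \<phi>)\<leftarrow>ts. l * of_bool (P R i \<phi> b))"
proof (induction ts)
  case (Cons t ts)
  obtain l R i \<phi> where t: "t = (l, R, i, \<phi>)" by (cases t)
  have "int (card {b \<in> A. P R i \<phi> b}) = (\<Sum>b\<in>A. of_bool (P R i \<phi> b))"
    using assms by (simp add: of_bool_def sum.If_cases Int_def)
  then show ?case using Cons by (simp add: t sum.distrib sum_distrib_left)
qed simp

lemma sat_Pres:
  assumes "finite (dom M)"
  shows "sat M (Pres v ts c d) \<sigma> \<longleftrightarrow> cmp_holds c (\<Sum>b\<in>dom M. term_at M v ts (\<sigma> v) b) d"
proof -
  have upd: "\<sigma>(other v := b) = as2 v (\<sigma> v) b" for b
    by (cases v) (auto simp: as2_def fun_eq_iff all_var)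
  have "rholds M R i (\<sigma> v) b \<longleftrightarrow> sat M (atm v R i) (as2 v (\<sigma> v) b)" for R i b
    by (cases v) (auto simp: rholds_def atm_def as2_def)
  then show ?thesis unfolding sat.simps term_at_def upd
    by (subst sum_list_card_swap[OF assms, symmetric]) simp
qed

text \<open>With a guard in two distinct variables, quantifying one of them asserts that a count is
  positive. Such quantifiers are thus covered by the treatment of counting formulas, provided that
  this formula is among the recorded ones.\<close>

lemma sat_ExG_Pres:
  assumes "finite (dom M)" "v1 \<noteq> v2" "v1 = v \<or> v2 = v"
  shows "sat M (ExG {other v} (BA r v1 v2) \<phi>) \<sigma> \<longleftrightarrow> sat M (Pres v [(1, r, v2 = v, \<phi>)] CGt 0) \<sigma>"
proof -
  have ex_upd: "(\<exists>\<sigma>'. (\<forall>w. w \<notin> {other v} \<longrightarrow> \<sigma>' w = \<sigma> w) \<and> (\<forall>w\<in>{other v}. \<sigma>' w \<in> dom M) \<and> P \<sigma>')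
    \<longleftrightarrow> (\<exists>b\<in>dom M. P (\<sigma>(other v := b)))" for P
  proof
    assume "\<exists>\<sigma>'. (\<forall>w. w \<notin> {other v} \<longrightarrow> \<sigma>' w = \<sigma> w) \<and> (\<forall>w\<in>{other v}. \<sigma>' w \<in> dom M) \<and> P \<sigma>'"
    then obtain \<sigma>' where s: "\<forall>w. w \<notin> {other v} \<longrightarrow> \<sigma>' w = \<sigma> w" "\<sigma>' (other v) \<in> dom M" "P \<sigma>'" by auto
    then have "\<sigma>' = \<sigma>(other v := \<sigma>' (other v))" by (auto simp: fun_eq_iff)
    then show "\<exists>b\<in>dom M. P (\<sigma>(other v := b))" using s by metis
  next
    assume "\<exists>b\<in>dom M. P (\<sigma>(other v := b))"
    then obtain b where "b \<in> dom M" "P (\<sigma>(other v := b))" by blast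
    then show "\<exists>\<sigma>'. (\<forall>w. w \<notin> {other v} \<longrightarrow> \<sigma>' w = \<sigma> w) \<and> (\<forall>w\<in>{other v}. \<sigma>' w \<in> dom M) \<and> P \<sigma>'"
      by (intro exI[of _ "\<sigma>(other v := b)"]) auto
  qed
  from ex_upd[of "\<lambda>\<sigma>'. asat M (BA r v1 v2) \<sigma>' \<and> sat M \<phi> \<sigma>'"]
  have "sat M (ExG {other v} (BA r v1 v2) \<phi>) \<sigma> \<longleftrightarrow>
      (\<exists>b\<in>dom M. asat M (BA r v1 v2) (\<sigma>(other v := b)) \<and> sat M \<phi> (\<sigma>(other v := b)))"
    unfolding sat.simps .
  also have "\<dots> \<longleftrightarrow> {b \<in> dom M. rholds M r (v2 = v) (\<sigma> v) b \<and> sat M \<phi> (\<sigma>(other v := b))} \<noteq> {}"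
    using assms(2,3) by (cases v; cases v1; cases v2) (auto simp: rholds_def)
  also have "\<dots> \<longleftrightarrow> sat M (Pres v [(1, r, v2 = v, \<phi>)] CGt 0) \<sigma>"
    using assms(1) by (auto simp: card_gt_0_iff)
  finally show ?thesis .
qed

text \<open>Quantifying both variables reduces to the existence of one element with a positive
  count.\<close>

lemma sat_ExG_both:
  assumes "finite (dom M)" "v1 \<noteq> v2"
  shows "sat M (ExG UNIV (BA r v1 v2) \<phi>) \<sigma> \<longleftrightarrow> (\<exists>a\<in>dom M. sat M (Pres VX [(1, r, v2 = VX, \<phi>)] CGt 0) (as a a))"
proof -
  have "sat M (ExG UNIV (BA r v1 v2) \<phi>) \<sigma> \<longleftrightarrow> (\<exists>a\<in>dom M. sat M (ExG {other VX} (BA r v1 v2) \<phi>) (as a a))"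
    (is "?L \<longleftrightarrow> ?R")
  proof
    assume ?L
    then obtain \<sigma>' where "\<forall>v. \<sigma>' v \<in> dom M" "asat M (BA r v1 v2) \<sigma>'" "sat M \<phi> \<sigma>'" by auto
    then show ?R by (intro bexI[of _ "\<sigma>' VX"]) (auto intro!: exI[of _ \<sigma>'] simp: all_var)
  next
    assume ?R
    then obtain a \<sigma>' where "a \<in> dom M" "\<forall>v. v \<notin> {other VX} \<longrightarrow> \<sigma>' v = as a a v" "\<forall>v\<in>{other VX}. \<sigma>' v \<in> dom M"
      "asat M (BA r v1 v2) \<sigma>'" "sat M \<phi> \<sigma>'" unfolding sat.simps by blast
    then show ?L unfolding sat.simps by (intro exI[of _ \<sigma>']) (simp add: all_var)
  qed
  moreover have "v1 = VX \<or> v2 = VX" using assms(2) by (cases v1; cases v2) auto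
  ultimately show ?thesis using sat_ExG_Pres[OF assms, of VX] by (simp only:)
qed

lemma sat_ExG_one:
  assumes "avars g = {v}" "fv \<phi> \<subseteq> {v}"
  shows "sat M (ExG {v} g \<phi>) \<sigma> \<longleftrightarrow> (\<exists>a\<in>dom M. sat M (Conj (Atom g) \<phi>) (as a a))"
proof -
  have c: "sat M (Conj (Atom g) \<phi>) \<tau> = sat M (Conj (Atom g) \<phi>) (as a a)" if "\<tau> v = a" for \<tau> a
    using assms that by (intro sat_cong) (cases v; auto)
  show ?thesis
  proof
    assume "sat M (ExG {v} g \<phi>) \<sigma>"
    then obtain \<tau> where "\<tau> v \<in> dom M" "sat M (Conj (Atom g) \<phi>) \<tau>" by auto
    then show "\<exists>a\<in>dom M. sat M (Conj (Atom g) \<phi>) (as a a)" using c by blast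
  next
    assume "\<exists>a\<in>dom M. sat M (Conj (Atom g) \<phi>) (as a a)"
    then obtain a where a: "a \<in> dom M" "sat M (Conj (Atom g) \<phi>) (as a a)" by blast
    have "sat M (Conj (Atom g) \<phi>) (\<sigma>(v := a))" using c[of "\<sigma>(v := a)" a] a(2) by simp
    then show "sat M (ExG {v} g \<phi>) \<sigma>" using a(1) by (auto intro!: exI[of _ "\<sigma>(v := a)"])
  qed
qed

lemma sat_AllG: "sat M (AllG Q g \<phi>) \<sigma> \<longleftrightarrow> \<not> sat M (ExG Q g (Neg \<phi>)) \<sigma>"
  unfolding sat.simps by blast

section \<open>The small model property\<close>

lemma item_bound_mono:
  assumes "m \<le> m'" "K \<le> K'" "c \<le> c'" "C \<le> C'"
  shows "item_bound m K c C \<le> item_bound m' K' c' C'"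
proof -
  have "(4 * C + 1) ^ m \<le> (4 * C' + 1) ^ m"
    using assms by (intro power_mono) auto
  also have "\<dots> \<le> (4 * C' + 1) ^ m'"
    using assms by (intro power_increasing) auto
  finally have pow: "(4 * C + 1) ^ m \<le> (4 * C' + 1) ^ m'" .
  have "zsb m (3 * C) \<le> zsb m' (3 * C')" using assms by (intro zsb_mono) auto
  then have "(\<Sum>i<Suc (zsb m (3 * C)). (1 + K + 2 * m) ^ i) \<le> (\<Sum>i<Suc (zsb m' (3 * C')). (1 + K + 2 * m) ^ i)"
    by (intro sum_mono2) auto
  also have "\<dots> \<le> (\<Sum>i<Suc (zsb m' (3 * C')). (1 + K' + 2 * m') ^ i)"
    using assms by (intro sum_mono power_mono) auto
  finally show ?thesis unfolding item_bound_def using pow assms by (intro mult_le_mono) auto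
qed

lemma graph_bound_mono:
  assumes "m \<le> m'" "K \<le> K'" "c \<le> c'" "C \<le> C'"
  shows "graph_bound m K c C \<le> graph_bound m' K' c' C'"
proof -
  have z: "zsb m (3 * C) \<le> zsb m' (3 * C')" using assms by (intro zsb_mono) auto
  then have i: "items_bound m K c C \<le> items_bound m' K' c' C'"
    unfolding items_bound_def using assms item_bound_mono[OF assms] by (intro mult_le_mono zsb_mono) auto
  show ?thesis
    unfolding graph_bound_def
    by (intro mult_le_mono i le_refl Suc_le_mono[THEN iffD2] z)
qed

text \<open>The first summand bounds the codes of atoms with symbols up to \<open>N\<close>. The
  second bounds the formulas that replace guarded quantifiers: 2 is the code of the coefficient 1,
  \<open>prod_encode (5, 0)\<close> that of \<open>CGt\<close>, and
  \<open>prod_encode (2, N)\<close> leaves room for the negation of a formula with code at most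
  \<open>N\<close>.\<close>

definition code_bound :: "nat \<Rightarrow> nat" where
  "code_bound N = Suc (prod_encode (0, prod_encode (1, prod_encode (N, prod_encode (1, 1))))
    + prod_encode (7, prod_encode (1, prod_encode
       (list_encode [prod_encode (2, prod_encode (N, prod_encode (1, prod_encode (2, N))))],
        prod_encode (prod_encode (5, 0), 0)))))"

text \<open>At most \<open>L\<close> recorded formulas give at most \<open>2 ^ L\<close> colours,
  and a kind consists of four sets of formulas. The same \<open>L\<close> bounds the number of
  constraints, their weights, thresholds and moduli.\<close>

definition size_bound :: "nat \<Rightarrow> nat" where
  "size_bound N = (let L = code_bound N in graph_bound L (2 ^ (4 * L)) (2 ^ L) L)"

definition mk_struct :: "nat \<Rightarrow> nat \<Rightarrow> nat \<Rightarrow> struct" where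
  "mk_struct n x y = \<lparr>dom = {..<n}, urel = (\<lambda>p a. prod_encode (p, a) \<in> set_decode x),
    brel = (\<lambda>r a b. prod_encode (r, prod_encode (a, b)) \<in> set_decode y)\<rparr>"

lemma enc_var_le: "enc_var v \<le> 1" by (cases v) auto

lemma Atom_code_bound:
  assumes "(case a of UA p v \<Rightarrow> p | BA r v w \<Rightarrow> r) \<le> N"
  shows "enc (Atom a) < code_bound N"
proof -
  have "enc_atom a \<le> prod_encode (1, prod_encode (N, prod_encode (1, 1)))"
  proof (cases a)
    case (UA p v)
    have "enc_var v \<le> prod_encode (1, 1)" using enc_var_le[of v] le_prod_encode_1[of 1 1] by linarith
    then show ?thesis using UA assms by (auto intro!: prod_encode_mono)
  next
    case (BA r v w)
    then show ?thesis using assms enc_var_le[of v] enc_var_le[of w] by (auto intro!: prod_encode_mono)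
  qed
  from prod_encode_mono[OF order_refl this, of 0] show ?thesis by (simp add: code_bound_def)
qed

lemma Pres_code_bound:
  assumes "r \<le> N" "enc \<phi> \<le> prod_encode (2, N)"
  shows "enc (Pres v [(1, r, i, \<phi>)] CGt 0) < code_bound N"
proof -
  have "int_encode 1 = 2" "int_encode 0 = 0" by (simp_all add: int_encode_def sum_encode_def)
  then have "enc (Pres v [(1, r, i, \<phi>)] CGt 0) \<le> prod_encode (7, prod_encode (1, prod_encode
       (list_encode [prod_encode (2, prod_encode (N, prod_encode (1, prod_encode (2, N))))],
        prod_encode (prod_encode (5, 0), 0))))"
    using assms enc_var_le[of v]
    by (auto simp: of_bool_def intro!: prod_encode_mono Suc_le_mono[THEN iffD2])
  then show ?thesis by (simp add: code_bound_def)
qed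

lemma code_bound_gt: "N < code_bound N"
  using Atom_code_bound[of "UA N VX" N] le_prod_encode_1[of N 0] le_prod_encode_2[of "prod_encode (N, 0)" 0]
    le_prod_encode_2[of "prod_encode (0, prod_encode (N, 0))" 0] by simp

section \<open>Colours, kinds and weights of a finite model\<close>

definition rev4 :: "'b \<times> 'b \<times> 'b \<times> 'b \<Rightarrow> 'b \<times> 'b \<times> 'b \<times> 'b" where
  "rev4 = (\<lambda>(p, q, r, s). (s, r, q, p))"

definition pw :: "var \<Rightarrow> (int \<times> nat \<times> bool \<times> fm) list \<Rightarrow> fm set \<Rightarrow> int" where
  "pw v ts X = (\<Sum>(l, R, i, \<phi>)\<leftarrow>ts. l * of_bool (atm v R i \<in> X \<and> \<phi> \<in> X))"

lemma pw_le:
  assumes "enc (Pres v ts c d) \<le> b"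
  shows "\<bar>pw v ts X\<bar> \<le> int b"
proof -
  have "\<bar>pw v ts X\<bar> \<le> (\<Sum>(l, R, i, \<phi>)\<leftarrow>ts. \<bar>l\<bar>)"
    unfolding pw_def by (induction ts) (auto simp: of_bool_def)
  then show ?thesis using enc_Pres_coeffs[OF assms] by linarith
qed

fun modulus :: "fm \<Rightarrow> nat" where
  "modulus (Pres v ts (CCong m) d) = max 1 m"
| "modulus (Pres v ts (CNCong m) d) = max 1 m"
| "modulus _ = 1"

fun threshold :: "fm \<Rightarrow> int" where
  "threshold (Pres v ts c d) = d"
| "threshold _ = 0"

text \<open>The second component of a kind describes the pair with \<open>VX\<close> at the first
  end, the third with \<open>VY\<close> there; the counted variable is always at the second
  end.\<close>

fun weight :: "fm \<Rightarrow> fm set \<times> fm set \<times> fm set \<times> fm set \<Rightarrow> int" where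
  "weight (Pres v ts c d) (p, q, r, s) = pw v ts (if v = VX then q else r)"
| "weight _ _ = 0"

fun weight0 :: "fm \<Rightarrow> fm set \<Rightarrow> int" where
  "weight0 (Pres v ts c d) X = pw v ts X"
| "weight0 _ _ = 0"

locale bounded_model =
  fixes M :: struct and B :: nat
  assumes finM: "finite (dom M)" and neM: "dom M \<noteq> {}"
begin

definition F :: "fm set" where
  "F = {\<psi>. enc \<psi> < code_bound B}"

definition D :: "nat \<Rightarrow> nat \<Rightarrow> fm set" where
  "D a b = {\<psi> \<in> F. sat M \<psi> (as a b)}"

definition k :: "nat \<Rightarrow> nat \<Rightarrow> fm set \<times> fm set \<times> fm set \<times> fm set" where
  "k a b = (D a a, D a b, D b a, D b b)"

text \<open>Pairs of distinct elements outside this set satisfy no guard in two variables with a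
  symbol up to \<open>B\<close> and contribute nothing to the sums of \<open>J\<close>, so they can
  be left out when a structure is rebuilt.\<close>

definition LK :: "(fm set \<times> fm set \<times> fm set \<times> fm set) set" where
  "LK = {(p, q, r, s). \<exists>R\<le>B. \<exists>v w. v \<noteq> w \<and> Atom (BA R v w) \<in> q \<union> r}"

text \<open>The condition on symbols ensures that a counted pair is linked: \<open>F\<close> may
  also contain counting formulas with larger symbols, which \<open>LK\<close> does not see.\<close>

definition J :: "fm set" where
  "J = {\<psi> \<in> F. \<exists>v ts c d. \<psi> = Pres v ts c d \<and> (\<forall>(l, R, i, \<phi>)\<in>set ts. R \<le> B)}"

lemma finF: "finite F" and cardF: "card F \<le> code_bound B"
proof -
  have "inj_on enc F" by (simp add: inj_on_def enc_inj)
  moreover have "enc ` F \<subseteq> {..<code_bound B}" by (auto simp: F_def)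
  ultimately show "finite F" "card F \<le> code_bound B"
    by (metis finite_imageD finite_lessThan finite_subset)
       (metis \<open>inj_on enc F\<close> \<open>enc ` F \<subseteq> {..<code_bound B}\<close> card_inj_on_le card_lessThan finite_lessThan)
qed

lemma D_F: "D a b \<in> Pow F"
  by (auto simp: D_def)

lemma J_E:
  assumes "\<psi> \<in> J"
  obtains v ts c d where "\<psi> = Pres v ts c d" "enc (Pres v ts c d) \<le> code_bound B"
proof -
  have "enc \<psi> < code_bound B" "\<exists>v ts c d. \<psi> = Pres v ts c d" using assms unfolding J_def F_def by blast+
  then show thesis using that less_imp_le by blast
qed

lemma weight_le: "\<psi> \<in> J \<Longrightarrow> \<bar>weight \<psi> \<kappa>\<bar> \<le> int (code_bound B)"
  by (cases \<kappa>) (auto elim!: J_E intro: pw_le simp del: enc.simps)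

lemma weight0_le: "\<psi> \<in> J \<Longrightarrow> \<bar>weight0 \<psi> X\<bar> \<le> int (code_bound B)"
  by (auto elim!: J_E intro: pw_le simp del: enc.simps)

lemma threshold_le: "\<psi> \<in> J \<Longrightarrow> \<bar>threshold \<psi>\<bar> \<le> int (code_bound B)"
proof -
  assume "\<psi> \<in> J"
  then obtain v ts c d where \<psi>: "\<psi> = Pres v ts c d" "enc (Pres v ts c d) \<le> code_bound B"
    by (rule J_E)
  then show ?thesis using enc_Pres_bounds(3)[OF \<psi>(2)] abs_le_int_encode[of d] by simp
qed

lemma modulus_le: "\<psi> \<in> J \<Longrightarrow> modulus \<psi> \<le> code_bound B"
proof -
  assume "\<psi> \<in> J"
  then obtain v ts c d where \<psi>: "\<psi> = Pres v ts c d" "enc (Pres v ts c d) \<le> code_bound B"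
    by (rule J_E)
  have pos: "1 \<le> code_bound B" by (simp add: code_bound_def)
  show ?thesis using enc_Pres_bounds(2)[OF \<psi>(2)] pos by (cases c) (auto simp: \<psi>(1) dest: prod_encode_leD)
qed

sublocale kind_graph "dom M" k "\<lambda>a. D a a" rev4 fst LK "Pow F \<times> Pow F \<times> Pow F \<times> Pow F" "Pow F" J
  weight weight0 threshold modulus "code_bound B"
proof
  show "1 \<le> modulus \<psi>" for \<psi> by (cases \<psi> rule: modulus.cases) auto
  show "finite J" using finF by (simp add: J_def)
  show "rev4 \<kappa> \<in> LK" if "\<kappa> \<in> LK" for \<kappa> using that by (auto simp: LK_def rev4_def)
qed (use finM neM finF D_F weight_le weight0_le threshold_le modulus_le in
      \<open>auto simp: rev4_def k_def split: prod.split\<close>)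

abbreviation col :: "nat \<Rightarrow> fm set" where
  "col a \<equiv> D a a"

definition Dv :: "var \<Rightarrow> nat \<Rightarrow> nat \<Rightarrow> fm set" where
  "Dv v a b = (if v = VX then D a b else D b a)"

lemma Atom_F: "(case a of UA p v \<Rightarrow> p | BA r v w \<Rightarrow> r) \<le> B \<Longrightarrow> Atom a \<in> F"
  unfolding F_def using Atom_code_bound by blast

lemma atm_F: "R \<le> B \<Longrightarrow> atm v R i \<in> F"
  unfolding atm_def by (rule Atom_F) simp

lemma Dv_iff: "\<psi> \<in> F \<Longrightarrow> \<psi> \<in> Dv v a b \<longleftrightarrow> sat M \<psi> (as2 v a b)"
  by (simp add: Dv_def D_def as2_def)

lemma J_member:
  assumes "Pres v ts c d \<in> J" "(l, R, i, \<phi>) \<in> set ts"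
  shows "R \<le> B" "\<phi> \<in> F"
proof -
  show "R \<le> B" using assms by (force simp: J_def)
  have "enc (Pres v ts c d) < code_bound B" using assms(1) unfolding J_def F_def by blast
  moreover have "enc \<phi> \<le> enc (Pres v ts c d)" by (rule enc_Pres_member(2)[OF order_refl assms(2)])
  ultimately show "\<phi> \<in> F" unfolding F_def by simp
qed

lemma term_at_eq_pw:
  assumes "Pres v ts c d \<in> J"
  shows "term_at M v ts a b = pw v ts (Dv v a b)"
proof -
  have "map (\<lambda>(l, R, i, \<phi>). l * of_bool (sat M (atm v R i) (as2 v a b) \<and> sat M \<phi> (as2 v a b))) ts
      = map (\<lambda>(l, R, i, \<phi>). l * of_bool (atm v R i \<in> Dv v a b \<and> \<phi> \<in> Dv v a b)) ts"
  proof (rule map_cong[OF refl])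
    fix t assume t: "t \<in> set ts"
    obtain l R i \<phi> where eq: "t = (l, R, i, \<phi>)" by (cases t)
    show "(case t of (l, R, i, \<phi>) \<Rightarrow> l * of_bool (sat M (atm v R i) (as2 v a b) \<and> sat M \<phi> (as2 v a b)))
      = (case t of (l, R, i, \<phi>) \<Rightarrow> l * of_bool (atm v R i \<in> Dv v a b \<and> \<phi> \<in> Dv v a b))"
      using J_member[OF assms t[unfolded eq]] by (simp add: eq Dv_iff atm_F)
  qed
  then show ?thesis unfolding term_at_def pw_def by (rule arg_cong)
qed

lemma weight_k: "weight (Pres v ts c d) (k a b) = pw v ts (Dv v a b)"
  by (simp add: k_def Dv_def)

lemma weight0_col: "weight0 (Pres v ts c d) (col a) = pw v ts (Dv v a a)"
  by (simp add: Dv_def)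

text \<open>Each summand demands a binary atom between the two distinct elements, which an unlinked
  pair lacks.\<close>

lemma unlinked_term:
  assumes J: "Pres v ts c d \<in> J" and ab: "b \<in> dom M" "b \<noteq> a" "b \<notin> N a"
  shows "pw v ts (Dv v a b) = 0"
proof -
  have nl: "k a b \<notin> LK" using ab by (simp add: N_def)
  have "atm v R i \<notin> Dv v a b" if "R \<le> B" for R i
  proof
    assume "atm v R i \<in> Dv v a b"
    moreover have "other v \<noteq> v" by (cases v) auto
    ultimately have "\<exists>v w. v \<noteq> w \<and> Atom (BA R v w) \<in> D a b \<union> D b a"
      by (intro exI[of _ "if i then other v else v"] exI[of _ "if i then v else other v"])
        (auto simp: atm_def Dv_def split: if_splits)
    then show False using nl that unfolding LK_def k_def by blast
  qed
  then have "\<forall>t\<in>set ts. (case t of (l, R, i, \<phi>) \<Rightarrow> l * of_bool (atm v R i \<in> Dv v a b \<and> \<phi> \<in> Dv v a b)) = 0"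
    using J_member(1)[OF J] by auto
  then show ?thesis unfolding pw_def by (induction ts) auto
qed

text \<open>Identifies the abstract sum with the semantic one: the element itself gives the colour
  weight, linked elements give kind weights, and the others vanish.\<close>

lemma S_eq:
  assumes J: "Pres v ts c d \<in> J" and a: "a \<in> dom M"
  shows "S (Pres v ts c d) a = (\<Sum>b\<in>dom M. term_at M v ts a b)"
proof -
  have N: "N a \<subseteq> dom M - {a}" by (auto simp: N_def)
  have "(\<Sum>b\<in>dom M. term_at M v ts a b) = pw v ts (Dv v a a) + (\<Sum>b\<in>dom M - {a}. pw v ts (Dv v a b))"
    using a finM by (simp add: term_at_eq_pw[OF J] sum.remove)
  also have "(\<Sum>b\<in>dom M - {a}. pw v ts (Dv v a b)) = (\<Sum>b\<in>N a. pw v ts (Dv v a b))"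
    using finM N unlinked_term[OF J] by (intro sum.mono_neutral_right) auto
  finally show ?thesis by (simp add: S_def weight_k weight0_col del: weight.simps weight0.simps)
qed

end

section \<open>Transfer of truth to the small copy\<close>

locale small_copy = bounded_model +
  fixes n :: nat and col' :: "nat \<Rightarrow> fm set" and G :: "nat \<Rightarrow> fm set \<times> fm set \<times> fm set \<times> fm set \<Rightarrow> nat \<Rightarrow> bool"
  assumes origin: "u < n \<Longrightarrow> \<exists>a\<in>dom M. col a = col' u
       \<and> (\<forall>\<psi>\<in>J. same_order_mod (threshold \<psi>) (modulus \<psi>)
             (weight0 \<psi> (col' u) + (\<Sum>(v, \<kappa>)\<in>{(v, \<kappa>). G u \<kappa> v}. weight \<psi> \<kappa>)) (S \<psi> a))"
    and copy: "a \<in> dom M \<Longrightarrow> \<exists>u<n. col' u = col a"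
    and G_fun: "G u \<kappa> v \<Longrightarrow> G u \<kappa>' v \<Longrightarrow> \<kappa> = \<kappa>'"
    and G: "G u \<kappa> v \<Longrightarrow> u < n \<and> v < n \<and> u \<noteq> v \<and> G v (rev4 \<kappa>) u \<and> fst \<kappa> = col' u
       \<and> (\<exists>a\<in>dom M. \<exists>b\<in>N a. \<kappa> = k a b)"
begin

text \<open>Unary facts and loops are read off the colour, facts between distinct vertices off the
  kind of their edge. Symbols above \<open>B\<close> are empty, so that finitely many bits, bounded
  in number by \<open>B\<close> and \<open>n\<close>, describe the structure.\<close>

definition M' :: struct where
  "M' = \<lparr>dom = {..<n}, urel = (\<lambda>p u. p \<le> B \<and> u < n \<and> Atom (UA p VX) \<in> col' u),
    brel = (\<lambda>r u v. r \<le> B \<and> u < n \<and> v < n \<and> (if u = v then Atom (BA r VX VX) \<in> col' u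
      else \<exists>\<kappa>. G u \<kappa> v \<and> Atom (BA r VX VY) \<in> fst (snd \<kappa>)))\<rparr>"

lemma dom_M' [simp]: "dom M' = {..<n}"
  by (simp add: M'_def)

text \<open>Relates pairs of vertices to pairs of original elements. Distinct vertices without an
  edge correspond to nothing, and guardedness keeps the argument away from them.\<close>

definition similar :: "nat \<Rightarrow> nat \<Rightarrow> nat \<Rightarrow> nat \<Rightarrow> bool" where
  "similar u v a b \<longleftrightarrow> a \<in> dom M \<and> b \<in> dom M \<and> (u < n \<and> u = v \<and> a = b \<and> col' u = col a \<or> a \<noteq> b \<and> G u (k a b) v)"

lemma rev4_k: "rev4 (k a b) = k b a"
  by (simp add: k_def rev4_def)

lemma similar_sym: "similar u v a b \<Longrightarrow> similar v u b a"
  unfolding similar_def using G rev4_k by metis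

lemma similar_diag: "similar u v a b \<Longrightarrow> similar u u a a"
  unfolding similar_def using G[of u "k a b" v] by (auto simp: k_def)

lemma similar_col: "similar u v a b \<Longrightarrow> col' u = col a"
  using similar_diag[of u v a b] G[of u "k a b" v] unfolding similar_def k_def by auto

lemma similar_G:
  assumes "G u \<kappa> v"
  obtains a b where "similar u v a b" "\<kappa> = k a b"
  using G[OF assms] assms unfolding similar_def N_def by blast

text \<open>Quantifying over all similar pairs makes this a property of the formula alone, suited to
  induction. On the diagonal, \<open>a\<close> is any element with the colour of \<open>u\<close>,
  not one fixed original.\<close>

definition agree :: "fm \<Rightarrow> bool" where
  "agree \<psi> \<longleftrightarrow> (\<forall>u v a b. similar u v a b \<longrightarrow> sat M' \<psi> (as u v) = sat M \<psi> (as a b))"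

lemma agreeD: "agree \<psi> \<Longrightarrow> similar u v a b \<Longrightarrow> sat M' \<psi> (as u v) = sat M \<psi> (as a b)"
  unfolding agree_def by blast

lemma agree_as2: "agree \<psi> \<Longrightarrow> similar u w a b \<Longrightarrow> sat M' \<psi> (as2 v u w) = sat M \<psi> (as2 v a b)"
  using agreeD similar_sym by (simp add: as2_def)

lemma agree_Neg: "agree \<phi> \<Longrightarrow> agree (Neg \<phi>)"
  and agree_Conj: "agree \<phi> \<Longrightarrow> agree \<psi> \<Longrightarrow> agree (Conj \<phi> \<psi>)"
  and agree_Disj: "agree \<phi> \<Longrightarrow> agree \<psi> \<Longrightarrow> agree (Disj \<phi> \<psi>)"
  by (simp_all add: agree_def)

lemma agree_cong: "agree \<phi> \<Longrightarrow> (\<And>M \<sigma>. finite (dom M) \<Longrightarrow> sat M \<psi> \<sigma> = sat M \<phi> \<sigma>) \<Longrightarrow> agree \<psi>"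
  unfolding agree_def using finM by (metis dom_M' finite_lessThan)

lemma agree_Eq: "agree (Eq v w)"
  unfolding agree_def
proof (intro allI impI)
  fix u x a b assume "similar u x a b"
  then have "u = x \<longleftrightarrow> a = b" unfolding similar_def using G[of u "k a b" x] by auto
  then show "sat M' (Eq v w) (as u x) = sat M (Eq v w) (as a b)" by (cases v; cases w) auto
qed

lemma D_iff: "\<psi> \<in> F \<Longrightarrow> \<psi> \<in> D a b \<longleftrightarrow> sat M \<psi> (as a b)"
  by (simp add: D_def)

lemma agree_UA:
  assumes p: "p \<le> B"
  shows "agree (Atom (UA p w))"
  unfolding agree_def
proof (intro allI impI)
  have at: "Atom (UA p VX) \<in> F" by (rule Atom_F) (simp add: p)
  have 1: "urel M' p u = urel M p a" if "similar u v a b" for u v a b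
  proof -
    have "u < n" using similar_diag[OF that] G[of u "k a a" u] unfolding similar_def by blast
    then have "urel M' p u \<longleftrightarrow> Atom (UA p VX) \<in> col a" using p similar_col[OF that] by (simp add: M'_def)
    also have "\<dots> \<longleftrightarrow> urel M p a" using D_iff[OF at] by simp
    finally show ?thesis .
  qed
  fix u v a b assume s: "similar u v a b"
  show "sat M' (Atom (UA p w)) (as u v) = sat M (Atom (UA p w)) (as a b)"
    using 1[OF s] 1[OF similar_sym[OF s]] by (cases w) simp_all
qed

lemma agree_BA:
  assumes r: "r \<le> B"
  shows "agree (Atom (BA r w1 w2))"
  unfolding agree_def
proof (intro allI impI)
  have at: "Atom (BA r w1 w2) \<in> F" for w1 w2 by (rule Atom_F) (simp add: r)
  have 1: "brel M' r u u = brel M r a a" if "similar u v a b" for u v a b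
  proof -
    have "u < n" using similar_diag[OF that] G[of u "k a a" u] unfolding similar_def by blast
    then have "brel M' r u u \<longleftrightarrow> Atom (BA r VX VX) \<in> col a" using r similar_col[OF that] by (simp add: M'_def)
    also have "\<dots> \<longleftrightarrow> brel M r a a" using D_iff[OF at] by simp
    finally show ?thesis .
  qed
  have 2: "brel M' r u v = brel M r a b" if s: "similar u v a b" for u v a b
  proof (cases "a = b")
    case True
    then have "u = v" using s unfolding similar_def by blast
    then show ?thesis using 1[OF s] True by simp
  next
    case False
    then have g: "G u (k a b) v" using s unfolding similar_def by blast
    have "brel M' r u v \<longleftrightarrow> (\<exists>\<kappa>. G u \<kappa> v \<and> Atom (BA r VX VY) \<in> fst (snd \<kappa>))"
      using G[OF g] r by (simp add: M'_def)
    also have "\<dots> \<longleftrightarrow> Atom (BA r VX VY) \<in> D a b"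
      using g G_fun[OF g] by (auto simp: k_def)
    also have "\<dots> \<longleftrightarrow> brel M r a b" using D_iff[OF at] by simp
    finally show ?thesis .
  qed
  fix u v a b assume s: "similar u v a b"
  show "sat M' (Atom (BA r w1 w2)) (as u v) = sat M (Atom (BA r w1 w2)) (as a b)"
    using 1[OF s] 1[OF similar_sym[OF s]] 2[OF s] 2[OF similar_sym[OF s]]
    by (cases w1; cases w2) simp_all
qed

lemma agree_atm: "R \<le> B \<Longrightarrow> agree (atm v R i)"
  unfolding atm_def by (cases i) (simp_all add: agree_BA)

lemma term_at_similar:
  assumes J: "Pres v ts c d \<in> J" and ag: "\<And>l R i \<phi>. (l, R, i, \<phi>) \<in> set ts \<Longrightarrow> agree \<phi>" and s: "similar u w a b"
  shows "term_at M' v ts u w = pw v ts (Dv v a b)"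
proof -
  have "map (\<lambda>(l, R, i, \<phi>). l * of_bool (sat M' (atm v R i) (as2 v u w) \<and> sat M' \<phi> (as2 v u w))) ts
      = map (\<lambda>(l, R, i, \<phi>). l * of_bool (sat M (atm v R i) (as2 v a b) \<and> sat M \<phi> (as2 v a b))) ts"
  proof (rule map_cong[OF refl])
    fix t assume t: "t \<in> set ts"
    obtain l R i \<phi> where eq: "t = (l, R, i, \<phi>)" by (cases t)
    show "(case t of (l, R, i, \<phi>) \<Rightarrow> l * of_bool (sat M' (atm v R i) (as2 v u w) \<and> sat M' \<phi> (as2 v u w)))
      = (case t of (l, R, i, \<phi>) \<Rightarrow> l * of_bool (sat M (atm v R i) (as2 v a b) \<and> sat M \<phi> (as2 v a b)))"
      using agree_as2[OF ag[OF t[unfolded eq]] s] agree_as2[OF agree_atm[OF J_member(1)[OF J t[unfolded eq]]] s]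
      by (simp add: eq)
  qed
  then have "term_at M' v ts u w = term_at M v ts a b" unfolding term_at_def by (rule arg_cong)
  then show ?thesis using term_at_eq_pw[OF J] by simp
qed

lemma unlinked_term':
  assumes J: "Pres v ts c d \<in> J" and u: "w \<noteq> u" "\<not> (\<exists>\<kappa>. G u \<kappa> w)"
  shows "term_at M' v ts u w = 0"
proof -
  have "\<not> (\<exists>\<kappa>. G w \<kappa> u)" using u(2) G by blast
  then have "\<not> sat M' (atm v R i) (as2 v u w)" for R i
    using u by (cases v) (auto simp: atm_def as2_def M'_def split: if_splits)
  then have "\<forall>t\<in>set ts. (case t of (l, R, i, \<phi>) \<Rightarrow> l * of_bool (sat M' (atm v R i) (as2 v u w) \<and> sat M' \<phi> (as2 v u w))) = 0"
    by auto
  then show ?thesis unfolding term_at_def by (induction ts) auto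
qed

text \<open>The sum at a vertex splits into its own contribution and those of its neighbours, and
  agreement of the subformulas identifies these with colour and kind weights. By
  \<open>origin\<close> this sum has the sign and residue of a sum in the original model, where the
  colour records the truth of the formula.\<close>

lemma agree_Pres:
  assumes J: "Pres v ts c d \<in> J" and ag: "\<And>l R i \<phi>. (l, R, i, \<phi>) \<in> set ts \<Longrightarrow> agree \<phi>"
  shows "agree (Pres v ts c d)"
proof -
  let ?\<psi> = "Pres v ts c d"
  have M_iff: "cmp_holds c (S ?\<psi> a) d \<longleftrightarrow> ?\<psi> \<in> col a" if "a \<in> dom M" for a
  proof -
    have "?\<psi> \<in> F" using J by (simp add: J_def)
    moreover have "(as a a) v = a" by (cases v) auto
    ultimately show ?thesis unfolding S_eq[OF J that] D_iff[OF \<open>?\<psi> \<in> F\<close>] sat_Pres[OF finM] by simp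
  qed
  have main: "sat M' ?\<psi> \<sigma> = sat M ?\<psi> \<tau>" if s: "similar (\<sigma> v) w (\<tau> v) b" for \<sigma> \<tau> w b
  proof -
    define u a where "u = \<sigma> v" and "a = \<tau> v"
    have s': "similar u u a a" using similar_diag[OF s] by (simp add: u_def a_def)
    then have u: "u < n" and a: "a \<in> dom M" and col: "col' u = col a"
      unfolding similar_def by blast+
    let ?W = "{w. \<exists>\<kappa>. G u \<kappa> w}"
    have W: "?W \<subseteq> {..<n} - {u}" using G by blast
    have "(\<Sum>w<n. term_at M' v ts u w) = term_at M' v ts u u + (\<Sum>w\<in>{..<n} - {u}. term_at M' v ts u w)"
      using u by (intro sum.remove) auto
    also have "(\<Sum>w\<in>{..<n} - {u}. term_at M' v ts u w) = (\<Sum>w\<in>?W. term_at M' v ts u w)"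
      using W unlinked_term'[OF J] by (intro sum.mono_neutral_right) auto
    also have "\<dots> = (\<Sum>(w, \<kappa>)\<in>{(w, \<kappa>). G u \<kappa> w}. weight ?\<psi> \<kappa>)"
    proof (rule sum.reindex_bij_witness[of _ fst "\<lambda>w. (w, THE \<kappa>. G u \<kappa> w)"])
      fix w assume "w \<in> ?W"
      then obtain \<kappa> where g: "G u \<kappa> w" by blast
      have the: "(THE \<kappa>. G u \<kappa> w) = \<kappa>" using g G_fun by blast
      show "fst (w, THE \<kappa>. G u \<kappa> w) = w" by simp
      show "(w, THE \<kappa>. G u \<kappa> w) \<in> {(w, \<kappa>). G u \<kappa> w}" using g the by simp
      obtain a b where ab: "similar u w a b" "\<kappa> = k a b" by (rule similar_G[OF g])
      show "(case (w, THE \<kappa>. G u \<kappa> w) of (w, \<kappa>) \<Rightarrow> weight ?\<psi> \<kappa>) = term_at M' v ts u w"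
        unfolding the prod.case ab(2) weight_k by (rule term_at_similar[OF J ag ab(1), symmetric])
    next
      fix z assume "z \<in> {(w, \<kappa>). G u \<kappa> w}"
      then obtain w \<kappa> where z: "z = (w, \<kappa>)" "G u \<kappa> w" by blast
      have the: "(THE \<kappa>. G u \<kappa> w) = \<kappa>" using z G_fun by blast
      show "(fst z, THE \<kappa>. G u \<kappa> (fst z)) = z" using z the by simp
      show "fst z \<in> ?W" unfolding z(1) fst_conv using z(2) by blast
    qed
    also have "term_at M' v ts u u = weight0 ?\<psi> (col' u)"
      unfolding col weight0_col by (rule term_at_similar[OF J ag s'])
    finally have sum: "(\<Sum>w<n. term_at M' v ts u w)
      = weight0 ?\<psi> (col' u) + (\<Sum>(w, \<kappa>)\<in>{(w, \<kappa>). G u \<kappa> w}. weight ?\<psi> \<kappa>)" .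
    \<comment> \<open>The element supplied by \<open>origin\<close> may differ from
      \<open>a\<close>, but both have the colour of \<open>u\<close>, and the colour contains the
      formula exactly when it holds.\<close>
    obtain a0 where a0: "a0 \<in> dom M" "col a0 = col' u"
      "same_order_mod (threshold ?\<psi>) (modulus ?\<psi>) (\<Sum>w<n. term_at M' v ts u w) (S ?\<psi> a0)"
      using origin[OF u] J unfolding sum by blast
    have "modulus ?\<psi> = max 1 m" if "c = CCong m \<or> c = CNCong m" for m using that by auto
    then have "cmp_holds c (\<Sum>w<n. term_at M' v ts u w) d = cmp_holds c (S ?\<psi> a0) d"
      using cmp_holds_same_order[of d "modulus ?\<psi>"] a0(3) by simp
    also have "\<dots> = cmp_holds c (S ?\<psi> a) d"
      unfolding M_iff[OF a0(1)] M_iff[OF a] a0(2) col ..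
    finally show ?thesis
      using sat_Pres[of M' v ts c d \<sigma>] sat_Pres[OF finM, of v ts c d \<tau>] S_eq[OF J a]
      by (simp add: u_def a_def)
  qed
  show ?thesis unfolding agree_def
  proof (intro allI impI)
    fix u w a b assume s: "similar u w a b"
    show "sat M' ?\<psi> (as u w) = sat M ?\<psi> (as a b)"
      using main[of "as u w" w "as a b" b] main[of "as u w" u "as a b" a] s similar_sym[OF s]
      by (cases v) (simp_all del: sat.simps)
  qed
qed

lemma agree_Atom:
  assumes "enc_atom g \<le> B"
  shows "agree (Atom g)"
proof (cases g)
  case (UA p v)
  have "prod_encode (0, prod_encode (p, enc_var v)) \<le> B" using assms by (simp add: UA)
  then have "p \<le> B" using prod_encode_leD by blast
  then show ?thesis unfolding UA by (rule agree_UA)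
next
  case (BA r v w)
  have "prod_encode (1, prod_encode (r, prod_encode (enc_var v, enc_var w))) \<le> B" using assms by (simp add: BA)
  then have "r \<le> B" using prod_encode_leD by blast
  then show ?thesis unfolding BA by (rule agree_BA)
qed

lemma agree_CGt:
  assumes "agree \<phi>" "r \<le> B" "enc \<phi> \<le> prod_encode (2, B)"
  shows "agree (Pres v [(1, r, i, \<phi>)] CGt 0)"
proof (rule agree_Pres)
  show "Pres v [(1, r, i, \<phi>)] CGt 0 \<in> J"
    unfolding J_def F_def using Pres_code_bound[OF assms(2,3)] assms(2) by simp
qed (use assms(1) in simp)

text \<open>Every vertex has the colour of some original element, and every original colour occurs
  at a vertex; each fact gives one direction.\<close>

lemma ex_agree:
  assumes "agree \<chi>"
  shows "(\<exists>u\<in>dom M'. sat M' \<chi> (as u u)) \<longleftrightarrow> (\<exists>a\<in>dom M. sat M \<chi> (as a a))"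
proof
  assume "\<exists>u\<in>dom M'. sat M' \<chi> (as u u)"
  then obtain u where u: "u < n" "sat M' \<chi> (as u u)" by auto
  obtain a where a: "a \<in> dom M" "col a = col' u" using origin[OF u(1)] by blast
  have "similar u u a a" using u a by (simp add: similar_def)
  then show "\<exists>a\<in>dom M. sat M \<chi> (as a a)" using agreeD[OF assms] u(2) a(1) by blast
next
  assume "\<exists>a\<in>dom M. sat M \<chi> (as a a)"
  then obtain a where a: "a \<in> dom M" "sat M \<chi> (as a a)" by blast
  obtain u where u: "u < n" "col' u = col a" using copy[OF a(1)] by blast
  have "similar u u a a" using u a by (simp add: similar_def)
  then have "sat M' \<chi> (as u u)" using agreeD[OF assms] a(2) by blast
  then show "\<exists>u\<in>dom M'. sat M' \<chi> (as u u)" using u(1) by (auto intro!: bexI[of _ u])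
qed

lemma var_set_cases:
  obtains "Q = {}" | v where "Q = {v :: var}" | "Q = UNIV"
proof -
  have "UNIV = {VX, VY}" by (auto intro: var.exhaust)
  then have "Q \<in> Pow {VX, VY}" by auto
  also have "\<dots> = {{}, {VX}, {VY}, UNIV}" unfolding \<open>UNIV = {VX, VY}\<close> Pow_insert by auto
  finally show thesis using that by blast
qed

text \<open>Binding no variable gives a conjunction; a guard in one variable, or binding both, gives
  an existence statement about a single element; binding one variable of a two-variable guard gives
  a counting formula. The bound \<open>prod_encode (2, B)\<close> admits negated bodies, as needed
  for universal quantifiers.\<close>

lemma agree_ExG:
  assumes ag: "agree \<phi>" and wf: "wf (ExG Q g \<phi>)" and g: "enc_atom g \<le> B" and \<phi>: "enc \<phi> \<le> prod_encode (2, B)"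
  shows "agree (ExG Q g \<phi>)"
proof (cases Q rule: var_set_cases)
  case 1
  have "sat M (ExG Q g \<phi>) \<sigma> = sat M (Conj (Atom g) \<phi>) \<sigma>" for M \<sigma>
  proof -
    have "(\<forall>v. v \<notin> Q \<longrightarrow> \<sigma>' v = \<sigma> v) \<longleftrightarrow> \<sigma>' = \<sigma>" for \<sigma>' using 1 by (auto simp: fun_eq_iff)
    then show ?thesis using 1 by simp
  qed
  then show ?thesis by (intro agree_cong[OF agree_Conj[OF agree_Atom[OF g] ag]])
next
  case (2 v)
  show ?thesis
  proof (cases "avars g = {v}")
    case True
    have fv: "fv \<phi> \<subseteq> {v}" using wf True by simp
    show ?thesis unfolding agree_def 2 sat_ExG_one[OF True fv]
      using ex_agree[OF agree_Conj[OF agree_Atom[OF g] ag]] by blast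
  next
    case False
    then obtain r v1 v2 where gr: "g = BA r v1 v2" "v1 \<noteq> v2"
      using wf 2 by (cases g) auto
    have r: "r \<le> B" using g unfolding gr enc_atom.simps using prod_encode_leD by blast
    have "v = other (other v)" "v1 = other v \<or> v2 = other v" using gr(2) by (cases v; cases v1; cases v2; simp)+
    then show ?thesis unfolding gr 2
      using agree_cong[OF agree_CGt[OF ag r \<phi>] sat_ExG_Pres[OF _ gr(2)]] by metis
  qed
next
  case 3
  then obtain r v1 v2 where gr: "g = BA r v1 v2" "v1 \<noteq> v2"
    using wf by (cases g) (metis UNIV_I avars.simps insertE empty_iff subset_iff var.distinct(1) wf.simps(6))+
  have r: "r \<le> B" using g unfolding gr enc_atom.simps using prod_encode_leD by blast
  have fin: "finite (dom M')" by simp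
  show ?thesis unfolding agree_def gr 3 sat_ExG_both[OF finM gr(2)] sat_ExG_both[OF fin gr(2)]
    using ex_agree[OF agree_CGt[OF ag r \<phi>]] by blast
qed

lemma agree_all: "wf \<phi> \<Longrightarrow> enc \<phi> \<le> B \<Longrightarrow> agree \<phi>"
proof (induction \<phi> rule: fm_induct)
  case (Atom a)
  have "enc_atom a \<le> B" using Atom.prems(2) prod_encode_leD unfolding enc.simps by blast
  then show ?case by (rule agree_Atom)
next
  case (Eq v w)
  show ?case by (rule agree_Eq)
next
  case (Neg \<phi>)
  then show ?case using enc_less(1)[of \<phi>] by (intro agree_Neg) simp
next
  case (Conj \<phi> \<psi>)
  have "enc \<phi> \<le> B" "enc \<psi> \<le> B" using Conj.prems(2) enc_less(2,3)[of \<phi> \<psi>] enc_less(3)[of \<psi> \<phi>] by linarith+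
  then show ?case using Conj.IH Conj.prems(1) by (intro agree_Conj) simp_all
next
  case (Disj \<phi> \<psi>)
  have "enc \<phi> \<le> B" "enc \<psi> \<le> B" using Disj.prems(2) enc_less(4,5)[of \<phi> \<psi>] enc_less(5)[of \<psi> \<phi>] by linarith+
  then show ?case using Disj.IH Disj.prems(1) by (intro agree_Disj) simp_all
next
  case (ExG Q g \<phi>)
  have le: "enc_atom g \<le> B" "enc \<phi> \<le> B"
    using ExG.prems(2) unfolding enc.simps by (meson prod_encode_leD)+
  have "enc \<phi> \<le> prod_encode (2, B)" using le(2) le_prod_encode_2[of B 2] by linarith
  then show ?case using ExG le by (intro agree_ExG) auto
next
  case (AllG Q g \<phi>)
  have le: "enc_atom g \<le> B" "enc \<phi> \<le> B"
    using AllG.prems(2) unfolding enc.simps by (meson prod_encode_leD)+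
  have "enc (Neg \<phi>) \<le> prod_encode (2, B)" using le(2) by (simp add: prod_encode_mono)
  moreover have "agree (Neg \<phi>)" using AllG le by (intro agree_Neg) simp
  ultimately have "agree (ExG Q g (Neg \<phi>))" using AllG.prems(1) le(1) by (intro agree_ExG) simp_all
  from agree_Neg[OF this] show ?case by (rule agree_cong) (simp add: sat_AllG del: sat.simps(6,7))
next
  case (Pres v ts c d)
  show ?case
  proof (rule agree_Pres)
    have "enc (Pres v ts c d) < code_bound B" using Pres.prems(2) code_bound_gt[of B] by linarith
    moreover have "\<forall>(l, R, i, \<phi>)\<in>set ts. R \<le> B" using enc_Pres_member(1)[OF Pres.prems(2)] by auto
    ultimately show "Pres v ts c d \<in> J" unfolding J_def F_def by blast
  next
    fix l R i \<phi> assume t: "(l, R, i, \<phi>) \<in> set ts"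
    then have "wf \<phi>" using Pres.prems(1) by fastforce
    then show "agree \<phi>" using Pres.IH[OF t] enc_Pres_member(2)[OF Pres.prems(2) t] by blast
  qed
qed

end

text \<open>Bounds the search over relations, which are coded as bit sets.\<close>

lemma set_encode_less:
  assumes "X \<subseteq> {..<m}"
  shows "set_encode X < 2 ^ m"
proof -
  have "set_encode X \<le> (\<Sum>i<m. 2 ^ i)"
    unfolding set_encode_def using assms by (intro sum_mono2) auto
  also have "\<dots> < 2 ^ m" by (induction m) auto
  finally show ?thesis .
qed

text \<open>The relations of the small copy involve only symbols up to \<open>B\<close> and elements
  below \<open>n\<close>, so the coded tuples, and with them the codes of both relations, are
  bounded. A sentence has no free variables, so the assignment can be fixed to 0, which is always in
  the domain.\<close>

theorem small_model_property:
  assumes \<phi>: "sentence \<phi>" and sat: "fin_sat \<phi>"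
  defines "B \<equiv> enc \<phi>"
  shows "\<exists>n\<le>size_bound B. 0 < n \<and> (\<exists>x<2 ^ Suc (prod_encode (B, n)). \<exists>y<2 ^ Suc (prod_encode (B, prod_encode (n, n))).
    sat (mk_struct n x y) \<phi> (as 0 0))"
proof -
  obtain M \<sigma> where M: "finite (dom M)" "dom M \<noteq> {}" "sat M \<phi> \<sigma>" using sat unfolding fin_sat_def by blast
  interpret bounded_model M B using M by unfold_locales
  obtain n col' G where n: "0 < n" "n \<le> graph_bound (card J) (card (Pow F \<times> Pow F \<times> Pow F \<times> Pow F)) (card (Pow F)) (code_bound B)"
    and copy: "small_copy M B n col' G"
  proof (rule small_graph)
    fix n col' G
    assume "0 < n" "n \<le> graph_bound (card J) (card (Pow F \<times> Pow F \<times> Pow F \<times> Pow F)) (card (Pow F)) (code_bound B)"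
      "\<And>u. u < n \<Longrightarrow> \<exists>a\<in>dom M. col a = col' u
       \<and> (\<forall>\<psi>\<in>J. same_order_mod (threshold \<psi>) (modulus \<psi>)
             (weight0 \<psi> (col' u) + (\<Sum>(v, \<kappa>)\<in>{(v, \<kappa>). G u \<kappa> v}. weight \<psi> \<kappa>)) (S \<psi> a))"
      "\<And>a. a \<in> dom M \<Longrightarrow> \<exists>u<n. col' u = col a"
      "\<And>u v \<kappa> \<kappa>'. G u \<kappa> v \<Longrightarrow> G u \<kappa>' v \<Longrightarrow> \<kappa> = \<kappa>'"
      "\<And>u v \<kappa>. G u \<kappa> v \<Longrightarrow> u < n \<and> v < n \<and> u \<noteq> v \<and> G v (rev4 \<kappa>) u \<and> fst \<kappa> = col' u
       \<and> (\<exists>a\<in>dom M. \<exists>b\<in>N a. \<kappa> = k a b)"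
    then show thesis by (intro that[of n col' G]) (unfold_locales, blast+)
  qed
  interpret small_copy M B n col' G by (rule copy)
  define X where "X = {prod_encode (p, a) | p a. urel M' p a}"
  define Y where "Y = {prod_encode (r, prod_encode (a, b)) | r a b. brel M' r a b}"
  have X: "X \<subseteq> {..<Suc (prod_encode (B, n))}"
    by (auto simp: X_def M'_def less_Suc_eq_le intro!: prod_encode_mono)
  have Y: "Y \<subseteq> {..<Suc (prod_encode (B, prod_encode (n, n)))}"
    by (auto simp: Y_def M'_def less_Suc_eq_le intro!: prod_encode_mono)
  have "finite X" "finite Y" using X Y finite_subset by blast+
  then have dec: "set_decode (set_encode X) = X" "set_decode (set_encode Y) = Y" by simp_all
  have "prod_encode (p, a) \<in> X \<longleftrightarrow> urel M' p a" for p a by (auto simp: X_def)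
  moreover have "prod_encode (r, prod_encode (a, b)) \<in> Y \<longleftrightarrow> brel M' r a b" for r a b by (auto simp: Y_def)
  ultimately have mk_struct: "mk_struct n (set_encode X) (set_encode Y) = M'"
    unfolding mk_struct_def dec by (simp add: M'_def)
  have fv: "fv \<phi> = {}" and wf: "wf \<phi>" using \<phi> by (simp_all add: sentence_def)
  obtain a where "a \<in> dom M" using M(2) by blast
  then obtain u where "u < n" "col' u = col a" using copy[OF \<open>a \<in> dom M\<close>] small_copy.copy by blast
  then have "similar u u a a" using \<open>a \<in> dom M\<close> by (simp add: similar_def)
  from agreeD[OF agree_all[OF wf] this] have "sat M' \<phi> (as u u) = sat M \<phi> (as a a)" by (simp add: B_def)
  moreover have "sat M' \<phi> (as 0 0) = sat M' \<phi> (as u u)" "sat M \<phi> \<sigma> = sat M \<phi> (as a a)"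
    by (rule sat_cong, simp add: fv)+
  ultimately have "sat (mk_struct n (set_encode X) (set_encode Y)) \<phi> (as 0 0)" unfolding mk_struct using M(3) by simp
  moreover have "n \<le> size_bound B"
  proof -
    have "card J \<le> card F" unfolding J_def using finF by (intro card_mono) auto
    then have J: "card J \<le> code_bound B" using cardF by (rule order_trans)
    have Pow: "card (Pow F) \<le> 2 ^ code_bound B"
      using finF cardF by (simp add: card_Pow power_increasing)
    have "card (Pow F \<times> Pow F \<times> Pow F \<times> Pow F) = card (Pow F) ^ 4"
      by (simp add: card_cartesian_product power4_eq_xxxx)
    also have "\<dots> \<le> (2 ^ code_bound B) ^ 4" using Pow by (intro power_mono) auto
    also have "\<dots> = 2 ^ (4 * code_bound B)" by (simp add: power_mult[symmetric] mult.commute)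
    finally show ?thesis
      using n(2) graph_bound_mono[OF J _ Pow order_refl] unfolding size_bound_def Let_def by (meson order_trans)
  qed
  ultimately show ?thesis using n(1) set_encode_less[OF X] set_encode_less[OF Y] by blast
qed

section \<open>Recursive functions\<close>

text \<open>Computability of total functions on argument lists of a fixed length; lists make the
  closure rules uniform in the arity.\<close>

definition cf :: "nat \<Rightarrow> (nat list \<Rightarrow> nat) \<Rightarrow> bool" where
  "cf n f \<longleftrightarrow> (\<exists>r. \<forall>xs. length xs = n \<longrightarrow> rf_eval r xs (f xs))"

text \<open>The default 0 makes projections total, so that \<open>cf_arg\<close> needs no condition
  on the index.\<close>

definition arg :: "nat \<Rightarrow> nat list \<Rightarrow> nat" where
  "arg i xs = (if i < length xs then xs ! i else 0)"

lemma arg_simps [simp]: "arg 0 (x # xs) = x" "arg (Suc i) (x # xs) = arg i xs"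
  by (simp_all add: arg_def)

lemma arg_tl: "arg i (tl xs) = arg (Suc i) xs"
  by (cases xs) (simp_all add: arg_def)

lemma arg_numeral [simp]: "arg (numeral k) (x # xs) = arg (pred_numeral k) xs"
  by (simp add: numeral_eq_Suc)

lemma cf_cong: "cf n g \<Longrightarrow> (\<And>xs. length xs = n \<Longrightarrow> f xs = g xs) \<Longrightarrow> cf n f"
  by (simp add: cf_def)

lemma cf_comp:
  assumes "cf (length gs) f" "\<forall>g\<in>set gs. cf n g"
  shows "cf n (\<lambda>xs. f (map (\<lambda>g. g xs) gs))"
proof -
  obtain r where r: "\<And>xs. length xs = length gs \<Longrightarrow> rf_eval r xs (f xs)"
    using assms(1) by (auto simp: cf_def)
  have "\<exists>rs. \<forall>xs. length xs = n \<longrightarrow> list_all2 (\<lambda>g y. rf_eval g xs y) rs (map (\<lambda>g. g xs) gs)"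
    using assms(2)
  proof (induction gs)
    case (Cons g gs)
    obtain rs where "\<forall>xs. length xs = n \<longrightarrow> list_all2 (\<lambda>g y. rf_eval g xs y) rs (map (\<lambda>g. g xs) gs)"
      using Cons by auto
    moreover obtain q where "\<forall>xs. length xs = n \<longrightarrow> rf_eval q xs (g xs)"
      using Cons.prems by (auto simp: cf_def)
    ultimately show ?case by (intro exI[of _ "q # rs"]) simp
  qed simp
  then obtain rs where rs: "\<And>xs. length xs = n \<Longrightarrow> list_all2 (\<lambda>g y. rf_eval g xs y) rs (map (\<lambda>g. g xs) gs)"
    by blast
  then show ?thesis unfolding cf_def
  proof (intro exI[of _ "Cnf r rs"] allI impI)
    fix xs :: "nat list" assume "length xs = n"
    then show "rf_eval (Cnf r rs) xs (f (map (\<lambda>g. g xs) gs))"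
      using rs r[of "map (\<lambda>g. g xs) gs"] by (intro rf_eval.comp[where ys = "map (\<lambda>g. g xs) gs"]) simp_all
  qed
qed

lemma cf_zero: "cf n (\<lambda>xs. 0)"
  unfolding cf_def by (intro exI[of _ Zf]) (simp add: rf_eval.zero)

lemma cf_arg: "cf n (\<lambda>xs. arg i xs)"
proof (cases "i < n")
  case True
  then show ?thesis unfolding cf_def
    by (intro exI[of _ "Idf n i"]) (auto simp: arg_def intro: rf_eval.proj)
next
  case False
  then show ?thesis by (intro cf_cong[OF cf_zero]) (simp add: arg_def)
qed

lemma cf_cons:
  assumes "cf (Suc n) h" "cf n K"
  shows "cf n (\<lambda>xs. h (K xs # xs))"
proof -
  have "cf n (\<lambda>xs. h (map (\<lambda>g. g xs) (K # map arg [0..<n])))"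
    using assms by (intro cf_comp) (auto intro: cf_arg)
  then show ?thesis
  proof (rule cf_cong)
    fix xs :: "nat list" assume "length xs = n"
    then have "map (\<lambda>i. arg i xs) [0..<n] = xs"
      by (intro nth_equalityI) (auto simp: arg_def)
    then show "h (K xs # xs) = h (map (\<lambda>g. g xs) (K # map arg [0..<n]))" by (simp add: comp_def)
  qed
qed

text \<open>The \<open>cf_comp\<close> family lifts computability from bare projections to arbitrary
  argument functions, so that each composite notion is verified once, on projections.\<close>

lemma cf_comp1: "cf 1 (\<lambda>ys. F (arg 0 ys)) \<Longrightarrow> cf n a \<Longrightarrow> cf n (\<lambda>xs. F (a xs))"
  using cf_comp[of "[a]" "\<lambda>ys. F (arg 0 ys)" n] by simp

lemma cf_comp2: "cf 2 (\<lambda>ys. F (arg 0 ys) (arg 1 ys)) \<Longrightarrow> cf n a \<Longrightarrow> cf n b \<Longrightarrow> cf n (\<lambda>xs. F (a xs) (b xs))"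
  using cf_comp[of "[a, b]" "\<lambda>ys. F (arg 0 ys) (arg 1 ys)" n] by (simp add: numeral_eq_Suc)

lemma cf_comp3: "cf 3 (\<lambda>ys. F (arg 0 ys) (arg 1 ys) (arg 2 ys)) \<Longrightarrow> cf n a \<Longrightarrow> cf n b \<Longrightarrow> cf n c
    \<Longrightarrow> cf n (\<lambda>xs. F (a xs) (b xs) (c xs))"
  using cf_comp[of "[a, b, c]" "\<lambda>ys. F (arg 0 ys) (arg 1 ys) (arg 2 ys)" n] by (simp add: numeral_eq_Suc)

lemma cf_comp4: "cf 4 (\<lambda>ys. F (arg 0 ys) (arg 1 ys) (arg 2 ys) (arg 3 ys)) \<Longrightarrow> cf n a \<Longrightarrow> cf n b \<Longrightarrow> cf n c
    \<Longrightarrow> cf n d \<Longrightarrow> cf n (\<lambda>xs. F (a xs) (b xs) (c xs) (d xs))"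
  using cf_comp[of "[a, b, c, d]" "\<lambda>ys. F (arg 0 ys) (arg 1 ys) (arg 2 ys) (arg 3 ys)" n]
  by (simp add: numeral_eq_Suc)

lemma cf_comp8: "cf 8 (\<lambda>ys. F (arg 0 ys) (arg 1 ys) (arg 2 ys) (arg 3 ys) (arg 4 ys) (arg 5 ys) (arg 6 ys) (arg 7 ys))
    \<Longrightarrow> cf n a \<Longrightarrow> cf n b \<Longrightarrow> cf n c \<Longrightarrow> cf n d \<Longrightarrow> cf n e \<Longrightarrow> cf n f \<Longrightarrow> cf n g \<Longrightarrow> cf n h
    \<Longrightarrow> cf n (\<lambda>xs. F (a xs) (b xs) (c xs) (d xs) (e xs) (f xs) (g xs) (h xs))"
  using cf_comp[of "[a, b, c, d, e, f, g, h]" "\<lambda>ys. F (arg 0 ys) (arg 1 ys) (arg 2 ys) (arg 3 ys) (arg 4 ys) (arg 5 ys) (arg 6 ys) (arg 7 ys)" n]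
  by (simp add: numeral_eq_Suc)

lemma cf_Suc: "cf n a \<Longrightarrow> cf n (\<lambda>xs. Suc (a xs))"
proof (rule cf_comp1[where F = Suc])
  have "rf_eval Sf xs (Suc (arg 0 xs))" if len: "length xs = 1" for xs
  proof -
    obtain x where "xs = [x]" using len by (cases xs) auto
    then show ?thesis using rf_eval.succ[of x] by simp
  qed
  then show "cf 1 (\<lambda>ys. Suc (arg 0 ys))" unfolding cf_def by blast
qed

lemma cf_const: "cf n (\<lambda>xs. c)"
  by (induction c) (auto intro: cf_zero cf_Suc)

text \<open>The step receives the counter and the previous value in front of the parameters, hence
  \<open>tl (tl ys)\<close>.\<close>

lemma cf_rec:
  assumes B: "cf n B" and K: "cf n K" and S: "cf (Suc (Suc n)) (\<lambda>ys. S (arg 0 ys) (arg 1 ys) (tl (tl ys)))"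
  shows "cf n (\<lambda>xs. rec_nat (B xs) (\<lambda>k y. S k y xs) (K xs))"
proof -
  obtain f where f: "\<And>xs. length xs = n \<Longrightarrow> rf_eval f xs (B xs)" using B by (auto simp: cf_def)
  obtain g where g: "\<And>ys. length ys = Suc (Suc n) \<Longrightarrow> rf_eval g ys (S (arg 0 ys) (arg 1 ys) (tl (tl ys)))"
    using S by (auto simp: cf_def)
  have "rf_eval (Prf f g) (k # xs) (rec_nat (B xs) (\<lambda>k y. S k y xs) k)" if xs: "length xs = n" for k xs
  proof (induction k)
    case 0
    then show ?case using f[OF xs] by (auto intro: rf_eval.pr0)
  next
    case (Suc k)
    show ?case
      using rf_eval.prS[OF Suc] g[of "k # rec_nat (B xs) (\<lambda>k y. S k y xs) k # xs"] xs by simp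
  qed
  then have "rf_eval (Prf f g) ys (rec_nat (B (tl ys)) (\<lambda>k y. S k y (tl ys)) (hd ys))" if "length ys = Suc n" for ys
    using that by (cases ys) auto
  then have "cf (Suc n) (\<lambda>ys. rec_nat (B (tl ys)) (\<lambda>k y. S k y (tl ys)) (hd ys))"
    unfolding cf_def by blast
  from cf_cons[OF this K] show ?thesis by simp
qed

text \<open>Minimization looks for a zero, so the negated test is searched; the existence assumption
  makes the search stop.\<close>

lemma cf_Least:
  assumes P: "cf (Suc n) (\<lambda>ys. of_bool (P (arg 0 ys) (tl ys)))" and ex: "\<And>xs. length xs = n \<Longrightarrow> \<exists>y. P y xs"
  shows "cf n (\<lambda>xs. LEAST y. P y xs)"
proof -
  have not: "cf 1 (\<lambda>ys. rec_nat 1 (\<lambda>k y. 0) (arg 0 ys))"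
    by (intro cf_rec cf_const cf_arg)
  have "cf (Suc n) (\<lambda>ys. rec_nat 1 (\<lambda>k y. 0) (of_bool (P (arg 0 ys) (tl ys))))"
    by (rule cf_comp1[where F = "rec_nat 1 (\<lambda>k y. 0)", OF not P])
  then have "cf (Suc n) (\<lambda>ys. of_bool (\<not> P (arg 0 ys) (tl ys)))"
    by (rule cf_cong) auto
  then obtain f where f: "\<And>ys. length ys = Suc n \<Longrightarrow> rf_eval f ys (of_bool (\<not> P (arg 0 ys) (tl ys)))"
    by (auto simp: cf_def)
  have "rf_eval (Mnf f) xs (LEAST y. P y xs)" if xs: "length xs = n" for xs
  proof (rule rf_eval.mn)
    have "P (LEAST y. P y xs) xs" using ex[OF xs] by (rule LeastI_ex)
    then show "rf_eval f ((LEAST y. P y xs) # xs) 0" using f[of "(LEAST y. P y xs) # xs"] xs by simp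
    show "\<forall>i<LEAST y. P y xs. \<exists>z>0. rf_eval f (i # xs) z"
    proof (intro allI impI)
      fix i assume "i < (LEAST y. P y xs)"
      then have "\<not> P i xs" by (rule not_less_Least)
      then show "\<exists>z>0. rf_eval f (i # xs) z" using f[of "i # xs"] xs by (intro exI[of _ 1]) simp
    qed
  qed
  then show ?thesis unfolding cf_def by blast
qed

lemma cf_add: "cf n a \<Longrightarrow> cf n b \<Longrightarrow> cf n (\<lambda>xs. a xs + b xs)"
proof (rule cf_comp2[where F = "(+)"])
  have "cf 2 (\<lambda>ys. rec_nat (arg 0 ys) (\<lambda>k y. Suc y) (arg 1 ys))" by (intro cf_rec cf_arg cf_Suc)
  moreover have "rec_nat a (\<lambda>k y. Suc y) b = a + b" for a b by (induction b) auto
  ultimately show "cf 2 (\<lambda>ys. arg 0 ys + arg 1 ys)" by simp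
qed

lemma cf_mult: "cf n a \<Longrightarrow> cf n b \<Longrightarrow> cf n (\<lambda>xs. a xs * b xs)"
proof (rule cf_comp2[where F = "(*)"])
  have "cf 2 (\<lambda>ys. rec_nat 0 (\<lambda>k y. y + arg 0 ys) (arg 1 ys))"
    by (intro cf_rec cf_const cf_arg cf_add; simp only: arg_tl; intro cf_arg)
  moreover have "rec_nat 0 (\<lambda>k y. y + a) b = a * b" for a b :: nat by (induction b) auto
  ultimately show "cf 2 (\<lambda>ys. arg 0 ys * arg 1 ys)" by simp
qed

lemma cf_power: "cf n a \<Longrightarrow> cf n b \<Longrightarrow> cf n (\<lambda>xs. a xs ^ b xs)"
proof (rule cf_comp2[where F = "(^)"])
  have "cf 2 (\<lambda>ys. rec_nat 1 (\<lambda>k y. y * arg 0 ys) (arg 1 ys))"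
    by (intro cf_rec cf_const cf_arg cf_mult; simp only: arg_tl; intro cf_arg)
  moreover have "rec_nat 1 (\<lambda>k y. y * a) b = a ^ b" for a b :: nat by (induction b) auto
  ultimately show "cf 2 (\<lambda>ys. arg 0 ys ^ arg 1 ys)" by simp
qed

lemma cf_diff: "cf n a \<Longrightarrow> cf n b \<Longrightarrow> cf n (\<lambda>xs. a xs - b xs)"
proof (rule cf_comp2[where F = "(-)"])
  have "cf 1 (\<lambda>ys. rec_nat 0 (\<lambda>k y. k) (arg 0 ys))" by (intro cf_rec cf_const cf_arg)
  moreover have "rec_nat 0 (\<lambda>k y. k) a = a - 1" for a :: nat by (cases a) auto
  ultimately have "cf 1 (\<lambda>ys. arg 0 ys - 1)" by simp
  note pred = cf_comp1[where F = "\<lambda>x. x - 1", OF this]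
  have "cf 2 (\<lambda>ys. rec_nat (arg 0 ys) (\<lambda>k y. y - 1) (arg 1 ys))" by (intro cf_rec cf_arg pred)
  moreover have "rec_nat a (\<lambda>k y. y - 1) b = a - b" for a b :: nat by (induction b) auto
  ultimately show "cf 2 (\<lambda>ys. arg 0 ys - arg 1 ys)" by simp
qed

lemma cf_Not: "cf n (\<lambda>xs. of_bool (P xs)) \<Longrightarrow> cf n (\<lambda>xs. of_bool (\<not> P xs))"
  by (rule cf_cong[of n "\<lambda>xs. 1 - of_bool (P xs)"], intro cf_diff cf_const, assumption, simp)

lemma cf_conj: "cf n (\<lambda>xs. of_bool (P xs)) \<Longrightarrow> cf n (\<lambda>xs. of_bool (Q xs)) \<Longrightarrow> cf n (\<lambda>xs. of_bool (P xs \<and> Q xs))"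
  by (rule cf_cong[of n "\<lambda>xs. of_bool (P xs) * of_bool (Q xs)"], intro cf_mult, assumption+, simp)

lemma cf_disj: "cf n (\<lambda>xs. of_bool (P xs)) \<Longrightarrow> cf n (\<lambda>xs. of_bool (Q xs)) \<Longrightarrow> cf n (\<lambda>xs. of_bool (P xs \<or> Q xs))"
  by (rule cf_cong[of n "\<lambda>xs. of_bool (\<not> (\<not> P xs \<and> \<not> Q xs))"], intro cf_Not cf_conj, assumption+, simp)

lemma cf_imp: "cf n (\<lambda>xs. of_bool (P xs)) \<Longrightarrow> cf n (\<lambda>xs. of_bool (Q xs)) \<Longrightarrow> cf n (\<lambda>xs. of_bool (P xs \<longrightarrow> Q xs))"
  by (rule cf_cong[of n "\<lambda>xs. of_bool (\<not> (P xs \<and> \<not> Q xs))"], intro cf_Not cf_conj, assumption+, simp)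

lemma cf_le: "cf n a \<Longrightarrow> cf n b \<Longrightarrow> cf n (\<lambda>xs. of_bool (a xs \<le> b xs))"
  by (rule cf_cong[of n "\<lambda>xs. 1 - (a xs - b xs)"], intro cf_diff cf_const, assumption+, simp)

lemma cf_less: "cf n a \<Longrightarrow> cf n b \<Longrightarrow> cf n (\<lambda>xs. of_bool (a xs < b xs))"
  by (rule cf_cong[of n "\<lambda>xs. of_bool (\<not> b xs \<le> a xs)"], intro cf_Not cf_le, assumption+, simp add: not_le)

lemma cf_eq: "cf n a \<Longrightarrow> cf n b \<Longrightarrow> cf n (\<lambda>xs. of_bool (a xs = b xs))"
  by (rule cf_cong[of n "\<lambda>xs. of_bool (a xs \<le> b xs \<and> b xs \<le> a xs)"], intro cf_conj cf_le, assumption+,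
      simp add: eq_iff)

lemma cf_if: "cf n (\<lambda>xs. of_bool (P xs)) \<Longrightarrow> cf n a \<Longrightarrow> cf n b \<Longrightarrow> cf n (\<lambda>xs. if P xs then a xs else b xs)"
  by (rule cf_cong[of n "\<lambda>xs. of_bool (P xs) * a xs + of_bool (\<not> P xs) * b xs"],
      intro cf_add cf_mult cf_Not, assumption+, simp)

text \<open>Adapts a body that sees the index and the parameters to the step of a recursion, which
  also receives the accumulated value.\<close>

lemma cf_weaken2:
  assumes "cf (Suc n) h"
  shows "cf (Suc (Suc n)) (\<lambda>ys. h (arg 0 ys # tl (tl ys)))"
proof -
  have "cf (Suc (Suc n)) (\<lambda>xs. h (map (\<lambda>g. g xs) (arg 0 # map (\<lambda>i. arg (Suc (Suc i))) [0..<n])))"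
    using assms by (intro cf_comp) (auto intro: cf_arg)
  then show ?thesis
  proof (rule cf_cong)
    fix ys :: "nat list" assume "length ys = Suc (Suc n)"
    then have "map (\<lambda>i. arg (Suc (Suc i)) ys) [0..<n] = tl (tl ys)"
      by (intro nth_equalityI) (auto simp: arg_def nth_tl)
    then show "h (arg 0 ys # tl (tl ys)) = h (map (\<lambda>g. g ys) (arg 0 # map (\<lambda>i. arg (Suc (Suc i))) [0..<n]))"
      by (simp add: comp_def)
  qed
qed

lemma cf_sum:
  assumes g: "cf (Suc n) (\<lambda>ys. g (arg 0 ys) (tl ys))" and b: "cf n b"
  shows "cf n (\<lambda>xs. \<Sum>i<b xs. g i xs)"
proof -
  have "cf (Suc (Suc n)) (\<lambda>ys. g (arg 0 ys) (tl (tl ys)))"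
    using cf_weaken2[OF g] by simp
  then have "cf n (\<lambda>xs. rec_nat 0 (\<lambda>k y. y + g k xs) (b xs))"
    by (intro cf_rec cf_const b cf_add cf_arg)
  moreover have "rec_nat 0 (\<lambda>k y. y + g k xs) m = (\<Sum>i<m. g i xs)" for m xs
    by (induction m) auto
  ultimately show ?thesis by simp
qed

lemma cf_bex:
  assumes "cf (Suc n) (\<lambda>ys. of_bool (P (arg 0 ys) (tl ys)))" "cf n b"
  shows "cf n (\<lambda>xs. of_bool (\<exists>i<b xs. P i xs))"
proof (rule cf_cong)
  show "cf n (\<lambda>xs. of_bool (0 < (\<Sum>i<b xs. of_bool (P i xs) :: nat)))"
    using assms by (intro cf_less cf_const cf_sum)
  show "of_bool (\<exists>i<b xs. P i xs) = of_bool (0 < (\<Sum>i<b xs. of_bool (P i xs) :: nat))" for xs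
  proof -
    have "(\<Sum>i<b xs. of_bool (P i xs) :: nat) = 0 \<longleftrightarrow> (\<forall>i<b xs. \<not> P i xs)"
      by (simp add: sum_eq_0_iff) blast
    then show ?thesis by (auto simp del: sum_eq_0_iff)
  qed
qed

lemma cf_ball:
  assumes "cf (Suc n) (\<lambda>ys. of_bool (P (arg 0 ys) (tl ys)))" "cf n b"
  shows "cf n (\<lambda>xs. of_bool (\<forall>i<b xs. P i xs))"
  by (rule cf_cong[of n "\<lambda>xs. of_bool (\<not> (\<exists>i<b xs. \<not> P i xs))"])
    (rule cf_Not[OF cf_bex[OF cf_Not[OF assms(1)] assms(2)]], simp)

lemmas cf_basic = cf_const cf_arg cf_Suc cf_add cf_mult cf_power cf_diff cf_Not cf_conj cf_disj cf_imp
  cf_le cf_less cf_eq cf_if cf_bex cf_ball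

text \<open>Division is the least \<open>q\<close> whose next multiple exceeds the dividend; the
  disjunct for divisor 0 yields 0, in accordance with \<open>div\<close>.\<close>

lemma cf_div: "cf n a \<Longrightarrow> cf n b \<Longrightarrow> cf n (\<lambda>xs. a xs div b xs)"
proof (rule cf_comp2[where F = "(div)"])
  have "cf 2 (\<lambda>xs. LEAST q. arg 1 xs = 0 \<or> arg 0 xs < Suc q * arg 1 xs)"
  proof (rule cf_Least)
    show "cf (Suc 2) (\<lambda>ys. of_bool (arg 1 (tl ys) = 0 \<or> arg 0 (tl ys) < Suc (arg 0 ys) * arg 1 (tl ys)))"
      unfolding arg_tl by (intro cf_basic)
    show "\<exists>q. arg 1 xs = 0 \<or> arg 0 xs < Suc q * arg 1 xs" for xs
      by (intro exI[of _ "arg 0 xs"]) (cases "arg 1 xs", auto)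
  qed
  moreover have "(LEAST q. b = 0 \<or> a < Suc q * b) = a div b" for a b :: nat
  proof (rule Least_equality)
    show "b = 0 \<or> a < Suc (a div b) * b" using dividend_less_div_times[of b a] by auto
    show "a div b \<le> q" if "b = 0 \<or> a < Suc q * b" for q
      using that by (cases "b = 0") (simp_all add: less_Suc_eq_le[symmetric] div_less_iff_less_mult)
  qed
  ultimately show "cf 2 (\<lambda>ys. arg 0 ys div arg 1 ys)" by simp
qed

lemma cf_mod: "cf n a \<Longrightarrow> cf n b \<Longrightarrow> cf n (\<lambda>xs. a xs mod b xs)"
  unfolding minus_div_mult_eq_mod[symmetric] by (intro cf_diff cf_mult cf_div)

lemma cf_prod_encode: "cf n a \<Longrightarrow> cf n b \<Longrightarrow> cf n (\<lambda>xs. prod_encode (a xs, b xs))"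
  unfolding prod_encode_def triangle_def prod.case by (intro cf_basic cf_div)

definition pfst :: "nat \<Rightarrow> nat" where "pfst n = fst (prod_decode n)"
definition psnd :: "nat \<Rightarrow> nat" where "psnd n = snd (prod_decode n)"

lemma pfst_encode [simp]: "pfst (prod_encode (a, b)) = a" and psnd_encode [simp]: "psnd (prod_encode (a, b)) = b"
  by (simp_all add: pfst_def psnd_def)

lemma prod_encode_pfst_psnd: "prod_encode (pfst n, psnd n) = n"
  by (simp add: pfst_def psnd_def)

lemma cf_pfst: "cf n a \<Longrightarrow> cf n (\<lambda>xs. pfst (a xs))"
proof (rule cf_comp1[where F = pfst])
  have ex: "\<exists>y<Suc n. prod_encode (pfst n, y) = n" for n
    using prod_encode_pfst_psnd[of n] le_prod_encode_2[of "psnd n" "pfst n"]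
    by (intro exI[of _ "psnd n"]) simp
  have "cf 1 (\<lambda>xs. LEAST x. \<exists>y<Suc (arg 0 xs). prod_encode (x, y) = arg 0 xs)"
  proof (rule cf_Least)
    show "cf (Suc 1) (\<lambda>ys. of_bool (\<exists>y<Suc (arg 0 (tl ys)). prod_encode (arg 0 ys, y) = arg 0 (tl ys)))"
      unfolding arg_tl by (intro cf_basic cf_prod_encode; simp only: arg_tl; intro cf_basic)
  qed (use ex in blast)
  moreover have "(LEAST x. \<exists>y<Suc n. prod_encode (x, y) = n) = pfst n" for n
    by (rule Least_equality) (use ex in \<open>auto simp: pfst_def\<close>)
  ultimately show "cf 1 (\<lambda>ys. pfst (arg 0 ys))" by simp
qed

lemma cf_psnd: "cf n a \<Longrightarrow> cf n (\<lambda>xs. psnd (a xs))"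
proof (rule cf_comp1[where F = psnd])
  have "cf 1 (\<lambda>xs. LEAST y. prod_encode (pfst (arg 0 xs), y) = arg 0 xs)"
  proof (rule cf_Least)
    show "cf (Suc 1) (\<lambda>ys. of_bool (prod_encode (pfst (arg 0 (tl ys)), arg 0 ys) = arg 0 (tl ys)))"
      unfolding arg_tl by (intro cf_basic cf_prod_encode cf_pfst)
  qed (use prod_encode_pfst_psnd in blast)
  moreover have "(LEAST y. prod_encode (pfst n, y) = n) = psnd n" for n
  proof (rule Least_equality)
    show "prod_encode (pfst n, psnd n) = n" by (rule prod_encode_pfst_psnd)
    show "psnd n \<le> y" if "prod_encode (pfst n, y) = n" for y
      using psnd_encode[of "pfst n" y] that by simp
  qed
  ultimately show "cf 1 (\<lambda>ys. psnd (arg 0 ys))" by simp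
qed

lemma cf_bit: "cf n a \<Longrightarrow> cf n b \<Longrightarrow> cf n (\<lambda>xs. of_bool (a xs \<in> set_decode (b xs)))"
  unfolding set_decode_def mem_Collect_eq odd_iff_mod_2_eq_one by (intro cf_basic cf_mod cf_div)

lemmas cf_intros = cf_basic cf_sum cf_rec cf_div cf_mod cf_prod_encode cf_pfst cf_psnd cf_bit

section \<open>Course-of-values recursion\<close>

definition tab :: "(nat \<Rightarrow> nat \<Rightarrow> nat) \<Rightarrow> nat \<Rightarrow> nat" where
  "tab s c = rec_nat 0 (\<lambda>k t. prod_encode (s k t, t)) c"

text \<open>The table stores the latest value outermost, so in a table of length \<open>c\<close>
  the entry \<open>i\<close> lies below \<open>c - Suc i\<close> newer ones.\<close>

definition tab_entry :: "nat \<Rightarrow> nat \<Rightarrow> nat \<Rightarrow> nat" where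
  "tab_entry c t i = pfst (rec_nat t (\<lambda>_ y. psnd y) (c - Suc i))"

lemma gt_tab: "i < c \<Longrightarrow> tab_entry c (tab s c) i = s i (tab s i)"
proof -
  have "rec_nat (tab s (i + d)) (\<lambda>_ y. psnd y) d = tab s i" for i d
  proof (induction d arbitrary: i)
    case (Suc d)
    have "rec_nat (tab s (Suc i + d)) (\<lambda>_ y. psnd y) d = tab s (Suc i)" by (rule Suc)
    then show ?case by (simp add: tab_def)
  qed (simp add: tab_def)
  from this[of "Suc i" "c - Suc i"] show "tab_entry c (tab s c) i = s i (tab s i)" if "i < c"
    using that by (simp add: tab_entry_def) (simp add: tab_def)
qed

lemma cf_tab:
  assumes "cf (Suc (Suc n)) (\<lambda>ys. s (arg 0 ys) (arg 1 ys) (tl (tl ys)))" "cf n K"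
  shows "cf n (\<lambda>xs. tab (\<lambda>k t. s k t xs) (K xs))"
  unfolding tab_def using assms by (intro cf_rec cf_const cf_prod_encode cf_arg)

lemma cf_tab_entry: "cf n a \<Longrightarrow> cf n b \<Longrightarrow> cf n c \<Longrightarrow> cf n (\<lambda>xs. tab_entry (a xs) (b xs) (c xs))"
  by (rule cf_comp3[where F = tab_entry]) (unfold tab_entry_def, intro cf_intros)

section \<open>Evaluating coded formulas\<close>

definition sel :: "nat \<Rightarrow> nat \<Rightarrow> nat \<Rightarrow> nat" where
  "sel w a b = (if w = 0 then a else b)"

definition is_atom_code :: "nat \<Rightarrow> bool" where
  "is_atom_code g \<longleftrightarrow> (pfst g = 0 \<and> psnd (psnd g) < 2)
     \<or> (pfst g = 1 \<and> pfst (psnd (psnd g)) < 2 \<and> psnd (psnd (psnd g)) < 2)"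

definition in_atom_code :: "nat \<Rightarrow> nat \<Rightarrow> bool" where
  "in_atom_code g w \<longleftrightarrow> (pfst g = 0 \<and> psnd (psnd g) = w)
     \<or> (pfst g = 1 \<and> (pfst (psnd (psnd g)) = w \<or> psnd (psnd (psnd g)) = w))"

definition is_cmp_code :: "nat \<Rightarrow> bool" where
  "is_cmp_code c \<longleftrightarrow> (pfst c < 6 \<and> psnd c = 0) \<or> ((pfst c = 6 \<or> pfst c = 7) \<and> 1 \<le> psnd c)"

text \<open>The code of a nonempty list is the successor of a pair, so each step subtracts 1 and
  takes the second component; past the end it stays at 0, the code of the empty list.\<close>

definition dropc :: "nat \<Rightarrow> nat \<Rightarrow> nat" where
  "dropc l i = rec_nat l (\<lambda>_ y. psnd (y - 1)) i"

definition nthc :: "nat \<Rightarrow> nat \<Rightarrow> nat" where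
  "nthc l i = pfst (dropc l i - 1)"

text \<open>Subtracting 1 undoes the offset that separates masks from the value 0 of rejected
  codes.\<close>

definition memc :: "nat \<Rightarrow> nat \<Rightarrow> bool" where
  "memc v w \<longleftrightarrow> ((v - 1) div 2 ^ w) mod 2 = 1"

definition guard_ok :: "nat \<Rightarrow> nat \<Rightarrow> nat \<Rightarrow> bool" where
  "guard_ok q g e \<longleftrightarrow> pfst q < 2 \<and> psnd q < 2 \<and> is_atom_code g \<and> 0 < e
     \<and> (\<forall>w<2. (sel w (pfst q) (psnd q) = 1 \<longrightarrow> in_atom_code g w) \<and> (memc e w \<longrightarrow> in_atom_code g w))"

text \<open>The list code bounds the length of the list and so serves as the range of positions;
  those with \<open>dropc l i = 0\<close> lie past the end and are skipped.\<close>

definition pres_ok :: "nat \<Rightarrow> nat \<Rightarrow> nat \<Rightarrow> bool" where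
  "pres_ok c t l \<longleftrightarrow> (\<forall>i<l. 0 < dropc l i \<longrightarrow> pfst (psnd (psnd (nthc l i))) < 2 \<and> 0 < tab_entry c t (psnd (psnd (psnd (nthc l i)))))"

definition wf_code :: "nat \<Rightarrow> nat \<Rightarrow> bool" where
  "wf_code c t \<longleftrightarrow> (pfst c = 0 \<and> is_atom_code (psnd c))
     \<or> (pfst c = 1 \<and> pfst (psnd c) < 2 \<and> psnd (psnd c) < 2)
     \<or> (pfst c = 2 \<and> 0 < tab_entry c t (psnd c))
     \<or> ((pfst c = 3 \<or> pfst c = 4) \<and> 0 < tab_entry c t (pfst (psnd c)) \<and> 0 < tab_entry c t (psnd (psnd c)))
     \<or> ((pfst c = 5 \<or> pfst c = 6) \<and> guard_ok (pfst (psnd c)) (pfst (psnd (psnd c))) (tab_entry c t (psnd (psnd (psnd c)))))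
     \<or> (pfst c = 7 \<and> pfst (psnd c) < 2 \<and> 0 < pfst (psnd (psnd c)) \<and> is_cmp_code (pfst (psnd (psnd (psnd c))))
         \<and> pres_ok c t (pfst (psnd (psnd c))))"

text \<open>In the quantifier cases only the guard is inspected, because the body of a well-formed
  formula has no further variables.\<close>

definition free_code :: "nat \<Rightarrow> nat \<Rightarrow> nat \<Rightarrow> bool" where
  "free_code c t w \<longleftrightarrow> (pfst c = 0 \<and> in_atom_code (psnd c) w)
     \<or> (pfst c = 1 \<and> (pfst (psnd c) = w \<or> psnd (psnd c) = w))
     \<or> (pfst c = 2 \<and> memc (tab_entry c t (psnd c)) w)
     \<or> ((pfst c = 3 \<or> pfst c = 4) \<and> (memc (tab_entry c t (pfst (psnd c))) w \<or> memc (tab_entry c t (psnd (psnd c))) w))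
     \<or> ((pfst c = 5 \<or> pfst c = 6) \<and> in_atom_code (pfst (psnd (psnd c))) w \<and> sel w (pfst (pfst (psnd c))) (psnd (pfst (psnd c))) \<noteq> 1)
     \<or> (pfst c = 7 \<and> pfst (psnd c) = w)"

text \<open>The value \<open>vars_val c\<close> is \<open>0\<close> unless \<open>c\<close> is the code of a well-formed formula \<open>\<phi>\<close>, and then
  it is one plus the bit mask of \<open>fv \<phi>\<close>.\<close>

definition vars_step :: "nat \<Rightarrow> nat \<Rightarrow> nat" where
  "vars_step c t = (if wf_code c t then 1 + (of_bool (free_code c t 0) + 2 * of_bool (free_code c t 1)) else 0)"

definition vars_val :: "nat \<Rightarrow> nat" where
  "vars_val c = vars_step c (tab vars_step c)"

definition atom_holds :: "nat \<Rightarrow> nat \<Rightarrow> nat \<Rightarrow> nat \<Rightarrow> nat \<Rightarrow> bool" where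
  "atom_holds x y g a b \<longleftrightarrow>
     (pfst g = 0 \<and> prod_encode (pfst (psnd g), sel (psnd (psnd g)) a b) \<in> set_decode x)
     \<or> (pfst g = 1 \<and> prod_encode (pfst (psnd g), prod_encode (sel (pfst (psnd (psnd g))) a b, sel (psnd (psnd (psnd g))) a b)) \<in> set_decode y)"

definition lookup :: "nat \<Rightarrow> nat \<Rightarrow> nat \<Rightarrow> nat \<Rightarrow> nat \<Rightarrow> nat \<Rightarrow> bool" where
  "lookup n m t e a b \<longleftrightarrow> tab_entry m t ((e * n + a) * n + b) = 1"

definition succ_count :: "nat \<Rightarrow> nat \<Rightarrow> nat \<Rightarrow> nat \<Rightarrow> nat \<Rightarrow> nat \<Rightarrow> nat \<Rightarrow> nat \<Rightarrow> nat" where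
  "succ_count n y m t e v a b = (\<Sum>z<n. of_bool
     (prod_encode (pfst (psnd e), sel (pfst (psnd (psnd e))) (prod_encode (sel v a b, z)) (prod_encode (z, sel v a b))) \<in> set_decode y
      \<and> lookup n m t (psnd (psnd (psnd e))) (sel v a z) (sel v z b)))"

text \<open>Works on integer codes: nonnegative integers have even codes, negative ones odd codes.
  Sums with negative coefficients are kept as two natural numbers.\<close>

definition pos_part :: "nat \<Rightarrow> nat" where "pos_part z = (if z mod 2 = 0 then z div 2 else 0)"
definition neg_part :: "nat \<Rightarrow> nat" where "neg_part z = (if z mod 2 = 0 then 0 else Suc (z div 2))"

definition pos_sum :: "nat \<Rightarrow> nat \<Rightarrow> nat \<Rightarrow> nat \<Rightarrow> nat \<Rightarrow> nat \<Rightarrow> nat \<Rightarrow> nat \<Rightarrow> nat" where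
  "pos_sum n y m t l v a b =
     (\<Sum>i<l. if 0 < dropc l i then pos_part (pfst (nthc l i)) * succ_count n y m t (nthc l i) v a b else 0)"

definition neg_sum :: "nat \<Rightarrow> nat \<Rightarrow> nat \<Rightarrow> nat \<Rightarrow> nat \<Rightarrow> nat \<Rightarrow> nat \<Rightarrow> nat \<Rightarrow> nat" where
  "neg_sum n y m t l v a b =
     (\<Sum>i<l. if 0 < dropc l i then neg_part (pfst (nthc l i)) * succ_count n y m t (nthc l i) v a b else 0)"

definition cmp_code_holds :: "nat \<Rightarrow> nat \<Rightarrow> nat \<Rightarrow> bool" where
  "cmp_code_holds k s s' \<longleftrightarrow> (pfst k = 0 \<and> s = s') \<or> (pfst k = 1 \<and> s \<noteq> s') \<or> (pfst k = 2 \<and> s \<le> s') \<or> (pfst k = 3 \<and> s' \<le> s)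
     \<or> (pfst k = 4 \<and> s < s') \<or> (pfst k = 5 \<and> s' < s) \<or> (pfst k = 6 \<and> s mod psnd k = s' mod psnd k)
     \<or> (pfst k = 7 \<and> s mod psnd k \<noteq> s' mod psnd k)"

definition agree_off :: "nat \<Rightarrow> nat \<Rightarrow> nat \<Rightarrow> nat \<Rightarrow> nat \<Rightarrow> bool" where
  "agree_off q a b a' b' \<longleftrightarrow> (pfst q = 0 \<longrightarrow> a' = a) \<and> (psnd q = 0 \<longrightarrow> b' = b)"

text \<open>Negative parts are moved across the comparison, so that only natural numbers
  occur.\<close>

definition pres_holds :: "nat \<Rightarrow> nat \<Rightarrow> nat \<Rightarrow> nat \<Rightarrow> nat \<Rightarrow> nat \<Rightarrow> nat \<Rightarrow> bool" where
  "pres_holds n y m t r a b \<longleftrightarrow> cmp_code_holds (pfst (psnd (psnd r)))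
     (pos_sum n y m t (pfst (psnd r)) (pfst r) a b + neg_part (psnd (psnd (psnd r))))
     (neg_sum n y m t (pfst (psnd r)) (pfst r) a b + pos_part (psnd (psnd (psnd r))))"

definition sat_code :: "nat \<Rightarrow> nat \<Rightarrow> nat \<Rightarrow> nat \<Rightarrow> nat \<Rightarrow> nat \<Rightarrow> nat \<Rightarrow> nat \<Rightarrow> bool" where
  "sat_code n x y m t c a b \<longleftrightarrow> (pfst c = 0 \<and> atom_holds x y (psnd c) a b)
     \<or> (pfst c = 1 \<and> sel (pfst (psnd c)) a b = sel (psnd (psnd c)) a b)
     \<or> (pfst c = 2 \<and> \<not> lookup n m t (psnd c) a b)
     \<or> (pfst c = 3 \<and> lookup n m t (pfst (psnd c)) a b \<and> lookup n m t (psnd (psnd c)) a b)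
     \<or> (pfst c = 4 \<and> (lookup n m t (pfst (psnd c)) a b \<or> lookup n m t (psnd (psnd c)) a b))
     \<or> (pfst c = 5 \<and> (\<exists>a'<n. \<exists>b'<n. agree_off (pfst (psnd c)) a b a' b' \<and> atom_holds x y (pfst (psnd (psnd c))) a' b'
          \<and> lookup n m t (psnd (psnd (psnd c))) a' b'))
     \<or> (pfst c = 6 \<and> (\<forall>a'<n. \<forall>b'<n. agree_off (pfst (psnd c)) a b a' b' \<longrightarrow> atom_holds x y (pfst (psnd (psnd c))) a' b'
          \<longrightarrow> lookup n m t (psnd (psnd (psnd c))) a' b'))
     \<or> (pfst c = 7 \<and> pres_holds n y m t (psnd c) a b)"

text \<open>The triple of a formula code \<open>c\<close> and the values \<open>a\<close>, \<open>b\<close> of the two variables is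
  flattened to \<open>(c * n + a) * n + b\<close>, where \<open>n\<close> is the size of the domain.\<close>

definition sat_step :: "nat \<Rightarrow> nat \<Rightarrow> nat \<Rightarrow> nat \<Rightarrow> nat \<Rightarrow> nat" where
  "sat_step n x y m t = of_bool (sat_code n x y m t (m div n div n) (m div n mod n) (m mod n))"

definition sat_val :: "nat \<Rightarrow> nat \<Rightarrow> nat \<Rightarrow> nat \<Rightarrow> nat" where
  "sat_val n x y m = sat_step n x y m (tab (sat_step n x y) m)"

section \<open>Computability of the evaluation and of the size bound\<close>

lemmas cf_intros' = cf_intros cf_tab_entry

lemma cf_sel: "cf n a \<Longrightarrow> cf n b \<Longrightarrow> cf n c \<Longrightarrow> cf n (\<lambda>xs. sel (a xs) (b xs) (c xs))"
  by (rule cf_comp3[where F = sel]) (unfold sel_def, intro cf_intros)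

lemma cf_dropc: "cf n a \<Longrightarrow> cf n b \<Longrightarrow> cf n (\<lambda>xs. dropc (a xs) (b xs))"
  by (rule cf_comp2[where F = dropc]) (unfold dropc_def, intro cf_intros)

lemma cf_nthc: "cf n a \<Longrightarrow> cf n b \<Longrightarrow> cf n (\<lambda>xs. nthc (a xs) (b xs))"
  unfolding nthc_def by (intro cf_intros cf_dropc)

lemma cf_wf_code: "cf n a \<Longrightarrow> cf n b \<Longrightarrow> cf n (\<lambda>xs. of_bool (wf_code (a xs) (b xs)))"
  by (rule cf_comp2[where F = "\<lambda>c t. of_bool (wf_code c t)"])
    (unfold wf_code_def is_atom_code_def is_cmp_code_def guard_ok_def pres_ok_def in_atom_code_def memc_def,
      (intro cf_intros' cf_sel cf_dropc cf_nthc | simp only: arg_tl)+)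

lemma cf_free_code: "cf n a \<Longrightarrow> cf n b \<Longrightarrow> cf n c \<Longrightarrow> cf n (\<lambda>xs. of_bool (free_code (a xs) (b xs) (c xs)))"
  unfolding free_code_def in_atom_code_def memc_def by (intro cf_intros' cf_sel)

lemma cf_vars_val: "cf n a \<Longrightarrow> cf n (\<lambda>xs. vars_val (a xs))"
  by (rule cf_comp1[where F = vars_val])
    (unfold vars_val_def vars_step_def, intro cf_intros' cf_tab cf_wf_code cf_free_code)

lemma cf_atom_holds: "cf n x \<Longrightarrow> cf n y \<Longrightarrow> cf n g \<Longrightarrow> cf n a \<Longrightarrow> cf n b \<Longrightarrow>
    cf n (\<lambda>xs. of_bool (atom_holds (x xs) (y xs) (g xs) (a xs) (b xs)))"
  unfolding atom_holds_def by (intro cf_intros' cf_sel)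

lemma cf_lookup: "cf n' n \<Longrightarrow> cf n' m \<Longrightarrow> cf n' t \<Longrightarrow> cf n' e \<Longrightarrow> cf n' a \<Longrightarrow> cf n' b \<Longrightarrow>
    cf n' (\<lambda>xs. of_bool (lookup (n xs) (m xs) (t xs) (e xs) (a xs) (b xs)))"
  unfolding lookup_def by (intro cf_intros')

lemma cf_succ_count: "cf n' n \<Longrightarrow> cf n' y \<Longrightarrow> cf n' m \<Longrightarrow> cf n' t \<Longrightarrow> cf n' e \<Longrightarrow> cf n' v \<Longrightarrow> cf n' a \<Longrightarrow> cf n' b \<Longrightarrow>
    cf n' (\<lambda>xs. succ_count (n xs) (y xs) (m xs) (t xs) (e xs) (v xs) (a xs) (b xs))"
  by (rule cf_comp8[where F = succ_count])
    (unfold succ_count_def, (intro cf_intros' cf_sel cf_lookup | simp only: arg_tl)+)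

lemma cf_pos_part: "cf n a \<Longrightarrow> cf n (\<lambda>xs. pos_part (a xs))"
  and cf_neg_part: "cf n a \<Longrightarrow> cf n (\<lambda>xs. neg_part (a xs))"
  unfolding pos_part_def neg_part_def by (intro cf_intros'; assumption)+

lemma cf_pos_sum: "cf n' n \<Longrightarrow> cf n' y \<Longrightarrow> cf n' m \<Longrightarrow> cf n' t \<Longrightarrow> cf n' e \<Longrightarrow> cf n' v \<Longrightarrow> cf n' a \<Longrightarrow> cf n' b \<Longrightarrow>
    cf n' (\<lambda>xs. pos_sum (n xs) (y xs) (m xs) (t xs) (e xs) (v xs) (a xs) (b xs))"
  by (rule cf_comp8[where F = pos_sum])
    (unfold pos_sum_def, (intro cf_intros' cf_dropc cf_nthc cf_pos_part cf_succ_count | simp only: arg_tl)+)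

lemma cf_neg_sum: "cf n' n \<Longrightarrow> cf n' y \<Longrightarrow> cf n' m \<Longrightarrow> cf n' t \<Longrightarrow> cf n' e \<Longrightarrow> cf n' v \<Longrightarrow> cf n' a \<Longrightarrow> cf n' b \<Longrightarrow>
    cf n' (\<lambda>xs. neg_sum (n xs) (y xs) (m xs) (t xs) (e xs) (v xs) (a xs) (b xs))"
  by (rule cf_comp8[where F = neg_sum])
    (unfold neg_sum_def, (intro cf_intros' cf_dropc cf_nthc cf_neg_part cf_succ_count | simp only: arg_tl)+)

lemma cf_sat_code: "cf n' n \<Longrightarrow> cf n' x \<Longrightarrow> cf n' y \<Longrightarrow> cf n' m \<Longrightarrow> cf n' t \<Longrightarrow> cf n' c \<Longrightarrow> cf n' a \<Longrightarrow> cf n' b \<Longrightarrow>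
    cf n' (\<lambda>xs. of_bool (sat_code (n xs) (x xs) (y xs) (m xs) (t xs) (c xs) (a xs) (b xs)))"
  by (rule cf_comp8[where F = "\<lambda>n x y m t c a b. of_bool (sat_code n x y m t c a b)"])
    (unfold sat_code_def agree_off_def pres_holds_def cmp_code_holds_def,
      (intro cf_intros' cf_sel cf_atom_holds cf_lookup cf_pos_sum cf_neg_sum cf_pos_part cf_neg_part | simp only: arg_tl)+)

lemma cf_sat_val: "cf n' n \<Longrightarrow> cf n' x \<Longrightarrow> cf n' y \<Longrightarrow> cf n' m \<Longrightarrow> cf n' (\<lambda>xs. sat_val (n xs) (x xs) (y xs) (m xs))"
  by (rule cf_comp4[where F = sat_val])
    (unfold sat_val_def sat_step_def, (intro cf_intros' cf_tab cf_sat_code | simp only: arg_tl)+)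

lemma zsb_eq_rec: "zsb m C = rec_nat 1 (\<lambda>_ z. z * (2 * (C * z) + 1)) m"
  by (induction m) simp_all

lemma cf_zsb: "cf n a \<Longrightarrow> cf n b \<Longrightarrow> cf n (\<lambda>xs. zsb (a xs) (b xs))"
  by (rule cf_comp2[where F = zsb]) (unfold zsb_eq_rec, (intro cf_intros | simp only: arg_tl)+)

lemma cf_item_bound: "cf n a \<Longrightarrow> cf n b \<Longrightarrow> cf n c \<Longrightarrow> cf n d \<Longrightarrow> cf n (\<lambda>xs. item_bound (a xs) (b xs) (c xs) (d xs))"
  by (rule cf_comp4[where F = item_bound])
    (unfold item_bound_def, (intro cf_intros cf_zsb | simp only: arg_tl)+)

lemma cf_size_bound: "cf n a \<Longrightarrow> cf n (\<lambda>xs. size_bound (a xs))"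
  unfolding size_bound_def Let_def graph_bound_def items_bound_def code_bound_def list_encode.simps
  by (intro cf_intros cf_item_bound cf_zsb)

section \<open>Correctness of the evaluation\<close>

definition mask :: "var set \<Rightarrow> nat" where
  "mask X = 1 + (of_bool (VX \<in> X) + 2 * of_bool (VY \<in> X))"

lemma memc_mask: "memc (mask X) (enc_var v) \<longleftrightarrow> v \<in> X"
  by (cases v) (auto simp: memc_def mask_def)

lemma mask_pos: "0 < mask X"
  by (simp add: mask_def)

lemma mask_eq_1: "mask X = 1 \<longleftrightarrow> X = {}"
proof -
  have "X = {} \<longleftrightarrow> (\<forall>v. v \<notin> X)" by auto
  also have "\<dots> \<longleftrightarrow> VX \<notin> X \<and> VY \<notin> X" by (rule all_var)
  finally show ?thesis by (simp add: mask_def)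
qed

lemma vars_step_mask:
  assumes "wf_code c t" "\<And>v. free_code c t (enc_var v) \<longleftrightarrow> v \<in> X"
  shows "vars_step c t = mask X"
  using assms(1) assms(2)[of VX] assms(2)[of VY] by (simp add: vars_step_def mask_def)

lemma all_less_2: "(\<forall>w<2. P w) \<longleftrightarrow> (\<forall>v. P (enc_var v))"
proof -
  have "w < 2 \<longleftrightarrow> w = 0 \<or> w = 1" for w :: nat by auto
  then show ?thesis by (auto simp: all_var)
qed

lemma enc_var_less_2: "enc_var v < 2"
  by (cases v) auto

lemma is_atom_code_enc: "is_atom_code (enc_atom g)"
  by (cases g) (auto simp: is_atom_code_def enc_var_less_2)

lemma in_atom_code_enc: "in_atom_code (enc_atom g) (enc_var v) \<longleftrightarrow> v \<in> avars g"
  by (cases g) (auto simp: in_atom_code_def enc_var_inj)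

lemma sel_enc_var: "sel (enc_var v) a b = as a b v"
  by (cases v) (auto simp: sel_def)

lemma sel_vset: "sel (enc_var v) (pfst (enc_vset Q)) (psnd (enc_vset Q)) = 1 \<longleftrightarrow> v \<in> Q"
  by (cases v) (auto simp: sel_def enc_vset_def)

lemma enc_vset_less: "pfst (enc_vset Q) < 2" "psnd (enc_vset Q) < 2"
  by (auto simp: enc_vset_def)

lemma psnd_0: "psnd 0 = 0"
proof -
  have "prod_encode (0, 0) = 0" by (simp add: prod_encode_def)
  then show ?thesis by (metis psnd_encode)
qed

lemma dropc_list_encode: "dropc (list_encode xs) i = list_encode (drop i xs)"
proof (induction i)
  case (Suc i)
  have "psnd (list_encode ys - 1) = list_encode (tl ys)" for ys
    by (cases ys) (simp_all add: psnd_0)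
  moreover have "dropc (list_encode xs) (Suc i) = psnd (dropc (list_encode xs) i - 1)"
    by (simp add: dropc_def)
  ultimately show ?case using Suc by (simp add: tl_drop drop_Suc)
qed (simp add: dropc_def)

lemma dropc_pos: "0 < dropc (list_encode xs) i \<longleftrightarrow> i < length xs"
proof -
  have "0 < list_encode ys \<longleftrightarrow> ys \<noteq> []" for ys by (cases ys) auto
  then show ?thesis by (simp add: dropc_list_encode not_le)
qed

lemma nthc_list_encode: "i < length xs \<Longrightarrow> nthc (list_encode xs) i = xs ! i"
  by (simp add: nthc_def dropc_list_encode flip: Cons_nth_drop_Suc)

lemma gt_vars: "i < c \<Longrightarrow> tab_entry c (tab vars_step c) i = vars_val i"
  by (simp add: gt_tab vars_val_def)

lemma is_cmp_code_enc: "cmp_ok c \<Longrightarrow> is_cmp_code (enc_cmp c)"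
  by (cases c) (auto simp: is_cmp_code_def)

text \<open>Table entries of subformulas are available because their codes are smaller. That no
  other numbers are accepted is \<open>vars_val_pos\<close>.\<close>

lemma vars_val_enc: "wf \<phi> \<Longrightarrow> vars_val (enc \<phi>) = mask (fv \<phi>)"
proof (induction \<phi> rule: fm_induct)
  case (Atom a)
  show ?case unfolding vars_val_def
    by (rule vars_step_mask)
      (simp_all add: wf_code_def free_code_def is_atom_code_enc in_atom_code_enc)
next
  case (Eq v w)
  show ?case unfolding vars_val_def
    by (rule vars_step_mask) (auto simp: wf_code_def free_code_def enc_var_less_2 enc_var_inj)
next
  case (Neg \<phi>)
  note 1 = gt_vars[OF enc_less(1)] Neg.IH
  show ?case unfolding vars_val_def
    by (rule vars_step_mask)
      (use 1 Neg.prems in \<open>simp_all add: wf_code_def free_code_def memc_mask mask_pos\<close>)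
next
  case (Conj \<phi> \<psi>)
  note 1 = enc_less(2)[of \<phi> \<psi>, THEN gt_vars] enc_less(3)[of \<psi> \<phi>, THEN gt_vars] Conj.IH
  show ?case unfolding vars_val_def
    by (rule vars_step_mask)
      (use 1 Conj.prems in \<open>simp_all add: wf_code_def free_code_def memc_mask mask_pos\<close>)
next
  case (Disj \<phi> \<psi>)
  note 1 = enc_less(4)[of \<phi> \<psi>, THEN gt_vars] enc_less(5)[of \<psi> \<phi>, THEN gt_vars] Disj.IH
  show ?case unfolding vars_val_def
    by (rule vars_step_mask)
      (use 1 Disj.prems in \<open>simp_all add: wf_code_def free_code_def memc_mask mask_pos\<close>)
next
  case (ExG Q g \<phi>)
  note 1 = gt_vars[OF enc_less(6)] ExG.IH
  have Q: "Q \<subseteq> avars g" "fv \<phi> \<subseteq> avars g" using ExG.prems by simp_all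
  have g: "guard_ok (enc_vset Q) (enc_atom g) (mask (fv \<phi>))"
    using Q unfolding guard_ok_def all_less_2
    by (auto simp: sel_vset[unfolded One_nat_def] in_atom_code_enc memc_mask mask_pos is_atom_code_enc enc_vset_less)
  show ?case unfolding vars_val_def
    by (rule vars_step_mask)
      (use 1 g Q ExG.prems in \<open>auto simp: wf_code_def free_code_def memc_mask mask_pos sel_vset[unfolded One_nat_def] in_atom_code_enc\<close>)
next
  case (AllG Q g \<phi>)
  note 1 = gt_vars[OF enc_less(7)] AllG.IH
  have Q: "Q \<subseteq> avars g" "fv \<phi> \<subseteq> avars g" using AllG.prems by simp_all
  have g: "guard_ok (enc_vset Q) (enc_atom g) (mask (fv \<phi>))"
    using Q unfolding guard_ok_def all_less_2
    by (auto simp: sel_vset[unfolded One_nat_def] in_atom_code_enc memc_mask mask_pos is_atom_code_enc enc_vset_less)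
  show ?case unfolding vars_val_def
    by (rule vars_step_mask)
      (use 1 g Q AllG.prems in \<open>auto simp: wf_code_def free_code_def memc_mask mask_pos sel_vset[unfolded One_nat_def] in_atom_code_enc\<close>)
next
  case (Pres v ts c d)
  let ?c = "enc (Pres v ts c d)" and ?l = "list_encode (map enc_term ts)"
  have ts: "ts \<noteq> []" and c: "cmp_ok c" and wf: "\<And>l R i \<phi>. (l, R, i, \<phi>) \<in> set ts \<Longrightarrow> wf \<phi>"
    using Pres.prems by fastforce+
  have "pres_ok ?c (tab vars_step ?c) ?l"
    unfolding pres_ok_def dropc_pos
  proof (intro allI impI)
    fix j assume "j < length (map enc_term ts)"
    then have j: "nthc ?l j = enc_term (ts ! j)" "ts ! j \<in> set ts" by (simp_all add: nthc_list_encode)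
    obtain l R i \<phi> where t: "ts ! j = (l, R, i, \<phi>)" by (cases "ts ! j")
    from gt_vars[OF enc_less_Pres[OF j(2)[unfolded t]]] Pres.IH[OF j(2)[unfolded t] wf[OF j(2)[unfolded t]]]
    show "pfst (psnd (psnd (nthc ?l j))) < 2 \<and> 0 < tab_entry ?c (tab vars_step ?c) (psnd (psnd (psnd (nthc ?l j))))"
      unfolding j(1) t by (simp add: enc_term_def mask_pos)
  qed
  moreover have "0 < ?l" using ts by (cases ts) auto
  ultimately show ?case unfolding vars_val_def
    using is_cmp_code_enc[OF c]
    by (intro vars_step_mask; unfold enc_Pres) (auto simp: wf_code_def free_code_def enc_var_less_2 enc_var_inj)
qed

section \<open>Recovering formulas from accepted codes\<close>

lemma var_code: "w < 2 \<Longrightarrow> \<exists>v. enc_var v = w"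
  by (cases w) (auto intro: exI[of _ VX] exI[of _ VY])

lemma vset_code: "pfst q < 2 \<Longrightarrow> psnd q < 2 \<Longrightarrow> \<exists>Q. enc_vset Q = q"
proof -
  assume "pfst q < 2" "psnd q < 2"
  then have "enc_vset {v. as (pfst q) (psnd q) v = 1} = prod_encode (pfst q, psnd q)"
    by (auto simp: enc_vset_def of_bool_def less_2_cases_iff)
  then show ?thesis unfolding prod_encode_pfst_psnd by blast
qed

lemma atom_code:
  assumes "is_atom_code g"
  shows "\<exists>a. enc_atom a = g"
proof -
  consider "pfst g = 0" "psnd (psnd g) < 2" | "pfst g = 1" "pfst (psnd (psnd g)) < 2" "psnd (psnd (psnd g)) < 2"
    using assms by (auto simp: is_atom_code_def)
  then show ?thesis
  proof cases
    case 1
    obtain v where v: "enc_var v = psnd (psnd g)" using var_code[OF 1(2)] by blast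
    have "enc_atom (UA (pfst (psnd g)) v) = prod_encode (pfst g, psnd g)"
      by (simp add: v 1 prod_encode_pfst_psnd)
    then show ?thesis unfolding prod_encode_pfst_psnd by blast
  next
    case 2
    obtain v w where v: "enc_var v = pfst (psnd (psnd g))" "enc_var w = psnd (psnd (psnd g))"
      using var_code[OF 2(2)] var_code[OF 2(3)] by blast
    have "enc_atom (BA (pfst (psnd g)) v w) = prod_encode (pfst g, psnd g)"
      by (simp add: v 2 prod_encode_pfst_psnd)
    then show ?thesis unfolding prod_encode_pfst_psnd by blast
  qed
qed

lemma cmp_code:
  assumes "is_cmp_code k"
  shows "\<exists>c. cmp_ok c \<and> enc_cmp c = k"
proof -
  have k: "k = prod_encode (pfst k, psnd k)" by (simp add: prod_encode_pfst_psnd)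
  have "pfst k = 0 \<or> pfst k = 1 \<or> pfst k = 2 \<or> pfst k = 3 \<or> pfst k = 4 \<or> pfst k = 5 \<or> pfst k = 6 \<or> pfst k = 7"
    using assms by (auto simp: is_cmp_code_def)
  then show ?thesis
  proof (elim disjE)
    assume "pfst k = 0" with assms k show ?thesis by (intro exI[of _ CEq]) (auto simp: is_cmp_code_def)
  next
    assume "pfst k = 1" with assms k show ?thesis by (intro exI[of _ CNe]) (auto simp: is_cmp_code_def)
  next
    assume "pfst k = 2" with assms k show ?thesis by (intro exI[of _ CLe]) (auto simp: is_cmp_code_def)
  next
    assume "pfst k = 3" with assms k show ?thesis by (intro exI[of _ CGe]) (auto simp: is_cmp_code_def)
  next
    assume "pfst k = 4" with assms k show ?thesis by (intro exI[of _ CLt]) (auto simp: is_cmp_code_def)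
  next
    assume "pfst k = 5" with assms k show ?thesis by (intro exI[of _ CGt]) (auto simp: is_cmp_code_def)
  next
    assume "pfst k = 6" with assms k show ?thesis by (intro exI[of _ "CCong (psnd k)"]) (auto simp: is_cmp_code_def)
  next
    assume "pfst k = 7" with assms k show ?thesis by (intro exI[of _ "CNCong (psnd k)"]) (auto simp: is_cmp_code_def)
  qed
qed

text \<open>Strong induction, rebuilding the formula from its components. In the quantifier cases
  the guard test speaks about the table entry of the body; \<open>vars_val_enc\<close>, applied to
  the decoded body, identifies this entry with the mask of its free variables.\<close>

lemma vars_val_pos: "0 < vars_val c \<Longrightarrow> \<exists>\<phi>. wf \<phi> \<and> enc \<phi> = c"
proof (induction c rule: less_induct)
  case (less c)
  let ?t = "tab vars_step c" and ?r = "psnd c"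
  have c: "prod_encode (pfst c, ?r) = c" by (rule prod_encode_pfst_psnd)
  have r: "?r < c" if "1 \<le> pfst c" using snd_less_prod_encode[OF that, of ?r] c by simp
  have p: "pfst z \<le> z" "psnd z \<le> z" for z
    using prod_encode_leD[of "pfst z" "psnd z" z] by (simp_all add: prod_encode_pfst_psnd)
  have sub: "\<exists>\<phi>. wf \<phi> \<and> enc \<phi> = i" if "0 < tab_entry c ?t i" "i < c" for i
    using less.IH[of i] that gt_vars by simp
  have "wf_code c ?t" using less.prems by (simp add: vars_val_def vars_step_def split: if_splits)
  then consider (Atom) "pfst c = 0" "is_atom_code ?r"
    | (Eq) "pfst c = 1" "pfst ?r < 2" "psnd ?r < 2"
    | (Neg) "pfst c = 2" "0 < tab_entry c ?t ?r"
    | (Bin) "pfst c = 3 \<or> pfst c = 4" "0 < tab_entry c ?t (pfst ?r)" "0 < tab_entry c ?t (psnd ?r)"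
    | (Quant) "pfst c = 5 \<or> pfst c = 6" "guard_ok (pfst ?r) (pfst (psnd ?r)) (tab_entry c ?t (psnd (psnd ?r)))"
    | (Pres) "pfst c = 7" "pfst ?r < 2" "0 < pfst (psnd ?r)" "is_cmp_code (pfst (psnd (psnd ?r)))"
        "pres_ok c ?t (pfst (psnd ?r))"
    unfolding wf_code_def by (elim disjE conjE) blast+
  then show ?case
  proof cases
    case Atom
    then obtain a where "enc_atom a = ?r" using atom_code by blast
    then have "wf (fm.Atom a) \<and> enc (fm.Atom a) = c" using c Atom(1) by simp
    then show ?thesis by blast
  next
    case Eq
    then obtain v w where "enc_var v = pfst ?r" "enc_var w = psnd ?r" using var_code by blast
    then have "wf (fm.Eq v w) \<and> enc (fm.Eq v w) = c" using c Eq(1) by (simp add: prod_encode_pfst_psnd)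
    then show ?thesis by blast
  next
    case Neg
    then obtain \<phi> where "wf \<phi>" "enc \<phi> = ?r" using sub r by auto
    then have "wf (fm.Neg \<phi>) \<and> enc (fm.Neg \<phi>) = c" using c Neg(1) by simp
    then show ?thesis by blast
  next
    case Bin
    have "?r < c" using r Bin(1) by auto
    then have "pfst ?r < c" "psnd ?r < c" using p[of ?r] by linarith+
    then obtain \<phi> \<psi> where f: "wf \<phi>" "enc \<phi> = pfst ?r" "wf \<psi>" "enc \<psi> = psnd ?r" using sub Bin(2,3) by metis
    from Bin(1) show ?thesis
    proof
      assume "pfst c = 3"
      then have "wf (Conj \<phi> \<psi>) \<and> enc (Conj \<phi> \<psi>) = c" using c f by (simp add: prod_encode_pfst_psnd)
      then show ?thesis by blast
    next
      assume "pfst c = 4"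
      then have "wf (Disj \<phi> \<psi>) \<and> enc (Disj \<phi> \<psi>) = c" using c f by (simp add: prod_encode_pfst_psnd)
      then show ?thesis by blast
    qed
  next
    case Quant
    have "?r < c" using r Quant(1) by auto
    then have e: "psnd (psnd ?r) < c" using p(2)[of ?r] p(2)[of "psnd ?r"] by linarith
    have q: "pfst (pfst ?r) < 2" "psnd (pfst ?r) < 2" "is_atom_code (pfst (psnd ?r))" "0 < tab_entry c ?t (psnd (psnd ?r))"
      using Quant(2) unfolding guard_ok_def by blast+
    obtain Q where Q: "enc_vset Q = pfst ?r" using vset_code[OF q(1,2)] by blast
    obtain g where g: "enc_atom g = pfst (psnd ?r)" using atom_code[OF q(3)] by blast
    obtain \<phi> where \<phi>: "wf \<phi>" "enc \<phi> = psnd (psnd ?r)" using sub[OF q(4) e] by blast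
    have "tab_entry c ?t (psnd (psnd ?r)) = mask (fv \<phi>)" using gt_vars[OF e] vars_val_enc[OF \<phi>(1)] \<phi>(2) by simp
    then have "\<forall>v. (v \<in> Q \<longrightarrow> v \<in> avars g) \<and> (v \<in> fv \<phi> \<longrightarrow> v \<in> avars g)"
      using Quant(2) unfolding guard_ok_def all_less_2 Q[symmetric] g[symmetric] sel_vset in_atom_code_enc
      by (simp add: memc_mask)
    then have wf: "wf (ExG Q g \<phi>)" "wf (AllG Q g \<phi>)" using \<phi>(1) by auto
    from Quant(1) show ?thesis
    proof
      assume "pfst c = 5"
      then have "enc (ExG Q g \<phi>) = c" using c Q g \<phi> by (simp add: prod_encode_pfst_psnd)
      then show ?thesis using wf by blast
    next
      assume "pfst c = 6"
      then have "enc (AllG Q g \<phi>) = c" using c Q g \<phi> by (simp add: prod_encode_pfst_psnd)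
      then show ?thesis using wf by blast
    qed
  next
    case Pres
    define xs where "xs = list_decode (pfst (psnd ?r))"
    have l: "pfst (psnd ?r) = list_encode xs" by (simp add: xs_def)
    obtain v where v: "enc_var v = pfst ?r" using var_code[OF Pres(2)] by blast
    obtain k where k: "cmp_ok k" "enc_cmp k = pfst (psnd (psnd ?r))" using cmp_code[OF Pres(4)] by blast
    have rc: "?r < c" using r Pres(1) by auto
    have ex: "\<exists>\<phi>. wf \<phi> \<and> enc_term (int_decode (pfst x), pfst (psnd x), pfst (psnd (psnd x)) = 1, \<phi>) = x"
      if x: "x \<in> set xs" for x
    proof -
      obtain j where j: "j < length xs" "xs ! j = x" using x by (auto simp: in_set_conv_nth)
      then have jl: "j < list_encode xs" using length_le_list_encode[of xs] by linarith
      have ok: "pfst (psnd (psnd x)) < 2" "0 < tab_entry c ?t (psnd (psnd (psnd x)))"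
        using Pres(5) jl j unfolding pres_ok_def l dropc_pos by (metis nthc_list_encode)+
      have "x \<le> pfst (psnd ?r)" unfolding l using x by (rule member_le_list_encode)
      then have "psnd (psnd (psnd x)) < c"
        using rc p(2)[of ?r] p(1)[of "psnd ?r"] p(2)[of x] p(2)[of "psnd x"] p(2)[of "psnd (psnd x)"] by linarith
      from sub[OF ok(2) this] obtain \<phi> where \<phi>: "wf \<phi>" "enc \<phi> = psnd (psnd (psnd x))" by blast
      have "of_bool (pfst (psnd (psnd x)) = 1) = pfst (psnd (psnd x))" using ok(1) by (auto simp: less_2_cases_iff)
      then have "enc_term (int_decode (pfst x), pfst (psnd x), pfst (psnd (psnd x)) = 1, \<phi>) = x"
        unfolding enc_term_def prod.case \<phi>(2) by (simp add: prod_encode_pfst_psnd)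
      then show ?thesis using \<phi>(1) by blast
    qed
    define F where "F x = (SOME \<phi>. wf \<phi> \<and> enc_term (int_decode (pfst x), pfst (psnd x), pfst (psnd (psnd x)) = 1, \<phi>) = x)" for x
    have F: "wf (F x) \<and> enc_term (int_decode (pfst x), pfst (psnd x), pfst (psnd (psnd x)) = 1, F x) = x" if "x \<in> set xs" for x
      unfolding F_def by (rule someI_ex[OF ex[OF that]])
    define ts where "ts = map (\<lambda>x. (int_decode (pfst x), pfst (psnd x), pfst (psnd (psnd x)) = 1, F x)) xs"
    have "map enc_term ts = xs" unfolding ts_def map_map comp_def by (rule map_idI) (use F in blast)
    then have "enc (fm.Pres v ts k (int_decode (psnd (psnd (psnd ?r))))) = c"
      unfolding enc_Pres using c Pres(1) by (simp add: v k l[symmetric] prod_encode_pfst_psnd)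
    moreover have "xs \<noteq> []" using Pres(3) l by auto
    then have "wf (fm.Pres v ts k (int_decode (psnd (psnd (psnd ?r)))))"
      using k(1) F by (auto simp: ts_def)
    ultimately show ?thesis by blast
  qed
qed

section \<open>Satisfaction in coded structures\<close>

lemma flat_index:
  fixes a b c n :: nat
  assumes "a < n" "b < n"
  shows "((c * n + a) * n + b) div n div n = c" "((c * n + a) * n + b) div n mod n = a" "((c * n + a) * n + b) mod n = b"
proof -
  have "((c * n + a) * n + b) div n = c * n + a" using assms by (simp add: div_add1_eq)
  then show "((c * n + a) * n + b) div n div n = c" "((c * n + a) * n + b) div n mod n = a" using assms by simp_all
qed (use assms in simp)

text \<open>The formula code is the leading part of the index, so passing to a subformula lowers the
  index even when quantifiers or counting change the assignment.\<close>

lemma flat_index_less: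
  fixes a b a' b' e c n :: nat
  assumes "e < c" "a' < n" "b' < n"
  shows "(e * n + a') * n + b' < (c * n + a) * n + b"
proof -
  have "e * n + a' + 1 \<le> c * n" using assms
    by (metis Suc_eq_plus1 Suc_leI add.commute add_less_cancel_left less_le_trans mult.commute mult_Suc_right mult_le_mono2)
  then have "(e * n + a' + 1) * n \<le> (c * n + a) * n" by (intro mult_le_mono1) simp
  then show ?thesis using assms by (simp add: algebra_simps)
qed

lemma sat_val_eq:
  fixes a b c n :: nat
  assumes "a < n" "b < n"
  defines "m \<equiv> (c * n + a) * n + b"
  shows "sat_val n x y m = of_bool (sat_code n x y m (tab (sat_step n x y) m) c a b)"
  using flat_index[OF assms(1,2), of c] by (simp add: sat_val_def sat_step_def m_def)

lemma gt_sat: "i < m \<Longrightarrow> tab_entry m (tab (sat_step n x y) m) i = sat_val n x y i"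
  by (simp add: gt_tab sat_val_def)

lemma atom_holds_enc: "atom_holds x y (enc_atom g) a b \<longleftrightarrow> asat (mk_struct n x y) g (as a b)"
  by (cases g) (auto simp: atom_holds_def mk_struct_def sel_enc_var)

lemma agree_off_enc: "agree_off (enc_vset Q) a b a' b' \<longleftrightarrow> (\<forall>v. v \<notin> Q \<longrightarrow> as a' b' v = as a b v)"
  by (auto simp: agree_off_def enc_vset_def all_var)

text \<open>Variables outside \<open>Q\<close> keep values below \<open>n\<close>, so assignments
  reduce to pairs of numbers below \<open>n\<close> and the quantification becomes bounded.\<close>

lemma ex_assignment:
  assumes "a < n" "b < n"
  shows "(\<exists>\<sigma>. (\<forall>v. v \<notin> Q \<longrightarrow> \<sigma> v = as a b v) \<and> (\<forall>v\<in>Q. \<sigma> v \<in> {..<n}) \<and> P \<sigma>)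
    \<longleftrightarrow> (\<exists>a'<n. \<exists>b'<n. agree_off (enc_vset Q) a b a' b' \<and> P (as a' b'))"
proof
  assume "\<exists>\<sigma>. (\<forall>v. v \<notin> Q \<longrightarrow> \<sigma> v = as a b v) \<and> (\<forall>v\<in>Q. \<sigma> v \<in> {..<n}) \<and> P \<sigma>"
  then obtain \<sigma> where \<sigma>: "\<forall>v. v \<notin> Q \<longrightarrow> \<sigma> v = as a b v" "\<forall>v\<in>Q. \<sigma> v \<in> {..<n}" "P \<sigma>" by blast
  have "\<sigma> v < n" for v using \<sigma>(1,2) assms by (cases "v \<in> Q"; cases v) auto
  then show "\<exists>a'<n. \<exists>b'<n. agree_off (enc_vset Q) a b a' b' \<and> P (as a' b')"
    using \<sigma>(1,3) unfolding agree_off_enc by (intro exI[of _ "\<sigma> VX"] exI[of _ "\<sigma> VY"] conjI) (simp_all add: as_eta)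
next
  assume "\<exists>a'<n. \<exists>b'<n. agree_off (enc_vset Q) a b a' b' \<and> P (as a' b')"
  then obtain a' b' where "a' < n" "b' < n" "\<forall>v. v \<notin> Q \<longrightarrow> as a' b' v = as a b v" "P (as a' b')"
    unfolding agree_off_enc by blast
  moreover from this(1,2) have "as a' b' v < n" for v by (cases v) auto
  ultimately show "\<exists>\<sigma>. (\<forall>v. v \<notin> Q \<longrightarrow> \<sigma> v = as a b v) \<and> (\<forall>v\<in>Q. \<sigma> v \<in> {..<n}) \<and> P \<sigma>"
    by (intro exI[of _ "as a' b'"]) simp
qed

lemma sum_list_code:
  "(\<Sum>i<list_encode xs. if 0 < dropc (list_encode xs) i then f (nthc (list_encode xs) i) else 0) = (\<Sum>x\<leftarrow>xs. f x :: nat)"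
proof -
  have "(\<Sum>i<list_encode xs. if 0 < dropc (list_encode xs) i then f (nthc (list_encode xs) i) else 0)
      = (\<Sum>i<length xs. if 0 < dropc (list_encode xs) i then f (nthc (list_encode xs) i) else 0)"
    using length_le_list_encode[of xs] by (intro sum.mono_neutral_right) (auto simp: dropc_pos)
  also have "\<dots> = (\<Sum>i<length xs. f (xs ! i))"
    by (intro sum.cong) (auto simp: dropc_pos nthc_list_encode)
  also have "\<dots> = (\<Sum>x\<leftarrow>xs. f x)" by (simp add: sum_list_sum_nth lessThan_atLeast0)
  finally show ?thesis .
qed

lemma pos_neg_part: "int (pos_part (int_encode l)) - int (neg_part (int_encode l)) = l"
proof -
  have "int (pos_part z) - int (neg_part z) = int_decode z" for z
    by (auto simp: pos_part_def neg_part_def int_decode_def sum_decode_def even_iff_mod_2_eq_zero)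
  then show ?thesis by simp
qed

text \<open>Adding the same amount to both sides preserves order and congruence; the threshold is
  split into a positive and a negative part.\<close>

lemma cmp_code_holds_enc:
  assumes "int dp - int dn = d"
  shows "cmp_code_holds (enc_cmp c) (p + dn) (q + dp) \<longleftrightarrow> cmp_holds c (int p - int q) d"
proof -
  have "(p + dn) mod m = (q + dp) mod m \<longleftrightarrow> (int p - int q) mod int m = d mod int m" for m
  proof -
    have "(p + dn) mod m = (q + dp) mod m \<longleftrightarrow> int (p + dn) mod int m = int (q + dp) mod int m"
      by (simp only: zmod_int[symmetric] of_nat_eq_iff)
    also have "\<dots> \<longleftrightarrow> int m dvd (int p - int q) - d"
      unfolding mod_eq_dvd_iff using assms by (simp add: algebra_simps)
    also have "\<dots> \<longleftrightarrow> (int p - int q) mod int m = d mod int m" by (simp only: mod_eq_dvd_iff)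
    finally show ?thesis .
  qed
  then show ?thesis using assms by (cases c) (auto simp: cmp_code_holds_def)
qed

lemma succ_count_enc:
  assumes lk: "\<And>a' b'. a' < n \<Longrightarrow> b' < n \<Longrightarrow> lookup n m t (enc \<phi>) a' b' \<longleftrightarrow> sat (mk_struct n x y) \<phi> (as a' b')"
    and ab: "a < n" "b < n"
  shows "succ_count n y m t (enc_term (l, R, i, \<phi>)) (enc_var v) a b
    = card {z \<in> dom (mk_struct n x y). rholds (mk_struct n x y) R i (as a b v) z \<and> sat (mk_struct n x y) \<phi> ((as a b)(other v := z))}"
proof -
  have "succ_count n y m t (enc_term (l, R, i, \<phi>)) (enc_var v) a b
    = (\<Sum>z<n. of_bool (rholds (mk_struct n x y) R i (as a b v) z \<and> sat (mk_struct n x y) \<phi> ((as a b)(other v := z))))"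
    unfolding succ_count_def
  proof (rule sum.cong[OF refl])
    fix z assume "z \<in> {..<n}"
    then have "lookup n m t (enc \<phi>) (sel (enc_var v) a z) (sel (enc_var v) z b) \<longleftrightarrow> sat (mk_struct n x y) \<phi> ((as a b)(other v := z))"
      using ab lk by (cases v) (simp_all add: sel_def)
    then show "of_bool (prod_encode (pfst (psnd (enc_term (l, R, i, \<phi>))),
         sel (pfst (psnd (psnd (enc_term (l, R, i, \<phi>))))) (prod_encode (sel (enc_var v) a b, z)) (prod_encode (z, sel (enc_var v) a b)))
        \<in> set_decode y \<and> lookup n m t (psnd (psnd (psnd (enc_term (l, R, i, \<phi>))))) (sel (enc_var v) a z) (sel (enc_var v) z b))
      = of_bool (rholds (mk_struct n x y) R i (as a b v) z \<and> sat (mk_struct n x y) \<phi> ((as a b)(other v := z)))"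
      by (cases i) (simp_all add: enc_term_def sel_enc_var rholds_def mk_struct_def, simp_all add: sel_def)
  qed
  also have "\<dots> = card {z \<in> dom (mk_struct n x y). rholds (mk_struct n x y) R i (as a b v) z \<and> sat (mk_struct n x y) \<phi> ((as a b)(other v := z))}"
    by (simp add: mk_struct_def of_bool_def sum.If_cases Int_def)
  finally show ?thesis .
qed

lemma pres_holds_enc:
  assumes lk: "\<And>l R i \<phi> a' b'. (l, R, i, \<phi>) \<in> set ts \<Longrightarrow> a' < n \<Longrightarrow> b' < n \<Longrightarrow>
      lookup n m t (enc \<phi>) a' b' \<longleftrightarrow> sat (mk_struct n x y) \<phi> (as a' b')"
    and ab: "a < n" "b < n"
  shows "pres_holds n y m t (prod_encode (enc_var v, prod_encode (list_encode (map enc_term ts), prod_encode (enc_cmp c, int_encode d)))) a b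
    \<longleftrightarrow> sat (mk_struct n x y) (Pres v ts c d) (as a b)"
proof -
  define cnt where "cnt = (\<lambda>(l :: int, R, i, \<phi>). card {z \<in> dom (mk_struct n x y). rholds (mk_struct n x y) R i (as a b v) z \<and> sat (mk_struct n x y) \<phi> ((as a b)(other v := z))})"
  have cnt: "succ_count n y m t (enc_term u) (enc_var v) a b = cnt u" if "u \<in> set ts" for u
    using succ_count_enc[OF lk ab] that by (cases u) (simp add: cnt_def)
  have fst: "pfst (enc_term u) = int_encode (fst u)" for u by (cases u) (simp add: enc_term_def)
  have p: "pos_sum n y m t (list_encode (map enc_term ts)) (enc_var v) a b = (\<Sum>u\<leftarrow>ts. pos_part (int_encode (fst u)) * cnt u)"
    unfolding pos_sum_def sum_list_code[of "map enc_term ts" "\<lambda>e. pos_part (pfst e) * succ_count n y m t e (enc_var v) a b"] map_map comp_def fst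
    using cnt by (intro arg_cong[where f = sum_list] map_cong) simp_all
  have q: "neg_sum n y m t (list_encode (map enc_term ts)) (enc_var v) a b = (\<Sum>u\<leftarrow>ts. neg_part (int_encode (fst u)) * cnt u)"
    unfolding neg_sum_def sum_list_code[of "map enc_term ts" "\<lambda>e. neg_part (pfst e) * succ_count n y m t e (enc_var v) a b"] map_map comp_def fst
    using cnt by (intro arg_cong[where f = sum_list] map_cong) simp_all
  have "int (\<Sum>u\<leftarrow>ts. pos_part (int_encode (fst u)) * cnt u) - int (\<Sum>u\<leftarrow>ts. neg_part (int_encode (fst u)) * cnt u)
    = (\<Sum>u\<leftarrow>ts. fst u * int (cnt u))"
  proof (induction ts)
    case (Cons u ts)
    have "fst u * int (cnt u) = int (pos_part (int_encode (fst u)) * cnt u) - int (neg_part (int_encode (fst u)) * cnt u)"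
      using pos_neg_part[of "fst u"] by (metis left_diff_distrib of_nat_mult)
    then show ?case using Cons by simp
  qed simp
  also have "\<dots> = (\<Sum>(l, R, i, \<phi>)\<leftarrow>ts. l * int (card {z \<in> dom (mk_struct n x y). rholds (mk_struct n x y) R i (as a b v) z \<and> sat (mk_struct n x y) \<phi> ((as a b)(other v := z))}))"
    by (intro arg_cong[where f = sum_list] map_cong) (auto simp: cnt_def)
  finally have diff: "int (pos_sum n y m t (list_encode (map enc_term ts)) (enc_var v) a b) - int (neg_sum n y m t (list_encode (map enc_term ts)) (enc_var v) a b)
    = (\<Sum>(l, R, i, \<phi>)\<leftarrow>ts. l * int (card {z \<in> dom (mk_struct n x y). rholds (mk_struct n x y) R i (as a b v) z \<and> sat (mk_struct n x y) \<phi> ((as a b)(other v := z))}))"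
    unfolding p q .
  show ?thesis
    unfolding pres_holds_def psnd_encode pfst_encode cmp_code_holds_enc[OF pos_neg_part] diff sat.simps ..
qed

lemma lookup_enc:
  assumes "sat_val n x y ((enc \<phi> * n + a') * n + b') = of_bool (sat (mk_struct n x y) \<phi> (as a' b'))"
    and "enc \<phi> < c" "a' < n" "b' < n"
  defines "m \<equiv> \<lambda>a b. (c * n + a) * n + b"
  shows "lookup n (m a b) (tab (sat_step n x y) (m a b)) (enc \<phi>) a' b' \<longleftrightarrow> sat (mk_struct n x y) \<phi> (as a' b')"
  unfolding lookup_def m_def using assms(1) gt_sat[OF flat_index_less[OF assms(2,3,4)]] by simp

text \<open>The values of the variables stay arbitrary in the induction, because quantifiers and
  counted terms consult the table at other assignments.\<close>

lemma sat_val_enc: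
  assumes "a < n" "b < n"
  shows "sat_val n x y ((enc \<phi> * n + a) * n + b) = of_bool (sat (mk_struct n x y) \<phi> (as a b))"
  using assms
proof (induction \<phi> arbitrary: a b rule: fm_induct)
  case (Atom g)
  show ?case using sat_val_eq[OF Atom, of x y "enc (fm.Atom g)"]
    by (simp add: sat_code_def atom_holds_enc[of x y g a b n])
next
  case (Eq v w)
  show ?case using sat_val_eq[OF Eq, of x y "enc (fm.Eq v w)"]
    by (simp add: sat_code_def sel_enc_var)
next
  case (Neg \<phi>)
  note lk = lookup_enc[OF Neg.IH[OF Neg.prems] enc_less(1) Neg.prems]
  show ?case unfolding sat_val_eq[OF Neg.prems] using lk by (simp add: sat_code_def)
next
  case (Conj \<phi> \<psi>)
  note lk = lookup_enc[OF Conj.IH(1)[OF Conj.prems] enc_less(2)[of \<phi> \<psi>] Conj.prems]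
    lookup_enc[OF Conj.IH(2)[OF Conj.prems] enc_less(3)[of \<psi> \<phi>] Conj.prems]
  show ?case unfolding sat_val_eq[OF Conj.prems] using lk by (simp add: sat_code_def)
next
  case (Disj \<phi> \<psi>)
  note lk = lookup_enc[OF Disj.IH(1)[OF Disj.prems] enc_less(4)[of \<phi> \<psi>] Disj.prems]
    lookup_enc[OF Disj.IH(2)[OF Disj.prems] enc_less(5)[of \<psi> \<phi>] Disj.prems]
  show ?case unfolding sat_val_eq[OF Disj.prems] using lk by (simp add: sat_code_def)
next
  case (ExG Q g \<phi>)
  define m where "m = (enc (fm.ExG Q g \<phi>) * n + a) * n + b"
  have lk: "lookup n m (tab (sat_step n x y) m) (enc \<phi>) a' b' \<longleftrightarrow> sat (mk_struct n x y) \<phi> (as a' b')"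
    if "a' < n" "b' < n" for a' b'
    unfolding m_def using that by (intro lookup_enc ExG.IH enc_less)
  have dom: "dom (mk_struct n x y) = {..<n}" by (simp add: mk_struct_def)
  have "sat_code n x y m (tab (sat_step n x y) m) (enc (ExG Q g \<phi>)) a b
    \<longleftrightarrow> (\<exists>a'<n. \<exists>b'<n. agree_off (enc_vset Q) a b a' b' \<and> asat (mk_struct n x y) g (as a' b') \<and> sat (mk_struct n x y) \<phi> (as a' b'))"
    using lk by (auto simp: sat_code_def atom_holds_enc[of x y g _ _ n])
  also have "\<dots> \<longleftrightarrow> sat (mk_struct n x y) (ExG Q g \<phi>) (as a b)"
    unfolding sat.simps dom by (rule ex_assignment[OF ExG.prems, symmetric])
  finally show ?case
    unfolding m_def[symmetric] sat_val_eq[OF ExG.prems, of x y "enc (ExG Q g \<phi>)", folded m_def] by (simp only:)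
next
  case (AllG Q g \<phi>)
  define m where "m = (enc (fm.AllG Q g \<phi>) * n + a) * n + b"
  have lk: "lookup n m (tab (sat_step n x y) m) (enc \<phi>) a' b' \<longleftrightarrow> sat (mk_struct n x y) \<phi> (as a' b')"
    if "a' < n" "b' < n" for a' b'
    unfolding m_def using that by (intro lookup_enc AllG.IH enc_less)
  have dom: "dom (mk_struct n x y) = {..<n}" by (simp add: mk_struct_def)
  have "sat_code n x y m (tab (sat_step n x y) m) (enc (AllG Q g \<phi>)) a b
    \<longleftrightarrow> \<not> (\<exists>a'<n. \<exists>b'<n. agree_off (enc_vset Q) a b a' b' \<and> asat (mk_struct n x y) g (as a' b') \<and> \<not> sat (mk_struct n x y) \<phi> (as a' b'))"
    using lk by (auto simp: sat_code_def atom_holds_enc[of x y g _ _ n])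
  also have "\<dots> \<longleftrightarrow> sat (mk_struct n x y) (AllG Q g \<phi>) (as a b)"
    unfolding sat_AllG sat.simps(3,6) dom
    by (subst ex_assignment[OF AllG.prems, symmetric]) (rule refl)
  finally show ?case
    unfolding m_def[symmetric] sat_val_eq[OF AllG.prems, of x y "enc (AllG Q g \<phi>)", folded m_def] by (simp only:)
next
  case (Pres v ts c d)
  let ?r = "prod_encode (enc_var v, prod_encode (list_encode (map enc_term ts), prod_encode (enc_cmp c, int_encode d)))"
  let ?m = "(enc (fm.Pres v ts c d) * n + a) * n + b"
  note lk = lookup_enc[OF Pres.IH enc_less_Pres]
  have "sat_code n x y ?m (tab (sat_step n x y) ?m) (enc (fm.Pres v ts c d)) a b
    \<longleftrightarrow> pres_holds n y ?m (tab (sat_step n x y) ?m) ?r a b"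
    unfolding enc_Pres by (simp add: sat_code_def)
  also have "\<dots> \<longleftrightarrow> sat (mk_struct n x y) (fm.Pres v ts c d) (as a b)"
    by (rule pres_holds_enc[OF lk Pres.prems])
  finally show ?case unfolding sat_val_eq[OF Pres.prems] by (simp only:)
qed

theorem mainTheorem11:
  shows "decidable_set {enc \<phi> | \<phi>. sentence \<phi> \<and> fin_sat \<phi>}"
proof -
  let ?S = "{enc \<phi> | \<phi>. sentence \<phi> \<and> fin_sat \<phi>}"
  \<comment> \<open>The value 1 of \<open>vars_val\<close> means well-formed with an empty mask of
    free variables. The index \<open>c * n * n\<close> is the flattened triple of \<open>c\<close>
    with both variables set to 0.\<close>
  define dec where "dec c \<longleftrightarrow> vars_val c = 1 \<and> (\<exists>n<Suc (size_bound c). 0 < n \<and> (\<exists>x<2 ^ Suc (prod_encode (c, n)).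
    \<exists>y<2 ^ Suc (prod_encode (c, prod_encode (n, n))). sat_val n x y (c * n * n) = 1))" for c
  have iff: "dec c \<longleftrightarrow> c \<in> ?S" for c
  proof
    assume "c \<in> ?S"
    then obtain \<phi> where \<phi>: "c = enc \<phi>" "sentence \<phi>" "fin_sat \<phi>" by blast
    have "vars_val c = 1" using \<phi>(2) vars_val_enc[of \<phi>] mask_eq_1 by (simp add: \<phi>(1) sentence_def)
    moreover obtain n x y where n: "n \<le> size_bound c" "0 < n" "x < 2 ^ Suc (prod_encode (c, n))"
      "y < 2 ^ Suc (prod_encode (c, prod_encode (n, n)))" "sat (mk_struct n x y) \<phi> (as 0 0)"
      using small_model_property[OF \<phi>(2,3)] unfolding \<phi>(1) by blast
    moreover have "sat_val n x y (c * n * n) = 1"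
      using sat_val_enc[OF n(2) n(2), of x y \<phi>] n(5) by (simp add: \<phi>(1))
    ultimately show "dec c" unfolding dec_def less_Suc_eq_le by blast
  next
    \<comment> \<open>Any structure found is a genuine finite model; the small model bound enters in
      the other direction.\<close>
    assume d: "dec c"
    then have "0 < vars_val c" by (simp add: dec_def)
    then obtain \<phi> where \<phi>: "wf \<phi>" "enc \<phi> = c" using vars_val_pos by blast
    have "vars_val c = 1" using d unfolding dec_def by blast
    then have "mask (fv \<phi>) = 1" using vars_val_enc[OF \<phi>(1)] by (simp only: \<phi>(2))
    then have "fv \<phi> = {}" unfolding mask_eq_1 .
    then have s: "sentence \<phi>" using \<phi>(1) by (simp add: sentence_def)
    obtain n x y where n: "0 < n" "sat_val n x y (c * n * n) = 1" using d unfolding dec_def by blast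
    have "sat_val n x y (c * n * n) = of_bool (sat (mk_struct n x y) \<phi> (as 0 0))"
      using sat_val_enc[OF n(1) n(1), of x y \<phi>] unfolding \<phi>(2) add_0_right .
    then have "sat (mk_struct n x y) \<phi> (as 0 0)"
      using n(2) by (cases "sat (mk_struct n x y) \<phi> (as 0 0)") simp_all
    moreover have "as 0 0 v = 0" for v by (cases v) auto
    ultimately have "fin_sat \<phi>" unfolding fin_sat_def using n(1)
      by (intro exI[of _ "mk_struct n x y"] exI[of _ "as 0 0"]) (auto simp: mk_struct_def)
    then show "c \<in> ?S" using s \<phi>(2) by blast
  qed
  have "cf 1 (\<lambda>xs. of_bool (dec (arg 0 xs)))"
    unfolding dec_def by (intro cf_intros' cf_vars_val cf_size_bound cf_sat_val | simp only: arg_tl)+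
  then obtain r where r: "\<forall>xs. length xs = 1 \<longrightarrow> rf_eval r xs (of_bool (dec (arg 0 xs)))"
    unfolding cf_def by blast
  have "rf_eval r [n] (if n \<in> ?S then 1 else 0)" for n
    using r[rule_format, of "[n]"] unfolding of_bool_def iff by simp
  then show ?thesis unfolding decidable_set_def by blast
qed

end
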